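(* For every $k\ge3$, $\mathrm{NCP}(k)=\mathrm{NCP}(k)^{\max}$.
   Context: $\mathrm{NCP}(k)=\mathrm{Span}\{1,w,w^2,\dots,w^{k-1},v\}\subseteq\mathrm C^*(\mathbb Z_k*\mathbb Z_2)$ (full group C$^*$-algebra of the free product), where $w,v$ are the canonical unitaries from the generators of $\mathbb Z_k$ and $\mathbb Z_2$. For an operator system $\mathcal R$, $\mathcal R^{\max}$ denotes the maximal operator system structure $\mathrm{OMAX}(\mathcal R)$: it is the operator system with the same underlying Archimedean order unit space as $\mathcal R$ (so the identity map $\mathcal R^{\max}\to\mathcal R$ is completely positive) characterised by the property that, for every operator system $\mathcal T$, every unital positive linear map $\mathcal R^{\max}\to\mathcal T$ is completely positive. Thus $\mathcal R=\mathcal R^{\max}$ (equality of matrix orders) says that every unital positive linear map from $\mathcal R$ to an operator system is completely positive. *)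

theory Defs
  imports
    Complex_Main
    "HOL-Library.Function_Algebras"
    "HOL-Library.Nonpos_Ints"
    "HOL-Algebra.Elementary_Groups"
    "Jordan_Normal_Form.Matrix"
begin

section \<open>Abstract operator systems\<close>

text \<open>
  The data of a matrix ordered complex *-vector space with a distinguished unit. The space
  \<open>os_space\<close> is a subset of the type \<open>'a\<close>, whose own addition is used; \<open>os_cone S n\<close> is the set of
  positive elements of \<open>M\<^sub>n\<close>. Only the values for \<open>n > 0\<close> are meaningful.
\<close>

record 'a os =
  os_space :: "'a set"
  os_smult :: "complex \<Rightarrow> 'a \<Rightarrow> 'a"
  os_star :: "'a \<Rightarrow> 'a"
  os_unit :: 'a
  os_cone :: "nat \<Rightarrow> 'a mat set"

definition os_mats :: "'a os \<Rightarrow> nat \<Rightarrow> 'a mat set" where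
  "os_mats S n = {X \<in> carrier_mat n n. \<forall>i<n. \<forall>j<n. X $$ (i, j) \<in> os_space S}"

definition os_adjoint :: "'a os \<Rightarrow> 'a mat \<Rightarrow> 'a mat" where
  "os_adjoint S X = mat (dim_col X) (dim_row X) (\<lambda>(i, j). os_star S (X $$ (j, i)))"

definition os_herm :: "'a os \<Rightarrow> nat \<Rightarrow> 'a mat set" where
  "os_herm S n = {X \<in> os_mats S n. os_adjoint S X = X}"

text \<open>The diagonal matrix \<open>r e\<^sub>n\<close>, for \<open>e\<close> the unit.\<close>

definition os_unit_mat :: "'a::zero os \<Rightarrow> nat \<Rightarrow> real \<Rightarrow> 'a mat" where
  "os_unit_mat S n r =
     mat n n (\<lambda>(i, j). if i = j then os_smult S (of_real r) (os_unit S) else 0)"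

text \<open>\<open>A\<^sup>* X A\<close> for a scalar matrix \<open>A\<close>.\<close>

definition os_conj :: "'a::comm_monoid_add os \<Rightarrow> complex mat \<Rightarrow> 'a mat \<Rightarrow> 'a mat" where
  "os_conj S A X = mat (dim_col A) (dim_col A) (\<lambda>(i, j).
     \<Sum>p<dim_row A. \<Sum>q<dim_row A. os_smult S (cnj (A $$ (p, i)) * A $$ (q, j)) (X $$ (p, q)))"

text \<open>
  Operator systems in the sense of Choi and Effros: proper, compatible matrix cones with an
  Archimedean matrix order unit.
\<close>

locale operator_system =
  fixes S :: "'a::ab_group_add os"
  assumes vector_space: "vector_space (os_smult S)"
    and subspace: "module.subspace (os_smult S) (os_space S)"
    and star_closed: "x \<in> os_space S \<Longrightarrow> os_star S x \<in> os_space S"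
    and star_star: "x \<in> os_space S \<Longrightarrow> os_star S (os_star S x) = x"
    and star_add: "\<lbrakk>x \<in> os_space S; y \<in> os_space S\<rbrakk> \<Longrightarrow>
          os_star S (x + y) = os_star S x + os_star S y"
    and star_smult: "x \<in> os_space S \<Longrightarrow>
          os_star S (os_smult S c x) = os_smult S (cnj c) (os_star S x)"
    and unit_closed: "os_unit S \<in> os_space S"
    and star_unit: "os_star S (os_unit S) = os_unit S"
    and cone_herm: "n > 0 \<Longrightarrow> os_cone S n \<subseteq> os_herm S n"
    and cone_add: "\<lbrakk>n > 0; X \<in> os_cone S n; Y \<in> os_cone S n\<rbrakk> \<Longrightarrow> X + Y \<in> os_cone S n"
    and cone_scale: "\<lbrakk>n > 0; X \<in> os_cone S n; r \<ge> 0\<rbrakk> \<Longrightarrow>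
          map_mat (os_smult S (of_real r)) X \<in> os_cone S n"
    and cone_proper: "\<lbrakk>n > 0; X \<in> os_cone S n; - X \<in> os_cone S n\<rbrakk> \<Longrightarrow> X = 0\<^sub>m n n"
    and cone_compat: "\<lbrakk>m > 0; n > 0; X \<in> os_cone S m; A \<in> carrier_mat m n\<rbrakk> \<Longrightarrow>
          os_conj S A X \<in> os_cone S n"
    and order_unit: "\<lbrakk>n > 0; X \<in> os_herm S n\<rbrakk> \<Longrightarrow>
          \<exists>r>0. os_unit_mat S n r + X \<in> os_cone S n"
    and archimedean: "\<lbrakk>n > 0; X \<in> os_herm S n; \<And>r. r > 0 \<Longrightarrow> os_unit_mat S n r + X \<in> os_cone S n\<rbrakk>
          \<Longrightarrow> X \<in> os_cone S n"

definition os_linear :: "'a::plus os \<Rightarrow> 'b::plus os \<Rightarrow> ('a \<Rightarrow> 'b) \<Rightarrow> bool" where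
  "os_linear S T f \<longleftrightarrow>
     (\<forall>x\<in>os_space S. f x \<in> os_space T) \<and>
     (\<forall>x\<in>os_space S. \<forall>y\<in>os_space S. f (x + y) = f x + f y) \<and>
     (\<forall>c. \<forall>x\<in>os_space S. f (os_smult S c x) = os_smult T c (f x))"

definition os_unital :: "'a os \<Rightarrow> 'b os \<Rightarrow> ('a \<Rightarrow> 'b) \<Rightarrow> bool" where
  "os_unital S T f \<longleftrightarrow> f (os_unit S) = os_unit T"

definition os_positive :: "'a os \<Rightarrow> 'b os \<Rightarrow> ('a \<Rightarrow> 'b) \<Rightarrow> bool" where
  "os_positive S T f \<longleftrightarrow> (\<forall>X\<in>os_cone S 1. map_mat f X \<in> os_cone T 1)"

definition completely_positive :: "'a os \<Rightarrow> 'b os \<Rightarrow> ('a \<Rightarrow> 'b) \<Rightarrow> bool" where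
  "completely_positive S T f \<longleftrightarrow> (\<forall>n>0. \<forall>X\<in>os_cone S n. map_mat f X \<in> os_cone T n)"

text \<open>
  \<open>is_omax TYPE('b) R M\<close>: \<open>M\<close> is the maximal operator system structure on \<open>R\<close>, i.e. an operator
  system with the same underlying Archimedean order unit space out of which every unital positive
  linear map into an operator system is completely positive. A definition cannot quantify over
  types, so the type of the target systems is a parameter; a theorem with \<open>'b\<close> free asserts the
  property for targets of every type. The matrix order of \<open>M\<close> is determined by \<open>R\<close>, by
  applying the property (with \<open>'b = 'a\<close>) to the identity map.
\<close>

definition is_omax :: "'b::ab_group_add itself \<Rightarrow> 'a::ab_group_add os \<Rightarrow> 'a os \<Rightarrow> bool" where
  "is_omax (_ :: 'b itself) R M \<longleftrightarrow>
     operator_system M \<and>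
     os_space M = os_space R \<and> os_smult M = os_smult R \<and> os_star M = os_star R \<and>
     os_unit M = os_unit R \<and> os_cone M 1 = os_cone R 1 \<and>
     (\<forall>(T :: 'b os) f. operator_system T \<longrightarrow>
        os_linear M T f \<longrightarrow> os_unital M T f \<longrightarrow> os_positive M T f \<longrightarrow> completely_positive M T f)"

text \<open>The operator subsystem with underlying space \<open>V\<close>, carrying the inherited matrix order.\<close>

definition os_sub :: "'a set \<Rightarrow> 'a os \<Rightarrow> 'a os" where
  "os_sub V S = S\<lparr>os_space := V,
     os_cone := (\<lambda>n. {X \<in> os_cone S n. \<forall>i<n. \<forall>j<n. X $$ (i, j) \<in> V})\<rparr>"


section \<open>The Hilbert space \<open>\<ell>\<^sup>2(\<nat>)\<close> and unitary representations\<close>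

type_synonym cseq = "nat \<Rightarrow> complex"

definition l2 :: "cseq set" where
  "l2 = {x. summable (\<lambda>i. (cmod (x i))\<^sup>2)}"

definition l2_inner :: "cseq \<Rightarrow> cseq \<Rightarrow> complex" where
  "l2_inner x y = (\<Sum>i. cnj (x i) * y i)"

definition l2_norm :: "cseq \<Rightarrow> real" where
  "l2_norm x = sqrt (\<Sum>i. (cmod (x i))\<^sup>2)"

definition l2_unitary :: "(cseq \<Rightarrow> cseq) \<Rightarrow> bool" where
  "l2_unitary U \<longleftrightarrow> bij_betw U l2 l2 \<and>
     (\<forall>x\<in>l2. \<forall>y\<in>l2. U (x + y) = U x + U y) \<and>
     (\<forall>c. \<forall>x\<in>l2. U (\<lambda>i. c * x i) = (\<lambda>i. c * U x i)) \<and>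
     (\<forall>x\<in>l2. \<forall>y\<in>l2. l2_inner (U x) (U y) = l2_inner x y)"

definition unitary_rep :: "('g, 'c) monoid_scheme \<Rightarrow> ('g \<Rightarrow> cseq \<Rightarrow> cseq) \<Rightarrow> bool" where
  "unitary_rep G \<pi> \<longleftrightarrow>
     (\<forall>g\<in>carrier G. l2_unitary (\<pi> g)) \<and>
     (\<forall>g\<in>carrier G. \<forall>h\<in>carrier G. \<forall>x\<in>l2. \<pi> (g \<otimes>\<^bsub>G\<^esub> h) x = \<pi> g (\<pi> h x))"


section \<open>The full group C*-algebra of a countable group\<close>

text \<open>
  For a countable group \<open>G\<close>, the algebra \<open>C\<^sup>*(G)\<close> is realised in its universal representation, the
  direct sum of all unitary representations of \<open>G\<close> on \<open>\<ell>\<^sup>2(\<nat>)\<close>. This is faithful on the full group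
  C*-algebra: the full norm is the supremum over the cyclic representations, these are separable
  since \<open>G\<close> is countable, and adding a multiple of the trivial representation turns a separable
  representation into one on \<open>\<ell>\<^sup>2(\<nat>)\<close>.

  Operators on the direct sum that preserve every summand are families \<open>a\<close> of operators, \<open>a \<pi>\<close>
  being the component at \<open>\<pi>\<close>. So that families are determined by their components, \<open>a \<pi> x\<close> is set
  to \<open>0\<close> unless \<open>\<pi>\<close> is a unitary representation and \<open>x \<in> l2\<close>. Sums of families are those of
  \<^theory>\<open>HOL-Library.Function_Algebras\<close>.
\<close>

type_synonym 'g family = "('g \<Rightarrow> cseq \<Rightarrow> cseq) \<Rightarrow> cseq \<Rightarrow> cseq"

definition fam_smult :: "complex \<Rightarrow> 'g family \<Rightarrow> 'g family" where
  "fam_smult c a = (\<lambda>\<pi> x i. c * a \<pi> x i)"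

definition fam_adjoint :: "('g, 'c) monoid_scheme \<Rightarrow> 'g family \<Rightarrow> 'g family" where
  "fam_adjoint G a = (\<lambda>\<pi> x. if unitary_rep G \<pi> \<and> x \<in> l2
     then THE y. y \<in> l2 \<and> (\<forall>z\<in>l2. l2_inner y z = l2_inner x (a \<pi> z)) else 0)"

text \<open>The canonical unitary of a group element.\<close>

definition gunitary :: "('g, 'c) monoid_scheme \<Rightarrow> 'g \<Rightarrow> 'g family" where
  "gunitary G g = (\<lambda>\<pi> x. if unitary_rep G \<pi> \<and> x \<in> l2 then \<pi> g x else 0)"

text \<open>The closure, in the operator norm of the direct sum, of the span of the group elements.\<close>

definition full_cstar_carrier :: "('g, 'c) monoid_scheme \<Rightarrow> 'g family set" where
  "full_cstar_carrier G = {a.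
     (\<forall>\<pi> x. unitary_rep G \<pi> \<and> x \<in> l2 \<longrightarrow> a \<pi> x \<in> l2) \<and>
     (\<forall>\<pi> x. \<not> (unitary_rep G \<pi> \<and> x \<in> l2) \<longrightarrow> a \<pi> x = 0) \<and>
     (\<forall>\<epsilon>>0. \<exists>b \<in> module.span fam_smult (gunitary G ` carrier G).
        \<forall>\<pi> x. unitary_rep G \<pi> \<and> x \<in> l2 \<longrightarrow> l2_norm (a \<pi> x - b \<pi> x) \<le> \<epsilon> * l2_norm x)}"

definition full_cstar :: "('g, 'c) monoid_scheme \<Rightarrow> 'g family os" where
  "full_cstar G = \<lparr>
     os_space = full_cstar_carrier G,
     os_smult = fam_smult,
     os_star = fam_adjoint G,
     os_unit = gunitary G \<one>\<^bsub>G\<^esub>,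
     os_cone = (\<lambda>n. {X \<in> carrier_mat n n.
       (\<forall>i<n. \<forall>j<n. X $$ (i, j) \<in> full_cstar_carrier G) \<and>
       (\<forall>\<pi> \<xi>. unitary_rep G \<pi> \<longrightarrow> (\<forall>i<n. \<xi> i \<in> l2) \<longrightarrow>
          (\<Sum>i<n. \<Sum>j<n. l2_inner (\<xi> i) ((X $$ (i, j)) \<pi> (\<xi> j))) \<in> \<real>\<^sub>\<ge>\<^sub>0)})\<rparr>"


section \<open>Free products of groups and \<open>NCP(k)\<close>\<close>

text \<open>
  The free product is the set of reduced words: the letters are non-identity elements of the
  factors and adjacent letters come from different factors. Words are multiplied by prepending
  the letters of the left word one after the other.
\<close>

fun fp_prepend ::
  "('a, 'c) monoid_scheme \<Rightarrow> ('b, 'd) monoid_scheme \<Rightarrow> 'a + 'b \<Rightarrow> ('a + 'b) list \<Rightarrow> ('a + 'b) list"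
where
  "fp_prepend G H (Inl a) (Inl b # ws) =
     (if a \<otimes>\<^bsub>G\<^esub> b = \<one>\<^bsub>G\<^esub> then ws else Inl (a \<otimes>\<^bsub>G\<^esub> b) # ws)"
| "fp_prepend G H (Inr a) (Inr b # ws) =
     (if a \<otimes>\<^bsub>H\<^esub> b = \<one>\<^bsub>H\<^esub> then ws else Inr (a \<otimes>\<^bsub>H\<^esub> b) # ws)"
| "fp_prepend G H x ws = x # ws"

definition free_product ::
  "('a, 'c) monoid_scheme \<Rightarrow> ('b, 'd) monoid_scheme \<Rightarrow> ('a + 'b) list monoid" where
  "free_product G H = \<lparr>
     carrier = {ws. set ws \<subseteq> Inl ` (carrier G - {\<one>\<^bsub>G\<^esub>}) \<union> Inr ` (carrier H - {\<one>\<^bsub>H\<^esub>}) \<and>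
                    successively (\<lambda>x y. isl x \<noteq> isl y) ws},
     monoid.mult = (\<lambda>us vs. foldr (fp_prepend G H) us vs),
     one = []\<rparr>"

definition Zk_Z2 :: "nat \<Rightarrow> (int + int) list monoid" where
  "Zk_Z2 k = free_product (integer_mod_group k) (integer_mod_group 2)"

definition NCP_w :: "(int + int) list" where
  "NCP_w = [Inl 1]"

definition NCP_v :: "(int + int) list" where
  "NCP_v = [Inr 1]"

definition NCP :: "nat \<Rightarrow> (int + int) list family os" where
  "NCP k = os_sub
     (module.span fam_smult
        (insert (gunitary (Zk_Z2 k) NCP_v)
           ((\<lambda>i. gunitary (Zk_Z2 k) (NCP_w [^]\<^bsub>Zk_Z2 k\<^esub> i)) ` {0..<k})))
     (full_cstar (Zk_Z2 k))"

end

theory Submission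
  imports Defs
begin

text \<open>
  The spectral projections \<open>p\<^sub>0, \<dots>, p\<^sub>k\<^sub>-\<^sub>1\<close> of \<open>w\<close> add up to \<open>1\<close>, and together with \<open>v\<close> they span
  \<open>NCP(k)\<close>. So \<open>NCP(k)\<close> is glued from two commutative operator systems, \<open>\<complex>\<^sup>k\<close> and \<open>\<complex>\<^sup>2\<close>, along their
  units, and its positive elements \<open>p\<^sub>j\<close> and \<open>1 \<plusminus> v\<close> turn out to control all matrix levels.

  Let \<open>f\<close> be a unital positive map into an operator system \<open>T\<close> and let \<open>X\<close> be a positive
  \<open>n \<times> n\<close> matrix over \<open>NCP(k)\<close>. Then \<open>X = \<Sum>\<^sub>j A\<^sub>j \<otimes> p\<^sub>j + B \<otimes> v\<close> with hermitian scalar matrices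
  (\<open>cone_coeffs\<close>). The tuples \<open>(A, B)\<close> whose image under \<open>f\<close> is positive form a convex cone with an
  order unit. Since \<open>f\<close> is positive and the cones of \<open>T\<close> are compatible, it contains
  \<open>a\<^sup>*a \<otimes> p\<^sub>j\<close> and \<open>a\<^sup>*a \<otimes> (1 \<plusminus> v)\<close> for every row vector \<open>a\<close> (\<open>coeff_cone_rank_one\<close>). If the image
  of \<open>X\<close> were not positive, then, \<open>T\<close> being Archimedean, a functional would be nonnegative on the cone
  and negative at \<open>X\<close> (\<open>complex_separation\<close>). Such a functional is given by hermitian kernels
  \<open>r\<^sub>0, \<dots>, r\<^sub>k\<^sub>-\<^sub>1, r\<^sub>k\<close>, and its values at the rank-one elements say that \<open>r\<^sub>j \<ge> 0\<close> for \<open>j < k\<close> and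
  \<open>R \<plusminus> r\<^sub>k \<ge> 0\<close>, where \<open>R = \<Sum>\<^sub>j\<^sub><\<^sub>k r\<^sub>j\<close>.

  Every functional of this kind comes from a unitary representation (\<open>realise_functional\<close>). Writing
  the \<open>r\<^sub>j\<close> as Gram matrices gives vectors \<open>\<xi>\<^sub>i\<close> and a unitary \<open>W\<close> with \<open>W\<^sup>k = 1\<close> whose spectral
  projections \<open>P\<^sub>j\<close> satisfy \<open>\<langle>\<xi>\<^sub>i, P\<^sub>j \<xi>\<^sub>l\<rangle> = r\<^sub>j(i, l)\<close>; writing \<open>(R \<plusminus> r\<^sub>k)/2\<close> as Gram matrices gives
  vectors \<open>\<eta>\<^sub>i\<close> and a symmetry \<open>D\<close> with \<open>\<langle>\<eta>\<^sub>i, D \<eta>\<^sub>l\<rangle> = r\<^sub>k(i, l)\<close>. Both families have the Gram matrix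
  \<open>R\<close>, so some unitary \<open>U\<close> maps \<open>\<xi>\<^sub>i\<close> to \<open>\<eta>\<^sub>i\<close> (\<open>gram_unitary\<close>). As \<open>W\<close> and \<open>U\<^sup>*DU\<close> need not satisfy any
  relation with each other, the free product \<open>\<int>\<^sub>k * \<int>\<^sub>2\<close> acts by them. In this representation \<open>X\<close> takes
  a negative value at \<open>\<xi>\<close>, contrary to its positivity.

  That \<open>NCP(k)\<close> is an operator system at all (\<open>operator_system_os_sub\<close>) rests on polarisation: a matrix
  over the algebra is hermitian, respectively zero, as soon as its quadratic forms are real,
  respectively zero, in all representations.
\<close>

section \<open>The Hilbert space of square-summable sequences\<close>

lemma sum_apply: "(\<Sum>i\<in>I. f i) x = (\<Sum>i\<in>I. f i x)"
  by (induction I rule: infinite_finite_induct) auto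

definition scal :: "complex \<Rightarrow> cseq \<Rightarrow> cseq" where
  "scal c x = (\<lambda>i. c * x i)"

lemma mult_le_sum_squares: "a * b \<le> a\<^sup>2 + (b::real)\<^sup>2" if "0 \<le> a" "0 \<le> b"
proof -
  have "0 \<le> a * b" using that by simp
  then show ?thesis using sum_squares_bound[of a b] by linarith
qed

lemma l2_summable_mult:
  assumes "x \<in> l2" "y \<in> l2"
  shows "summable (\<lambda>i. cmod (x i) * cmod (y i))"
proof (rule summable_comparison_test')
  show "summable (\<lambda>i. (cmod (x i))\<^sup>2 + (cmod (y i))\<^sup>2)"
    using assms by (auto simp: l2_def intro: summable_add)
  show "norm (cmod (x n) * cmod (y n)) \<le> (cmod (x n))\<^sup>2 + (cmod (y n))\<^sup>2" for n
    using mult_le_sum_squares[of "cmod (x n)" "cmod (y n)"] by simp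
qed

lemma l2_summable_inner:
  assumes "x \<in> l2" "y \<in> l2"
  shows "summable (\<lambda>i. cnj (x i) * y i)"
  by (rule summable_norm_cancel) (use l2_summable_mult[OF assms] in \<open>simp add: norm_mult\<close>)

lemma l2_add: assumes "x \<in> l2" "y \<in> l2" shows "x + y \<in> l2"
proof -
  have "summable (\<lambda>i. (cmod ((x + y) i))\<^sup>2)"
  proof (rule summable_comparison_test')
    show "summable (\<lambda>i. 2 * ((cmod (x i))\<^sup>2 + (cmod (y i))\<^sup>2))"
      using assms by (auto simp: l2_def intro!: summable_mult summable_add)
    show "norm ((cmod ((x + y) n))\<^sup>2) \<le> 2 * ((cmod (x n))\<^sup>2 + (cmod (y n))\<^sup>2)" for n
    proof -
      have "(cmod ((x + y) n))\<^sup>2 \<le> (cmod (x n) + cmod (y n))\<^sup>2"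
        by (rule power_mono) (auto simp: norm_triangle_ineq)
      also have "\<dots> \<le> 2 * ((cmod (x n))\<^sup>2 + (cmod (y n))\<^sup>2)"
        using sum_squares_bound[of "cmod (x n)" "cmod (y n)"] by (simp add: power2_sum)
      finally show ?thesis by simp
    qed
  qed
  then show ?thesis by (simp add: l2_def)
qed

lemma l2_scal: "x \<in> l2 \<Longrightarrow> scal c x \<in> l2"
  by (auto simp: l2_def scal_def norm_mult power_mult_distrib intro: summable_mult)

lemma l2_zero: "0 \<in> l2"
  by (simp add: l2_def)

lemma l2_uminus: "x \<in> l2 \<Longrightarrow> - x \<in> l2"
  by (simp add: l2_def)

lemma l2_diff: "x \<in> l2 \<Longrightarrow> y \<in> l2 \<Longrightarrow> x - y \<in> l2"
  using l2_add[of x "- y"] l2_uminus[of y] by simp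

lemma l2_sum: "(\<And>i. i \<in> I \<Longrightarrow> f i \<in> l2) \<Longrightarrow> sum f I \<in> l2"
  by (induction I rule: infinite_finite_induct) (auto simp: l2_zero l2_add)

lemma inner_add_right:
  assumes "x \<in> l2" "y \<in> l2" "z \<in> l2"
  shows "l2_inner x (y + z) = l2_inner x y + l2_inner x z"
  unfolding l2_inner_def
  using suminf_add[OF l2_summable_inner[OF assms(1,2)] l2_summable_inner[OF assms(1,3)]]
  by (simp add: ring_distribs)

lemma inner_cnj:
  assumes "x \<in> l2" "y \<in> l2"
  shows "l2_inner y x = cnj (l2_inner x y)"
proof -
  have "(\<lambda>i. cnj (cnj (x i) * y i)) sums cnj (l2_inner x y)"
    unfolding l2_inner_def sums_cnj using l2_summable_inner[OF assms] by (rule summable_sums)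
  then show ?thesis
    unfolding l2_inner_def[of y x] by (simp add: sums_iff mult.commute)
qed

lemma inner_add_left:
  assumes "x \<in> l2" "y \<in> l2" "z \<in> l2"
  shows "l2_inner (x + y) z = l2_inner x z + l2_inner y z"
  using assms by (simp add: inner_cnj[of z] inner_add_right l2_add)

lemma inner_scal_right:
  assumes "x \<in> l2" "y \<in> l2"
  shows "l2_inner x (scal c y) = c * l2_inner x y"
  unfolding l2_inner_def scal_def
  using suminf_mult[OF l2_summable_inner[OF assms], of c] by (simp add: mult_ac)

lemma inner_scal_left:
  assumes "x \<in> l2" "y \<in> l2"
  shows "l2_inner (scal c x) y = cnj c * l2_inner x y"
  using assms by (simp add: inner_cnj[of y] inner_scal_right l2_scal)

lemma scal_minus_one: "scal (- 1) x = - x"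
  by (auto simp: scal_def)

lemma inner_diff_right:
  assumes "x \<in> l2" "y \<in> l2" "z \<in> l2"
  shows "l2_inner x (y - z) = l2_inner x y - l2_inner x z"
  using inner_add_right[of x y "scal (-1) z"] inner_scal_right[of x z "-1"] assms
  by (simp add: scal_minus_one l2_uminus)

lemma inner_diff_left:
  assumes "x \<in> l2" "y \<in> l2" "z \<in> l2"
  shows "l2_inner (x - y) z = l2_inner x z - l2_inner y z"
  using assms by (simp add: inner_cnj[of z] inner_diff_right l2_diff)

lemma inner_zero_left [simp]: "l2_inner 0 x = 0" and inner_zero_right [simp]: "l2_inner x 0 = 0"
  by (simp_all add: l2_inner_def)

lemma inner_sum_right:
  assumes "x \<in> l2" "\<And>i. i \<in> I \<Longrightarrow> f i \<in> l2"
  shows "l2_inner x (sum f I) = (\<Sum>i\<in>I. l2_inner x (f i))"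
  using assms(2)
  by (induction I rule: infinite_finite_induct) (auto simp: inner_add_right l2_sum assms(1))

lemma inner_sum_left:
  assumes "x \<in> l2" "\<And>i. i \<in> I \<Longrightarrow> f i \<in> l2"
  shows "l2_inner (sum f I) x = (\<Sum>i\<in>I. l2_inner (f i) x)"
  using assms(2)
  by (induction I rule: infinite_finite_induct) (auto simp: inner_add_left l2_sum assms(1))

lemma inner_sum_sum:
  assumes "\<And>i. i \<in> I \<Longrightarrow> f i \<in> l2" "\<And>j. j \<in> J \<Longrightarrow> g j \<in> l2"
  shows "l2_inner (sum f I) (sum g J) = (\<Sum>i\<in>I. \<Sum>j\<in>J. l2_inner (f i) (g j))"
proof -
  have "l2_inner (sum f I) (sum g J) = (\<Sum>i\<in>I. l2_inner (f i) (sum g J))"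
    by (rule inner_sum_left[OF l2_sum[OF assms(2)] assms(1)])
  also have "\<dots> = (\<Sum>i\<in>I. \<Sum>j\<in>J. l2_inner (f i) (g j))"
    using inner_sum_right[OF assms(1) assms(2)] by (intro sum.cong) auto
  finally show ?thesis .
qed

definition sq_norm :: "cseq \<Rightarrow> real" where
  "sq_norm x = (\<Sum>i. (cmod (x i))\<^sup>2)"

lemma sq_norm_nonneg: "x \<in> l2 \<Longrightarrow> 0 \<le> sq_norm x"
  unfolding sq_norm_def by (rule suminf_nonneg) (auto simp: l2_def)

lemma inner_self: assumes "x \<in> l2" shows "l2_inner x x = of_real (sq_norm x)"
proof -
  have "(\<lambda>i. complex_of_real ((cmod (x i))\<^sup>2)) sums of_real (sq_norm x)"
    unfolding sq_norm_def sums_of_real_iff using assms by (auto simp: l2_def)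
  moreover have "complex_of_real ((cmod (x i))\<^sup>2) = cnj (x i) * x i" for i
    by (metis complex_norm_square mult.commute of_real_power)
  ultimately show ?thesis by (simp add: l2_inner_def sums_iff)
qed

lemma inner_self_eq_0: assumes "x \<in> l2" "l2_inner x x = 0" shows "x = 0"
proof -
  have "(\<Sum>i. (cmod (x i))\<^sup>2) = 0"
    using assms inner_self[OF assms(1)] by (simp add: sq_norm_def)
  then have "\<forall>i. (cmod (x i))\<^sup>2 = 0"
    by (subst (asm) suminf_eq_zero_iff) (use assms(1) in \<open>auto simp: l2_def\<close>)
  then show ?thesis by auto
qed

lemma inner_eq_0_imp_eq:
  assumes "x \<in> l2" "y \<in> l2" "\<And>z. z \<in> l2 \<Longrightarrow> l2_inner x z = l2_inner y z"
  shows "x = y"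
proof -
  have "l2_inner (x - y) (x - y) = 0"
    using assms by (simp add: inner_diff_left l2_diff)
  then show ?thesis
    using inner_self_eq_0[of "x - y"] assms by (simp add: l2_diff)
qed

text \<open>
A weak form of the Cauchy-Schwarz inequality, which needs only \<open>|ab| \<le> a\<^sup>2 + b\<^sup>2\<close> termwise. It is what
makes every element of the algebra dominated by a multiple of the unit.
\<close>

lemma inner_bound:
  assumes "x \<in> l2" "y \<in> l2"
  shows "cmod (l2_inner x y) \<le> sq_norm x + sq_norm y"
proof -
  have sx: "summable (\<lambda>i. (cmod (x i))\<^sup>2)" and sy: "summable (\<lambda>i. (cmod (y i))\<^sup>2)"
    using assms by (auto simp: l2_def)
  have s: "summable (\<lambda>i. cmod (cnj (x i) * y i))"
    using l2_summable_mult[OF assms] by (simp add: norm_mult)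
  have "cmod (l2_inner x y) \<le> (\<Sum>i. cmod (cnj (x i) * y i))"
    unfolding l2_inner_def by (rule summable_norm[OF s])
  also have "\<dots> \<le> (\<Sum>i. (cmod (x i))\<^sup>2 + (cmod (y i))\<^sup>2)"
  proof (rule suminf_le[OF _ s summable_add[OF sx sy]])
    show "cmod (cnj (x n) * y n) \<le> (cmod (x n))\<^sup>2 + (cmod (y n))\<^sup>2" for n
      using mult_le_sum_squares[of "cmod (x n)" "cmod (y n)"] by (simp add: norm_mult)
  qed
  also have "\<dots> = sq_norm x + sq_norm y"
    unfolding sq_norm_def by (rule suminf_add[OF sx sy, symmetric])
  finally show ?thesis .
qed

section \<open>Unitaries\<close>

lemma unitary_l2: "l2_unitary U \<Longrightarrow> x \<in> l2 \<Longrightarrow> U x \<in> l2"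
  by (auto simp: l2_unitary_def bij_betw_def)

lemma unitary_surj: "l2_unitary U \<Longrightarrow> y \<in> l2 \<Longrightarrow> \<exists>x\<in>l2. U x = y"
  by (metis bij_betw_imp_surj_on imageE l2_unitary_def)

lemma unitary_add: "l2_unitary U \<Longrightarrow> x \<in> l2 \<Longrightarrow> y \<in> l2 \<Longrightarrow> U (x + y) = U x + U y"
  by (auto simp: l2_unitary_def)

lemma unitary_scal: "l2_unitary U \<Longrightarrow> x \<in> l2 \<Longrightarrow> U (scal c x) = scal c (U x)"
  by (auto simp: l2_unitary_def scal_def)

lemma unitary_inner:
  "l2_unitary U \<Longrightarrow> x \<in> l2 \<Longrightarrow> y \<in> l2 \<Longrightarrow> l2_inner (U x) (U y) = l2_inner x y"
  by (auto simp: l2_unitary_def)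

lemma unitary_diff: "l2_unitary U \<Longrightarrow> x \<in> l2 \<Longrightarrow> y \<in> l2 \<Longrightarrow> U (x - y) = U x - U y"
  using unitary_add[of U x "scal (-1) y"] unitary_scal[of U y "-1"]
  by (simp add: scal_minus_one l2_uminus)

lemma unitary_sum:
  assumes "l2_unitary U" "\<And>i. i \<in> I \<Longrightarrow> f i \<in> l2"
  shows "U (sum f I) = (\<Sum>i\<in>I. U (f i))"
proof -
  have "U 0 = 0" using unitary_diff[OF assms(1), of 0 0] by (simp add: l2_zero)
  with assms(2) show ?thesis
    by (induction I rule: infinite_finite_induct) (auto simp: unitary_add[OF assms(1)] l2_sum)
qed

lemma unitary_sq_norm: "l2_unitary U \<Longrightarrow> x \<in> l2 \<Longrightarrow> sq_norm (U x) = sq_norm x"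
  using inner_self[of x] inner_self[of "U x"] unitary_inner[of U x x] unitary_l2[of U x] by simp

text \<open>
Injectivity is automatic, because inner products determine vectors.
\<close>

lemma unitaryI:
  assumes "\<And>x. x \<in> l2 \<Longrightarrow> U x \<in> l2"
    and "\<And>y. y \<in> l2 \<Longrightarrow> \<exists>x\<in>l2. U x = y"
    and add: "\<And>x y. x \<in> l2 \<Longrightarrow> y \<in> l2 \<Longrightarrow> U (x + y) = U x + U y"
    and sc: "\<And>c x. x \<in> l2 \<Longrightarrow> U (scal c x) = scal c (U x)"
    and inn: "\<And>x y. x \<in> l2 \<Longrightarrow> y \<in> l2 \<Longrightarrow> l2_inner (U x) (U y) = l2_inner x y"
  shows "l2_unitary U"
proof -
  have "inj_on U l2"
  proof (rule inj_onI)
    fix x y assume *: "x \<in> l2" "y \<in> l2" "U x = U y"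
    show "x = y"
      using * inn by (intro inner_eq_0_imp_eq) metis+
  qed
  then have "bij_betw U l2 l2" using assms(1,2) by (auto simp: bij_betw_def)
  then show ?thesis using add sc inn by (auto simp: l2_unitary_def scal_def)
qed

lemma unitary_comp:
  assumes "l2_unitary U" "l2_unitary V" shows "l2_unitary (\<lambda>x. U (V x))"
proof (rule unitaryI)
  show "\<exists>x\<in>l2. U (V x) = y" if "y \<in> l2" for y
  proof -
    obtain z where z: "z \<in> l2" "U z = y"
      using unitary_surj[OF assms(1) \<open>y \<in> l2\<close>] by blast
    obtain x where "x \<in> l2" "V x = z"
      using unitary_surj[OF assms(2) z(1)] by blast
    with z show ?thesis by auto
  qed
qed (simp_all add: assms unitary_l2 unitary_add unitary_scal unitary_inner del: plus_fun_apply)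

lemma unitary_id: "l2_unitary (\<lambda>x. x)"
  by (rule unitaryI) auto

lemma unitary_funpow: "l2_unitary U \<Longrightarrow> l2_unitary (U ^^ n)"
proof (induction n)
  case 0 then show ?case using unitary_id by (simp add: id_def)
next
  case (Suc n)
  then show ?case using unitary_comp[of U "U ^^ n"] by (simp add: comp_def)
qed

lemma unitary_inverse:
  assumes "l2_unitary U"
  obtains U' where "l2_unitary U'" "\<And>x. x \<in> l2 \<Longrightarrow> U (U' x) = x" "\<And>x. x \<in> l2 \<Longrightarrow> U' (U x) = x"
proof
  let ?U' = "inv_into l2 U"
  have b: "bij_betw U l2 l2" using assms by (simp add: l2_unitary_def)
  show 1: "U (?U' x) = x" if "x \<in> l2" for x
    using b that by (simp add: bij_betw_def f_inv_into_f)
  show 2: "?U' (U x) = x" if "x \<in> l2" for x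
    using b that by (auto simp: bij_betw_def)
  have m: "?U' x \<in> l2" if "x \<in> l2" for x
    using b that by (metis bij_betw_def inv_into_into)
  show "l2_unitary ?U'"
  proof (rule unitaryI)
    show "\<exists>x\<in>l2. ?U' x = y" if "y \<in> l2" for y
      using 2[OF that] unitary_l2[OF assms that] by blast
    show "?U' (x + y) = ?U' x + ?U' y" if "x \<in> l2" "y \<in> l2" for x y
      using 2[of "?U' x + ?U' y"] unitary_add[OF assms, of "?U' x" "?U' y"] that by (simp add: 1 m l2_add)
    show "?U' (scal c x) = scal c (?U' x)" if "x \<in> l2" for x c
      using 2[of "scal c (?U' x)"] unitary_scal[OF assms, of "?U' x" c] that by (simp add: 1 m l2_scal)
    show "l2_inner (?U' x) (?U' y) = l2_inner x y" if "x \<in> l2" "y \<in> l2" for x y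
      using unitary_inner[OF assms, of "?U' x" "?U' y"] that by (simp add: 1 m)
  qed (fact m)
qed

text \<open>
A phase factor in each coordinate; the inverse multiplies by the conjugate phases.
\<close>

lemma diag_unitary:
  assumes d: "\<And>t. cmod (d t) = 1"
  shows "l2_unitary (\<lambda>x t. d t * x t)"
proof (rule unitaryI)
  have m: "(\<lambda>t. d' t * x t) \<in> l2" if "\<And>t. cmod (d' t) = 1" "x \<in> l2" for x d'
    using that by (simp add: l2_def norm_mult)
  show "(\<lambda>t. d t * x t) \<in> l2" if "x \<in> l2" for x by (rule m[OF d that])
  have dc: "d t * cnj (d t) = 1" for t using d[of t] by (simp add: complex_norm_square[symmetric])
  show "\<exists>x\<in>l2. (\<lambda>t. d t * x t) = y" if "y \<in> l2" for y
    using m[OF _ that, of "\<lambda>t. cnj (d t)"] d dc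
    by (intro bexI[of _ "\<lambda>t. cnj (d t) * y t"]) (simp_all add: mult.assoc[symmetric])
  show "l2_inner (\<lambda>t. d t * x t) (\<lambda>t. d t * y t) = l2_inner x y" for x y
  proof -
    have "cnj (d t * x t) * (d t * y t) = cnj (x t) * y t" for t
    proof -
      have "cnj (d t * x t) * (d t * y t) = (d t * cnj (d t)) * (cnj (x t) * y t)" by (simp add: mult_ac)
      then show ?thesis using dc by simp
    qed
    then show ?thesis unfolding l2_inner_def by presburger
  qed
qed (auto simp: scal_def fun_eq_iff algebra_simps)

text \<open>
The complex Householder reflection \<open>x \<mapsto> x - \<langle>u, x\<rangle> u / \<langle>u, y\<rangle>\<close> with \<open>u = y - z\<close>. It sends \<open>y\<close> to
\<open>y - u = z\<close> and fixes everything orthogonal to \<open>u\<close>. It preserves inner products because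
\<open>\<langle>u, u\<rangle> = 2 Re \<langle>u, y\<rangle>\<close>, which is where the equality of the norms of \<open>y\<close> and \<open>z\<close> enters.
\<close>

lemma householder:
  assumes y: "y \<in> l2" and z: "z \<in> l2" and eq: "l2_inner y y = l2_inner z z"
  obtains R where "l2_unitary R" "R y = z"
    "\<And>x. x \<in> l2 \<Longrightarrow> l2_inner y x = l2_inner z x \<Longrightarrow> R x = x"
proof (cases "y = z")
  case True
  with that[of "\<lambda>x. x"] unitary_id show ?thesis by simp
next
  case False
  define u where "u = y - z"
  have u: "u \<in> l2" using y z by (simp add: u_def l2_diff)
  have uu: "l2_inner u u \<noteq> 0" using inner_self_eq_0[OF u] False by (auto simp: u_def)
  define b where "b = l2_inner u y"
  have "l2_inner u u = l2_inner y y - l2_inner y z - (l2_inner z y - l2_inner z z)"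
    using y z by (simp add: u_def inner_diff_left inner_diff_right l2_diff)
  also have "\<dots> = b + cnj b"
    using y z eq by (simp add: b_def u_def inner_diff_left inner_cnj[OF z y, symmetric]
        inner_cnj[OF z z, symmetric])
  finally have uub: "l2_inner u u = b + cnj b" .
  have b0: "b \<noteq> 0" using uub uu by auto
  define F where "F = (\<lambda>c x. x - scal (c * l2_inner u x) u)"
  have Fm: "F c x \<in> l2" if "x \<in> l2" for c x
    using that u by (simp add: F_def l2_diff l2_scal)
  have Fu: "l2_inner u (F c x) = (1 - c * l2_inner u u) * l2_inner u x" if "x \<in> l2" for c x
    using that u by (simp add: F_def inner_diff_right l2_scal inner_scal_right algebra_simps)
  have key: "(1 - (1/b) * l2_inner u u) = - cnj b / b" "(1 - cnj (1/b) * l2_inner u u) = - b / cnj b"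
    using b0 by (simp_all add: uub field_simps)
  \<comment> \<open>the adjoint of the reflection is its right inverse, so the reflection is onto\<close>
  have inv: "F (1 / b) (F (cnj (1 / b)) x) = x" if x: "x \<in> l2" for x
  proof -
    have "F (1 / b) (F (cnj (1 / b)) x) = F (cnj (1/b)) x - scal (1 / b * ((- b / cnj b) * l2_inner u x)) u"
      by (subst F_def) (simp only: Fu[OF x] key)
    also have "\<dots> = x"
      using b0 by (simp add: F_def scal_def fun_eq_iff)
    finally show ?thesis .
  qed
  have "l2_unitary (F (1 / b))"
  proof (rule unitaryI)
    show "\<exists>x\<in>l2. F (1 / b) x = y" if "y \<in> l2" for y using inv[OF that] Fm[OF that] by blast
    show "F (1 / b) (x + y) = F (1 / b) x + F (1 / b) y" if "x \<in> l2" "y \<in> l2" for x y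
      using that u by (simp add: F_def scal_def fun_eq_iff inner_add_right algebra_simps add_divide_distrib)
    show "F (1 / b) (scal c x) = scal c (F (1 / b) x)" if "x \<in> l2" for x c
      using inner_scal_right[OF u that, of c] by (simp add: F_def scal_def fun_eq_iff algebra_simps)
    fix x y assume x: "x \<in> l2" and y: "y \<in> l2"
    have "l2_inner (F (1 / b) x) (F (1 / b) y) =
      l2_inner x (F (1/b) y) - cnj (1 / b * l2_inner u x) * l2_inner u (F (1/b) y)"
      by (subst (1) F_def) (simp add: inner_diff_left inner_scal_left x y u Fm l2_scal)
    also have "\<dots> = l2_inner x y - (1/b * l2_inner u y) * l2_inner x u
         - cnj (1 / b * l2_inner u x) * ((- cnj b / b) * l2_inner u y)"
      by (simp add: Fu[OF y] key(1)[simplified]) (simp add: F_def inner_diff_right inner_scal_right x y u l2_scal)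
    also have "\<dots> = l2_inner x y"
      using b0 by (simp add: inner_cnj[OF u x])
    finally show "l2_inner (F (1 / b) x) (F (1 / b) y) = l2_inner x y" .
  qed (fact Fm)
  moreover have "F (1 / b) y = z"
    using b0 by (simp add: F_def scal_def fun_eq_iff b_def[symmetric]) (simp add: u_def)
  moreover have "F (1 / b) x = x" if "x \<in> l2" "l2_inner y x = l2_inner z x" for x
    using that y z by (simp add: F_def scal_def u_def inner_diff_left fun_eq_iff)
  ultimately show ?thesis using that by blast
qed

text \<open>
The vectors are matched one at a time. A unitary matching the first \<open>n\<close> pairs is followed by the
reflection that moves the image of \<open>\<xi> n\<close> to \<open>\<eta> n\<close>; since the Gram matrices agree, the earlier \<open>\<eta> i\<close>
are orthogonal to the direction of reflection and stay fixed.
\<close>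

lemma gram_unitary:
  fixes n :: nat
  assumes "\<And>i. i < n \<Longrightarrow> \<xi> i \<in> l2" "\<And>i. i < n \<Longrightarrow> \<eta> i \<in> l2"
    and "\<And>i j. i < n \<Longrightarrow> j < n \<Longrightarrow> l2_inner (\<xi> i) (\<xi> j) = l2_inner (\<eta> i) (\<eta> j)"
  shows "\<exists>U. l2_unitary U \<and> (\<forall>i<n. U (\<xi> i) = \<eta> i)"
  using assms
proof (induction n)
  case 0 then show ?case using unitary_id by auto
next
  case (Suc n)
  then obtain U where U: "l2_unitary U" "\<forall>i<n. U (\<xi> i) = \<eta> i" by fastforce
  have y: "U (\<xi> n) \<in> l2" using unitary_l2[OF U(1)] Suc.prems(1) by simp
  obtain R where R: "l2_unitary R" "R (U (\<xi> n)) = \<eta> n"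
    "\<And>x. x \<in> l2 \<Longrightarrow> l2_inner (U (\<xi> n)) x = l2_inner (\<eta> n) x \<Longrightarrow> R x = x"
    using householder[OF y Suc.prems(2)[of n]] Suc.prems(1)[of n] Suc.prems(3)[of n n] unitary_inner[OF U(1)]
    by auto
  have "R (U (\<xi> i)) = \<eta> i" if "i < n" for i
  proof -
    have "l2_inner (U (\<xi> n)) (\<eta> i) = l2_inner (\<eta> n) (\<eta> i)"
      using unitary_inner[OF U(1), of "\<xi> n" "\<xi> i"] U(2) Suc.prems(1)[of n] Suc.prems(1)[of i] Suc.prems(3)[of n i] that
      by simp
    then show ?thesis using R(3)[of "\<eta> i"] Suc.prems(2)[of i] U(2) that by simp
  qed
  then show ?case using unitary_comp[OF R(1) U(1)] R(2) by (auto simp: less_Suc_eq)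
qed

section \<open>Positive kernels as Gram matrices\<close>

definition qform :: "nat \<Rightarrow> (nat \<Rightarrow> nat \<Rightarrow> complex) \<Rightarrow> (nat \<Rightarrow> complex) \<Rightarrow> (nat \<Rightarrow> complex) \<Rightarrow> complex" where
  "qform n r x y = (\<Sum>i<n. \<Sum>j<n. cnj (x i) * r i j * y j)"

text \<open>
Only the real part of the quadratic form is constrained; its imaginary part vanishes because the
kernel is hermitian.
\<close>

definition psd :: "nat \<Rightarrow> (nat \<Rightarrow> nat \<Rightarrow> complex) \<Rightarrow> bool" where
  "psd n r \<longleftrightarrow> (\<forall>i<n. \<forall>j<n. r i j = cnj (r j i)) \<and> (\<forall>x. Re (qform n r x x) \<ge> 0)"

lemma psd_cnj: "psd n r \<Longrightarrow> i < n \<Longrightarrow> j < n \<Longrightarrow> cnj (r i j) = r j i"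
proof -
  assume "psd n r" "i < n" "j < n"
  then have "r j i = cnj (r i j)" unfolding psd_def by blast
  then show ?thesis by (rule sym)
qed

lemma qform_unit_left:
  assumes "m < n" shows "qform n r (\<lambda>i. if i = m then c else 0) y = cnj c * (\<Sum>j<n. r m j * y j)"
proof -
  have "qform n r (\<lambda>i. if i = m then c else 0) y =
      (\<Sum>i<n. if i = m then \<Sum>j<n. cnj c * r i j * y j else 0)"
    unfolding qform_def by (intro sum.cong) auto
  then show ?thesis using assms by (simp add: sum_distrib_left mult_ac)
qed

lemma qform_unit_right:
  assumes "m < n" shows "qform n r x (\<lambda>j. if j = m then c else 0) = (\<Sum>i<n. cnj (x i) * r i m) * c"
proof -
  have "qform n r x (\<lambda>j. if j = m then c else 0) = (\<Sum>i<n. cnj (x i) * r i m * c)"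
    unfolding qform_def
    by (intro sum.cong refl) (simp add: if_distrib[of "\<lambda>z. _ * z"] sum.delta assms cong: if_cong)
  then show ?thesis by (simp add: sum_distrib_right)
qed

lemma qform_add:
  "qform n r (\<lambda>i. x i + y i) (\<lambda>i. x i + y i) =
     qform n r x x + qform n r x y + qform n r y x + qform n r y y"
  by (simp add: qform_def sum.distrib algebra_simps)

lemma qform_sum: "qform n (\<lambda>i l. \<Sum>j\<in>J. e j * r j i l) x y = (\<Sum>j\<in>J. e j * qform n (r j) x y)"
proof -
  have "qform n (\<lambda>i l. \<Sum>j\<in>J. e j * r j i l) x y = (\<Sum>i<n. \<Sum>l<n. \<Sum>j\<in>J. e j * (cnj (x i) * r j i l * y l))"
    unfolding qform_def by (intro sum.cong refl) (simp add: sum_distrib_left sum_distrib_right mult_ac)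
  also have "\<dots> = (\<Sum>i<n. \<Sum>j\<in>J. \<Sum>l<n. e j * (cnj (x i) * r j i l * y l))"
    by (rule sum.cong[OF refl sum.swap])
  also have "\<dots> = (\<Sum>j\<in>J. \<Sum>i<n. \<Sum>l<n. e j * (cnj (x i) * r j i l * y l))"
    by (rule sum.swap)
  finally show ?thesis by (simp add: qform_def sum_distrib_left)
qed

lemma qform_adjoint: "qform n (\<lambda>i l. cnj (r l i)) x x = cnj (qform n r x x)"
proof -
  have "qform n (\<lambda>i l. cnj (r l i)) x x = (\<Sum>l<n. \<Sum>i<n. cnj (x i) * cnj (r l i) * x l)"
    unfolding qform_def by (rule sum.swap)
  also have "\<dots> = cnj (qform n r x x)" unfolding qform_def by (simp add: mult_ac)
  finally show ?thesis .
qed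

lemma qform_divide: "qform n (\<lambda>i l. r i l / c) x y = qform n r x y / c"
  by (simp add: qform_def sum_divide_distrib)

lemma qform_add_kernel: "qform n (\<lambda>i l. r i l + s i l) x y = qform n r x y + qform n s x y"
  by (simp add: qform_def distrib_left distrib_right sum.distrib)

text \<open>
The expansion behind completing the square in one coordinate.
\<close>

lemma psd_shift:
  assumes "psd n r" "m < n"
  shows "qform n r (\<lambda>i. x i + (if i = m then c else 0)) (\<lambda>i. x i + (if i = m then c else 0)) =
    qform n r x x + (cnj c * (\<Sum>j<n. r m j * x j) + cnj (cnj c * (\<Sum>j<n. r m j * x j))) + cnj c * c * r m m"
proof -
  have s: "(\<Sum>i<n. cnj (x i) * r i m) = cnj (\<Sum>j<n. r m j * x j)"
    using assms by (auto simp: psd_cnj intro!: sum.cong)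
  have d: "(\<Sum>j<n. r m j * (if j = m then c else 0)) = r m m * c"
    using assms(2) by (simp add: if_distrib[of "\<lambda>z. _ * z"] sum.delta cong: if_cong)
  show ?thesis
    unfolding qform_add qform_unit_left[OF assms(2)] qform_unit_right[OF assms(2)] s d
    by (simp add: mult_ac)
qed

lemma psd_diag: assumes "psd n r" "m < n" shows "r m m = of_real (Re (r m m))" "Re (r m m) \<ge> 0"
proof -
  have "Im (cnj (r m m)) = Im (r m m)" using psd_cnj[OF assms assms(2)] by (rule arg_cong)
  then show "r m m = of_real (Re (r m m))" by (simp add: complex_eq_iff)
  have "0 \<le> Re (qform n r (\<lambda>i. if i = m then 1 else 0) (\<lambda>i. if i = m then 1 else 0))"
    using assms(1) unfolding psd_def by blast
  then show "0 \<le> Re (r m m)"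
    using assms(2) by (simp add: qform_unit_left if_distrib[of "\<lambda>z. _ * z"] sum.delta cong: if_cong)
qed

text \<open>
With a vanishing diagonal entry the form of \<open>psd_shift\<close> is affine in \<open>c\<close>, so it could be made negative
unless its slope, the row \<open>m\<close> of the kernel, vanishes as well.
\<close>

lemma psd_zero_row:
  assumes "psd n r" "m < n" "r m m = 0" "j < n"
  shows "r m j = 0"
proof (rule ccontr)
  assume nz: "r m j \<noteq> 0"
  define x where "x = (\<lambda>i. if i = j then 1 else (0::complex))"
  have s: "(\<Sum>i<n. r m i * x i) = r m j"
    using assms(4) by (simp add: x_def if_distrib[of "\<lambda>z. _ * z"] sum.delta cong: if_cong)
  define q where "q = Re (qform n r x x)"
  \<comment> \<open>chosen so that the shifted form takes the value \<open>- 1\<close>\<close>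
  define t where "t = (q + 1) / (2 * (cmod (r m j))\<^sup>2)"
  define c where "c = - of_real t * r m j"
  have "0 \<le> Re (qform n r (\<lambda>i. x i + (if i = m then c else 0)) (\<lambda>i. x i + (if i = m then c else 0)))"
    using assms(1) unfolding psd_def by blast
  also have "\<dots> = q + 2 * Re (cnj c * r m j)"
    unfolding psd_shift[OF assms(1,2)] s by (simp add: assms(3) q_def)
  also have "cnj c * r m j = - of_real (t * (cmod (r m j))\<^sup>2)"
    by (simp add: c_def complex_norm_square mult_ac flip: of_real_power)
  also have "q + 2 * Re (- of_real (t * (cmod (r m j))\<^sup>2) :: complex) = - 1"
    using nz by (simp add: t_def field_simps)
  finally show False by simp
qed

text \<open>
One step of Gaussian elimination. The new form at \<open>x\<close> is the old form at the point obtained from \<open>x\<close>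
by the optimal change of the coordinate \<open>m\<close>. If the pivot is zero, division by zero makes the step do
nothing, and that is right because then the whole row is zero.
\<close>

lemma psd_pivot:
  assumes r: "psd n r" and m: "m < n"
    and r'_def: "r' = (\<lambda>i j. r i j - r i m * r m j / r m m)"
  shows "psd n r'" and "j < n \<Longrightarrow> r' m j = 0" and "\<And>i j. \<lbrakk>i < n; r i m = 0\<rbrakk> \<Longrightarrow> r' i j = r i j"
proof -
  show *: "r' m j = 0" if "j < n" for j
    using psd_zero_row[OF r m _ that] by (auto simp: r'_def)
  show "r' i j = r i j" if "i < n" "r i m = 0" for i j using that by (simp add: r'_def)
  note h = psd_cnj[OF r]
  have "0 \<le> Re (qform n r' x x)" for x
  proof -
    let ?L = "\<Sum>j<n. r m j * x j"
    define c where "c = - ?L / r m m"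
    have s: "(\<Sum>i<n. cnj (x i) * r i m) = cnj ?L"
      using h m by (auto intro!: sum.cong)
    have "(\<Sum>i<n. cnj (x i) * r i m) * ?L / r m m =
        (\<Sum>i<n. \<Sum>j<n. cnj (x i) * r i m * (r m j * x j) / r m m)"
      by (simp only: sum_product sum_divide_distrib)
    then have "qform n r' x x = qform n r x x - (\<Sum>i<n. cnj (x i) * r i m) * ?L / r m m"
      by (simp add: qform_def r'_def left_diff_distrib right_diff_distrib sum_subtractf mult_ac)
    also have "\<dots> = qform n r x x - cnj ?L * ?L / r m m" by (simp only: s)
    also have "\<dots> = qform n r x x + (cnj c * ?L + cnj (cnj c * ?L)) + cnj c * c * r m m"
    proof (cases "r m m = 0")
      case False
      have "Q - cnj L * L / \<rho> = Q + (cnj (- L / \<rho>) * L + cnj (cnj (- L / \<rho>) * L)) + cnj (- L / \<rho>) * (- L / \<rho>) * \<rho>"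
        if "\<rho> \<noteq> 0" "cnj \<rho> = \<rho>" for Q L \<rho> :: complex using that by simp
      from this[OF False h[OF m m]] show ?thesis unfolding c_def .
    qed (simp add: c_def)
    also have "\<dots> = qform n r (\<lambda>i. x i + (if i = m then c else 0)) (\<lambda>i. x i + (if i = m then c else 0))"
      by (simp only: psd_shift[OF r m])
    also have "0 \<le> Re \<dots>" using r unfolding psd_def by blast
    finally show ?thesis .
  qed
  moreover have "r' i j = cnj (r' j i)" if "i < n" "j < n" for i j
    using that m by (simp add: r'_def h mult.commute)
  ultimately show "psd n r'" unfolding psd_def by blast
qed

text \<open>
After \<open>k\<close> eliminations the remainder vanishes on the first \<open>k\<close> rows, and the rank-one parts split off
so far are the first \<open>k\<close> columns of a Cholesky factor.
\<close>

lemma cholesky_step: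
  assumes "psd n r" "k \<le> n"
  shows "\<exists>r' \<eta>. psd n r' \<and> (\<forall>i<n. \<forall>j<n. r i j = (\<Sum>q<k. cnj (\<eta> i q) * \<eta> j q) + r' i j)
     \<and> (\<forall>i<k. \<forall>j<n. r' i j = 0)"
  using assms(2)
proof (induction k)
  case 0 then show ?case using assms(1) by (intro exI[of _ r]) auto
next
  case (Suc k)
  then obtain r' \<eta> where r': "psd n r'" "\<And>i j. i<n \<Longrightarrow> j<n \<Longrightarrow> r i j = (\<Sum>q<k. cnj (\<eta> i q) * \<eta> j q) + r' i j"
     "\<And>i j. i<k \<Longrightarrow> j<n \<Longrightarrow> r' i j = 0" by auto
  have kn: "k < n" using Suc.prems by simp
  define r'' where "r'' = (\<lambda>i j. r' i j - r' i k * r' k j / r' k k)"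
  define s where "s = complex_of_real (sqrt (Re (r' k k)))"
  have ss: "s * s = r' k k" "cnj s = s"
    using psd_diag(2)[OF r'(1) kn]
    by (simp_all add: s_def psd_diag(1)[OF r'(1) kn, symmetric] flip: of_real_mult)
  define \<eta>' where "\<eta>' = (\<lambda>i q. if q = k then r' k i / s else \<eta> i q)"
  note p = psd_pivot[OF r'(1) kn r''_def]
  have "r i j = (\<Sum>q<Suc k. cnj (\<eta>' i q) * \<eta>' j q) + r'' i j" if "i < n" "j < n" for i j
  proof -
    have "cnj (r' k i) = r' i k" using psd_cnj[OF r'(1)] kn that by simp
    then have "cnj (\<eta>' i k) * \<eta>' j k = r' i k * r' k j / r' k k"
      by (simp add: \<eta>'_def ss flip: ss(1))
    moreover have "(\<Sum>q<k. cnj (\<eta>' i q) * \<eta>' j q) = (\<Sum>q<k. cnj (\<eta> i q) * \<eta> j q)"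
      by (intro sum.cong) (auto simp: \<eta>'_def)
    ultimately show ?thesis by (simp add: r'(2)[OF that] r''_def)
  qed
  moreover have "r'' i j = 0" if "i < Suc k" "j < n" for i j
    using p(2)[OF that(2)] p(3)[of i j] r'(3)[of i] that kn
    by (cases "i = k") auto
  ultimately show ?case using p(1) by blast
qed

lemma cholesky:
  assumes "psd n r"
  obtains \<eta> where "\<And>i j. i < n \<Longrightarrow> j < n \<Longrightarrow> r i j = (\<Sum>q<n. cnj (\<eta> i q) * \<eta> j q)"
proof -
  obtain r' \<eta> where "\<forall>i<n. \<forall>j<n. r i j = (\<Sum>q<n. cnj (\<eta> i q) * \<eta> j q) + r' i j"
      "\<forall>i<n. \<forall>j<n. r' i j = 0"
    using cholesky_step[OF assms order_refl] by blast
  then show ?thesis using that[of \<eta>] by simp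
qed

text \<open>
The projections onto the residue classes of the index modulo \<open>d\<close>: a partition of \<open>\<ell>\<^sup>2(\<nat>)\<close> into \<open>d\<close>
infinite-dimensional coordinate subspaces.
\<close>

definition residue_block :: "nat \<Rightarrow> nat \<Rightarrow> cseq \<Rightarrow> cseq" where
  "residue_block d m x = (\<lambda>t. if t mod d = m then x t else 0)"

text \<open>
Naimark dilation in coordinates: positive kernels \<open>r\<^sub>0, \<dots>, r\<^sub>d\<^sub>-\<^sub>1\<close> become the compressions of an
orthogonal family of projections to one common family of vectors. The vector \<open>\<xi>\<^sub>i\<close> is the direct sum
over \<open>m\<close> of the Cholesky vectors of \<open>r\<^sub>m\<close>, with the \<open>m\<close>-th summand placed in the \<open>m\<close>-th block.
\<close>

lemma naimark:
  assumes d: "d > 0" and "\<And>m. m < d \<Longrightarrow> psd n (r m)"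
  obtains \<xi> where "\<And>i. \<xi> i \<in> l2"
    "\<And>i j m. i < n \<Longrightarrow> j < n \<Longrightarrow> m < d \<Longrightarrow> l2_inner (\<xi> i) (residue_block d m (\<xi> j)) = r m i j"
proof -
  have "\<exists>\<eta>. \<forall>i<n. \<forall>j<n. r m i j = (\<Sum>q<n. cnj (\<eta> i q) * \<eta> j q)" if "m < d" for m
    using cholesky[OF assms(2)[OF that]] by metis
  then obtain \<eta> where \<eta>: "\<And>m i j. m < d \<Longrightarrow> i < n \<Longrightarrow> j < n \<Longrightarrow> r m i j = (\<Sum>q<n. cnj (\<eta> m i q) * \<eta> m j q)"
    by metis
  define \<xi> where "\<xi> = (\<lambda>i t. if t div d < n then \<eta> (t mod d) i (t div d) else 0)"
  have fin: "finite {t. t div d < n}"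
  proof (rule finite_subset)
    show "{t. t div d < n} \<subseteq> {..<n * d}" using d by (auto simp: less_mult_imp_div_less div_less_iff_less_mult)
  qed simp
  show ?thesis
  proof
    show "\<xi> i \<in> l2" for i
      unfolding l2_def mem_Collect_eq
      by (rule summable_finite[OF fin]) (auto simp: \<xi>_def)
    fix i j m assume *: "i < n" "j < n" "m < d"
    have "l2_inner (\<xi> i) (residue_block d m (\<xi> j)) = (\<Sum>t | t mod d = m \<and> t div d < n. cnj (\<xi> i t) * residue_block d m (\<xi> j) t)"
      unfolding l2_inner_def
      by (rule suminf_finite[OF finite_subset[OF _ fin]]) (auto simp: \<xi>_def residue_block_def)
    also have "\<dots> = (\<Sum>q<n. cnj (\<eta> m i q) * \<eta> m j q)"
      using * by (intro sum.reindex_bij_witness[of _ "\<lambda>q. q * d + m" "\<lambda>t. t div d"]) (auto simp: \<xi>_def residue_block_def)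
    finally show "l2_inner (\<xi> i) (residue_block d m (\<xi> j)) = r m i j" using \<eta> * by simp
  qed
qed

lemma residue_block_l2: "x \<in> l2 \<Longrightarrow> residue_block d m x \<in> l2"
  unfolding l2_def mem_Collect_eq
  by (rule summable_comparison_test'[of "\<lambda>t. (cmod (x t))\<^sup>2"]) (auto simp: residue_block_def)

lemma sum_residue_block: "d > 0 \<Longrightarrow> (\<Sum>m<d. residue_block d m x) = x"
  by (rule ext) (simp add: residue_block_def sum_apply sum.delta)

section \<open>Roots of unity\<close>

definition unity_root :: "nat \<Rightarrow> complex" where
  "unity_root k = cis (2 * pi / real k)"

lemma unity_root_pow: "k > 0 \<Longrightarrow> unity_root k ^ k = 1"
  by (simp add: unity_root_def Complex.DeMoivre)

lemma cnj_unity_root: "cnj (unity_root k) * unity_root k = 1" "cmod (unity_root k) = 1"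
  by (simp_all add: unity_root_def cis_cnj cis_mult)

lemma unity_root_inj: assumes "i < k" "j < k" "unity_root k ^ i = unity_root k ^ j" shows "i = j"
proof -
  have "inj_on (\<lambda>i. cis (2 * pi * real i / real k)) {..<k}"
    using bij_betw_roots_unity[of k] assms by (auto simp: bij_betw_def)
  moreover have "unity_root k ^ i = cis (2 * pi * real i / real k)" for i
    by (simp add: unity_root_def Complex.DeMoivre mult_ac)
  ultimately show ?thesis using assms by (auto simp: inj_on_def)
qed

lemma unity_root_orthogonal:
  assumes "m < k" "l < k"
  shows "(\<Sum>i<k. cnj (unity_root k ^ (i * m)) * unity_root k ^ (i * l)) = (if m = l then of_nat k else 0)"
proof -
  define z where "z = cnj (unity_root k) ^ m * unity_root k ^ l"
  have e: "cnj (unity_root k ^ (i * m)) * unity_root k ^ (i * l) = z ^ i" for i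
    by (simp add: z_def power_mult_distrib mult.commute flip: power_mult)
  have zm: "unity_root k ^ m * z = unity_root k ^ l"
    using cnj_unity_root(1)[of k] by (simp add: z_def flip: mult.assoc power_mult_distrib) (simp add: mult.commute)
  have S: "(\<Sum>i<k. cnj (unity_root k ^ (i * m)) * unity_root k ^ (i * l)) = (\<Sum>i<k. z ^ i)"
    by (simp only: e)
  show ?thesis unfolding S
  proof (cases "m = l")
    case True
    then have "z = 1" using cnj_unity_root(1)[of k] by (simp add: z_def flip: power_mult_distrib)
    then show "(\<Sum>i<k. z ^ i) = (if m = l then of_nat k else 0)" using True by simp
  next
    case False
    then have "z \<noteq> 1" using zm unity_root_inj[OF assms] by auto
    moreover have "z ^ k = 1"
    proof -
      have "z ^ k = cnj ((unity_root k ^ k) ^ m) * (unity_root k ^ k) ^ l"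
        by (simp add: z_def power_mult_distrib mult.commute flip: power_mult)
      then show ?thesis using unity_root_pow[of k] assms by simp
    qed
    ultimately show "(\<Sum>i<k. z ^ i) = (if m = l then of_nat k else 0)"
      using False by (simp add: geometric_sum)
  qed
qed

section \<open>Representations of \<open>\<int>\<^sub>k * \<int>\<^sub>2\<close>\<close>

fun letter_act :: "(cseq \<Rightarrow> cseq) \<Rightarrow> (cseq \<Rightarrow> cseq) \<Rightarrow> int + int \<Rightarrow> cseq \<Rightarrow> cseq" where
  "letter_act W V (Inl a) = W ^^ nat a"
| "letter_act W V (Inr b) = V ^^ nat b"

definition word_act :: "(cseq \<Rightarrow> cseq) \<Rightarrow> (cseq \<Rightarrow> cseq) \<Rightarrow> (int + int) list \<Rightarrow> cseq \<Rightarrow> cseq" where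
  "word_act W V ws x = foldr (letter_act W V) ws x"

lemma word_act_unitary:
  assumes "l2_unitary W" "l2_unitary V" shows "l2_unitary (word_act W V ws)"
proof (induction ws)
  case Nil
  have "word_act W V [] = (\<lambda>x. x)" by (simp add: word_act_def fun_eq_iff)
  then show ?case using unitary_id by simp
next
  case (Cons a ws)
  have "word_act W V (a # ws) = (\<lambda>x. letter_act W V a (word_act W V ws x))"
    by (simp add: word_act_def fun_eq_iff)
  moreover have "l2_unitary (letter_act W V a)"
    using assms by (cases a) (auto intro: unitary_funpow)
  ultimately show ?case using unitary_comp[OF _ Cons] by simp
qed

lemma funpow_nat_mod:
  assumes "(U ^^ k) x = x" "0 \<le> a" "0 \<le> b"
  shows "(U ^^ nat ((a + b) mod int k)) x = (U ^^ nat a) ((U ^^ nat b) x)"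
proof -
  have "nat ((a + b) mod int k) = (nat a + nat b) mod k"
    using assms(2,3) by (simp add: nat_mod_distrib nat_add_distrib)
  then show ?thesis by (simp add: funpow_mod_eq[OF assms(1)] funpow_add)
qed

lemma carrier_Zk_Z2:
  "k > 0 \<Longrightarrow> ws \<in> carrier (Zk_Z2 k) \<longleftrightarrow>
     set ws \<subseteq> Inl ` {0<..<int k} \<union> Inr ` {1} \<and> successively (\<lambda>x y. isl x \<noteq> isl y) ws"
proof -
  assume "k > 0"
  moreover have "{0..<int k} - {0} = {0<..<int k}" "{0..<2} - {0} = {1::int}" by auto
  ultimately show ?thesis
    by (simp add: Zk_Z2_def free_product_def carrier_integer_mod_group)
qed

text \<open>
The universal property of the free product: any two unitaries with \<open>W\<^sup>k = 1\<close> and \<open>V\<^sup>2 = 1\<close> give a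
representation. Multiplicativity is checked letter by letter; what matters is that merging two letters
of the same factor modulo \<open>k\<close> or \<open>2\<close>, and cancelling them when they multiply to the identity, does
not change the operator.
\<close>

lemma word_act_rep:
  assumes k: "k > 0" and W: "l2_unitary W" and V: "l2_unitary V"
    and Wk: "\<And>x. x \<in> l2 \<Longrightarrow> (W ^^ k) x = x" and V2: "\<And>x. x \<in> l2 \<Longrightarrow> (V ^^ 2) x = x"
  shows "unitary_rep (Zk_Z2 k) (word_act W V)"
proof -
  let ?P = "fp_prepend (integer_mod_group k) (integer_mod_group 2)"
  \<comment> \<open>nonnegative exponents, the only property of the letters that is used for exponent arithmetic\<close>
  define ok where "ok = (\<lambda>a :: int + int. a \<in> Inl ` {0..} \<union> Inr ` {0..})"
  have ok_prep: "\<forall>b\<in>set (?P a ws). ok b" if "ok a" "\<forall>b\<in>set ws. ok b" for a ws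
  proof (cases "(integer_mod_group k, integer_mod_group 2, a, ws)" rule: fp_prepend.cases)
  qed (use that k in \<open>auto simp: ok_def\<close>)
  have prep: "word_act W V (?P a ws) x = letter_act W V a (word_act W V ws x)"
    if "ok a" "\<forall>b\<in>set ws. ok b" "x \<in> l2" for a ws x
  proof (cases ws)
    case Nil
    then show ?thesis by (cases a) (simp_all add: word_act_def)
  next
    case (Cons b vs)
    define y where "y = word_act W V vs x"
    have y: "y \<in> l2" using unitary_l2[OF word_act_unitary[OF W V] that(3)] by (simp add: y_def)
    have *: "word_act W V (c # vs) x = letter_act W V c y" for c by (simp add: word_act_def y_def)
    have "word_act W V (?P a (b # vs)) x = letter_act W V a (letter_act W V b y)"
    proof (cases a)
      case (Inl i)
      show ?thesis
      proof (cases b)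
        case b: (Inl j)
        have ij: "0 \<le> i" "0 \<le> j" using that Cons Inl b by (auto simp: ok_def)
        then show ?thesis using funpow_nat_mod[OF Wk[OF y] ij]
          by (auto simp: Inl b * y_def[symmetric])
      qed (simp add: Inl word_act_def y_def)
    next
      case (Inr i)
      show ?thesis
      proof (cases b)
        case b: (Inr j)
        have ij: "0 \<le> i" "0 \<le> j" using that Cons Inr b by (auto simp: ok_def)
        then show ?thesis using funpow_nat_mod[OF V2[OF y] ij]
          by (auto simp: Inr b * y_def[symmetric])
      qed (simp add: Inr word_act_def y_def)
    qed
    then show ?thesis by (simp add: Cons *)
  qed
  have mult: "(\<forall>b\<in>set (foldr ?P us vs). ok b) \<and>
      word_act W V (foldr ?P us vs) x = word_act W V us (word_act W V vs x)"
    if "\<forall>b\<in>set us. ok b" "\<forall>b\<in>set vs. ok b" "x \<in> l2" for us vs x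
    using that(1)
  proof (induction us)
    case Nil then show ?case using that by (simp add: word_act_def)
  next
    case (Cons a us)
    then have IH: "\<forall>b\<in>set (foldr ?P us vs). ok b"
      "word_act W V (foldr ?P us vs) x = word_act W V us (word_act W V vs x)" and a: "ok a" by auto
    show ?case using ok_prep[OF a IH(1)] prep[OF a IH(1) that(3)] by (simp add: IH(2)) (simp add: word_act_def)
  qed
  have okc: "\<forall>b\<in>set ws. ok b" if "ws \<in> carrier (Zk_Z2 k)" for ws
    using that k by (fastforce simp: carrier_Zk_Z2 ok_def)
  show ?thesis
    unfolding unitary_rep_def
    using word_act_unitary[OF W V] mult okc by (auto simp: Zk_Z2_def free_product_def)
qed

lemma w_pow:
  assumes "k \<ge> 2" "i \<le> k"
  shows "NCP_w [^]\<^bsub>Zk_Z2 k\<^esub> i = (if 0 < i \<and> i < k then [Inl (int i)] else [])"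
  using assms(2)
proof (induction i)
  case 0 then show ?case by (simp add: nat_pow_def Zk_Z2_def free_product_def)
next
  case (Suc i)
  then have IH: "NCP_w [^]\<^bsub>Zk_Z2 k\<^esub> i = (if 0 < i \<and> i < k then [Inl (int i)] else [])" by simp
  have "NCP_w [^]\<^bsub>Zk_Z2 k\<^esub> Suc i = foldr (fp_prepend (integer_mod_group k) (integer_mod_group 2)) (NCP_w [^]\<^bsub>Zk_Z2 k\<^esub> i) NCP_w"
    by (simp add: nat_pow_def Zk_Z2_def free_product_def)
  also have "\<dots> = (if Suc i < k then [Inl (int (Suc i))] else [])"
    unfolding IH using Suc.prems assms(1) by (cases "Suc i < k") (auto simp: NCP_w_def algebra_simps)
  finally show ?case by simp
qed

lemma w_pow_carrier: "k \<ge> 2 \<Longrightarrow> i \<le> k \<Longrightarrow> NCP_w [^]\<^bsub>Zk_Z2 k\<^esub> i \<in> carrier (Zk_Z2 k)"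
  by (auto simp: w_pow carrier_Zk_Z2)

lemma v_carrier: "k \<ge> 2 \<Longrightarrow> NCP_v \<in> carrier (Zk_Z2 k)"
  by (auto simp: carrier_Zk_Z2 NCP_v_def)

lemma one_Zk_Z2: "\<one>\<^bsub>Zk_Z2 k\<^esub> = []"
  by (simp add: Zk_Z2_def free_product_def)

text \<open>
A representation is only assumed multiplicative, but \<open>\<pi>(1)\<close> is an idempotent bijection.
\<close>

lemma rep_one:
  assumes "k \<ge> 2" "unitary_rep (Zk_Z2 k) \<pi>" "x \<in> l2" shows "\<pi> [] x = x"
proof -
  have c: "[] \<in> carrier (Zk_Z2 k)" using assms by (simp add: carrier_Zk_Z2)
  have u: "l2_unitary (\<pi> [])" using assms c by (auto simp: unitary_rep_def)
  have "\<pi> [] (\<pi> [] x) = \<pi> ([] \<otimes>\<^bsub>Zk_Z2 k\<^esub> []) x"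
    using assms c by (auto simp: unitary_rep_def)
  also have "[] \<otimes>\<^bsub>Zk_Z2 k\<^esub> [] = []" by (simp add: Zk_Z2_def free_product_def)
  finally show ?thesis
    using u assms(3) unitary_l2[OF u] by (auto simp: l2_unitary_def bij_betw_def inj_on_def)
qed

lemma rep_w_pow:
  assumes "k \<ge> 2" "unitary_rep (Zk_Z2 k) \<pi>" "x \<in> l2" "i \<le> k"
  shows "\<pi> (NCP_w [^]\<^bsub>Zk_Z2 k\<^esub> i) x = (\<pi> NCP_w ^^ i) x"
  using assms(4)
proof (induction i)
  case 0 then show ?case using rep_one[OF assms(1-3)] w_pow[OF assms(1), of 0] by simp
next
  case (Suc i)
  have c: "NCP_w \<in> carrier (Zk_Z2 k)"
    using assms(1) by (auto simp: carrier_Zk_Z2 NCP_w_def)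
  have "NCP_w \<otimes>\<^bsub>Zk_Z2 k\<^esub> NCP_w [^]\<^bsub>Zk_Z2 k\<^esub> i = NCP_w [^]\<^bsub>Zk_Z2 k\<^esub> Suc i"
  proof -
    have "NCP_w \<otimes>\<^bsub>Zk_Z2 k\<^esub> NCP_w [^]\<^bsub>Zk_Z2 k\<^esub> i = fp_prepend (integer_mod_group k) (integer_mod_group 2) (Inl 1) (NCP_w [^]\<^bsub>Zk_Z2 k\<^esub> i)"
      by (simp add: NCP_w_def Zk_Z2_def free_product_def)
    also have "\<dots> = (if Suc i < k then [Inl (int (Suc i))] else [])"
      unfolding w_pow[OF assms(1) less_imp_le, of i, OF Suc_le_lessD[OF Suc.prems]]
      using Suc.prems assms(1) by (cases "Suc i < k") (auto simp: algebra_simps)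
    also have "\<dots> = NCP_w [^]\<^bsub>Zk_Z2 k\<^esub> Suc i"
      unfolding w_pow[OF assms(1) Suc.prems] by simp
    finally show ?thesis .
  qed
  moreover have "\<pi> (NCP_w \<otimes>\<^bsub>Zk_Z2 k\<^esub> NCP_w [^]\<^bsub>Zk_Z2 k\<^esub> i) x = \<pi> NCP_w (\<pi> (NCP_w [^]\<^bsub>Zk_Z2 k\<^esub> i) x)"
    using assms c w_pow_carrier[of k i] Suc.prems by (auto simp: unitary_rep_def)
  ultimately show ?case using Suc by simp
qed

lemma rep_v_v:
  assumes "k \<ge> 2" "unitary_rep (Zk_Z2 k) \<pi>" "x \<in> l2"
  shows "\<pi> NCP_v (\<pi> NCP_v x) = x"
proof -
  have "NCP_v \<otimes>\<^bsub>Zk_Z2 k\<^esub> NCP_v = []" by (simp add: NCP_v_def Zk_Z2_def free_product_def)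
  moreover have "\<pi> (NCP_v \<otimes>\<^bsub>Zk_Z2 k\<^esub> NCP_v) x = \<pi> NCP_v (\<pi> NCP_v x)"
    using assms v_carrier[OF assms(1)] by (auto simp: unitary_rep_def)
  ultimately show ?thesis using rep_one[OF assms] by simp
qed

lemma rep_w_k:
  assumes "k \<ge> 2" "unitary_rep (Zk_Z2 k) \<pi>" "x \<in> l2"
  shows "(\<pi> NCP_w ^^ k) x = x"
  using rep_w_pow[OF assms order_refl] rep_one[OF assms] w_pow[OF assms(1), of k] by simp

lemma rep_unitary_w: "k \<ge> 2 \<Longrightarrow> unitary_rep (Zk_Z2 k) \<pi> \<Longrightarrow> l2_unitary (\<pi> NCP_w)"
  and rep_unitary_v: "k \<ge> 2 \<Longrightarrow> unitary_rep (Zk_Z2 k) \<pi> \<Longrightarrow> l2_unitary (\<pi> NCP_v)"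
  using v_carrier[of k] by (auto simp: unitary_rep_def carrier_Zk_Z2 NCP_w_def)

section \<open>Separating functionals for cones with an order unit\<close>

text \<open>
An extension theorem of M. Riesz type in finitely many directions. Instead of extending a functional,
the cone is enlarged: for each direction \<open>b\<^sub>j\<close> a number \<open>t\<^sub>j\<close> is chosen such that the line through
\<open>b\<^sub>j - t\<^sub>j e\<close> can be added to the cone without producing \<open>- e\<close>. The largest \<open>t\<close> with
\<open>b\<^sub>j - t e\<close> in the closure of the cone works. When all lines have been added, \<open>b\<^sub>j\<close> and
\<open>t\<^sub>j e\<close> are interchangeable, and membership in the cone forces the coefficient of \<open>e\<close> to be
nonnegative. Since the functional acts on coefficients, the \<open>b\<^sub>j\<close> may be linearly dependent.
\<close>

lemma cone_support:
  fixes s :: "real \<Rightarrow> 'v::ab_group_add \<Rightarrow> 'v"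
  assumes vs: "vector_space s" and "finite I"
    and add: "\<And>x y. x \<in> K \<Longrightarrow> y \<in> K \<Longrightarrow> x + y \<in> K"
    and sc: "\<And>r x. r \<ge> 0 \<Longrightarrow> x \<in> K \<Longrightarrow> s r x \<in> K"
    and e: "- e \<notin> K" "\<And>i. i \<in> I \<Longrightarrow> \<exists>r. s r e + b i \<in> K \<and> s r e - b i \<in> K"
    and "0 \<in> K"
  shows "\<exists>t :: 'i \<Rightarrow> real. \<forall>c r. s r e + (\<Sum>i\<in>I. s (c i) (b i)) \<in> K \<longrightarrow> r + (\<Sum>i\<in>I. c i * t i) \<ge> 0"
  using assms(2-)
proof (induction I arbitrary: K)
  case (empty K)
  interpret vector_space s by (rule vs)
  have "r \<ge> 0" if "s r e \<in> K" for r
  proof (rule ccontr)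
    assume "\<not> r \<ge> 0"
    then have "s (- 1 / r) (s r e) \<in> K" using empty.prems(2)[OF _ that, of "- 1 / r"] by simp
    with \<open>\<not> r \<ge> 0\<close> empty.prems(3) show False by simp
  qed
  then show ?case by simp
next
  case (insert j I K)
  interpret vector_space s by (rule vs)
  note add = insert.prems(1) and sc = insert.prems(2) and e = insert.prems(3,4)
  have neg: "s r e \<notin> K" if "r < 0" for r
  proof
    assume "s r e \<in> K"
    from sc[OF _ this, of "- 1 / r"] that have "s (- 1 / r) (s r e) \<in> K" by simp
    with that e(1) show False by simp
  qed
  define A where "A = {t. b j - s t e \<in> K}"
  obtain R where R: "s R e + b j \<in> K" "s R e - b j \<in> K" using e(2)[of j] by auto
  have "- R \<in> A" using R(1) by (simp add: A_def add.commute)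
  moreover have "t \<le> R" if "t \<in> A" for t
  proof (rule ccontr)
    assume "\<not> t \<le> R"
    have "(b j - s t e) + (s R e - b j) \<in> K" using add[OF _ R(2)] that unfolding A_def by blast
    then have "s (R - t) e \<in> K" by (simp add: scale_left_diff_distrib)
    with neg[of "R - t"] \<open>\<not> t \<le> R\<close> show False by simp
  qed
  ultimately have A: "A \<noteq> {}" "bdd_above A" unfolding bdd_above_def by blast+
  define t where "t = Sup A"
  \<comment> \<open>the sum of \<open>K\<close> and the line through \<open>b j - t e\<close>\<close>
  define K' where "K' = {x. \<exists>l. x + s l (b j - s t e) \<in> K}"
  have sub: "x \<in> K'" if "x \<in> K" for x
    unfolding K'_def using that by (auto intro!: exI[of _ 0])
  have "\<exists>t'. \<forall>c r. s r e + (\<Sum>i\<in>I. s (c i) (b i)) \<in> K' \<longrightarrow> r + (\<Sum>i\<in>I. c i * t' i) \<ge> 0"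
  proof (rule insert.IH)
    show "x + y \<in> K'" if "x \<in> K'" "y \<in> K'" for x y
    proof -
      from that obtain l m where "x + s l (b j - s t e) \<in> K" "y + s m (b j - s t e) \<in> K" unfolding K'_def by blast
      from add[OF this] have "(x + y) + s (l + m) (b j - s t e) \<in> K" by (simp add: scale_left_distrib algebra_simps)
      then show ?thesis by (auto simp: K'_def)
    qed
    show "s r x \<in> K'" if "r \<ge> 0" "x \<in> K'" for r x
    proof -
      from that(2) obtain l where "x + s l (b j - s t e) \<in> K" unfolding K'_def by blast
      from sc[OF that(1) this] have "s r x + s (r * l) (b j - s t e) \<in> K" by (simp add: scale_right_distrib)
      then show ?thesis by (auto simp: K'_def)
    qed
    show "\<exists>r. s r e + b i \<in> K' \<and> s r e - b i \<in> K'" if "i \<in> I" for i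
      using e(2)[of i] that sub by blast
    show "0 \<in> K'" using sub insert.prems(5) .
    show "- e \<notin> K'"
    proof
      assume "- e \<in> K'"
      then obtain l where l: "- e + s l (b j - s t e) \<in> K" by (auto simp: K'_def)
      consider "l = 0" | "l > 0" | "l < 0" by linarith
      then show False
      proof cases
        case 1 with l e(1) show False by simp
      next
        case 2
        have "s (1 / l) (- e + s l (b j - s t e)) \<in> K" using sc[OF _ l, of "1 / l"] 2 by simp
        moreover have "s (1 / l) (- e + s l (b j - s t e)) = b j - s (t + 1 / l) e"
          using 2 by (simp add: scale_right_distrib scale_left_distrib algebra_simps)
        ultimately have "t + 1 / l \<in> A" by (simp add: A_def)
        then have "t + 1 / l \<le> t" unfolding t_def by (rule cSup_upper[OF _ A(2)])
        with 2 show False by simp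
      next
        case 3
        have "t - 1 / (- l) < Sup A" using 3 by (simp add: t_def)
        then obtain t' where t': "t' \<in> A" "t + 1 / l < t'"
          using less_cSup_iff[OF A] by auto
        have "s (- 1 / l) (- e + s l (b j - s t e)) \<in> K" using sc[OF _ l, of "- 1 / l"] 3 by simp
        moreover have "s (- 1 / l) (- e + s l (b j - s t e)) = s (t + 1 / l) e - b j"
          using 3 by (simp add: scale_right_distrib scale_left_distrib algebra_simps)
        ultimately have "(s (t + 1 / l) e - b j) + (b j - s t' e) \<in> K"
          using t'(1) add[of "s (t + 1 / l) e - b j" "b j - s t' e"] unfolding A_def by simp
        then have "s (t + 1 / l - t') e \<in> K" by (simp add: scale_left_diff_distrib)
        with neg[of "t + 1 / l - t'"] t'(2) show False by simp
      qed
    qed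
  qed
  then obtain t' where t': "\<And>c r. s r e + (\<Sum>i\<in>I. s (c i) (b i)) \<in> K' \<Longrightarrow> r + (\<Sum>i\<in>I. c i * t' i) \<ge> 0" by blast
  show ?case
  proof (intro exI[of _ "t'(j := t)"] allI impI)
    fix c r assume *: "s r e + (\<Sum>i\<in>insert j I. s (c i) (b i)) \<in> K"
    have "s (r + c j * t) e + (\<Sum>i\<in>I. s (c i) (b i)) + s (c j) (b j - s t e) = s r e + (\<Sum>i\<in>insert j I. s (c i) (b i))"
      using insert.hyps by (simp add: scale_left_distrib scale_right_diff_distrib algebra_simps)
    with * have "s (r + c j * t) e + (\<Sum>i\<in>I. s (c i) (b i)) + s (c j) (b j - s t e) \<in> K" by simp
    then have "s (r + c j * t) e + (\<Sum>i\<in>I. s (c i) (b i)) \<in> K'" unfolding K'_def by blast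
    from t'[OF this] have "r + c j * t + (\<Sum>i\<in>I. c i * t' i) \<ge> 0" .
    moreover have "(\<Sum>i\<in>I. c i * (t'(j := t)) i) = (\<Sum>i\<in>I. c i * t' i)"
      using insert.hyps by (intro sum.cong) auto
    ultimately show "r + (\<Sum>i\<in>insert j I. c i * (t'(j := t)) i) \<ge> 0"
      using insert.hyps by simp
  qed
qed

text \<open>
The point \<open>u = \<epsilon> e + x\<close> is outside the cone, so adding the ray through \<open>- u\<close> keeps the cone from
containing \<open>- e\<close>. A supporting functional \<open>\<phi>\<close> with \<open>\<phi>(e) = 1\<close> of the enlarged cone satisfies
\<open>\<phi>(u) \<le> 0\<close>, that is \<open>\<phi>(x) \<le> - \<epsilon> < 0\<close>.
\<close>

lemma cone_separation:
  fixes s :: "real \<Rightarrow> 'v::ab_group_add \<Rightarrow> 'v" and b :: "'i \<Rightarrow> 'v"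
  assumes vs: "vector_space s" and "finite I"
    and add: "\<And>x y. x \<in> K \<Longrightarrow> y \<in> K \<Longrightarrow> x + y \<in> K"
    and sc: "\<And>r x. r \<ge> 0 \<Longrightarrow> x \<in> K \<Longrightarrow> s r x \<in> K"
    and b: "\<And>i. i \<in> I \<Longrightarrow> \<exists>r. s r e + b i \<in> K \<and> s r e - b i \<in> K"
    and K: "0 \<in> K" "e \<in> K" and \<epsilon>: "\<epsilon> > 0" and x: "s \<epsilon> e + (\<Sum>i\<in>I. s (d i) (b i)) \<notin> K"
  obtains t :: "'i \<Rightarrow> real"
    where "\<And>c. (\<Sum>i\<in>I. s (c i) (b i)) \<in> K \<Longrightarrow> (\<Sum>i\<in>I. c i * t i) \<ge> 0" "(\<Sum>i\<in>I. d i * t i) < 0"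
proof -
  interpret vector_space s by (rule vs)
  define u where "u = s \<epsilon> e + (\<Sum>i\<in>I. s (d i) (b i))"
  define K0 where "K0 = {x. \<exists>l\<ge>0. x + s l u \<in> K}"
  have sub: "x \<in> K0" if "x \<in> K" for x
    unfolding K0_def using that by (auto intro!: exI[of _ 0])
  have "\<exists>t :: 'i \<Rightarrow> real. \<forall>c r. s r e + (\<Sum>i\<in>I. s (c i) (b i)) \<in> K0 \<longrightarrow> r + (\<Sum>i\<in>I. c i * t i) \<ge> 0"
  proof (rule cone_support[OF vs \<open>finite I\<close>])
    show "x + y \<in> K0" if "x \<in> K0" "y \<in> K0" for x y
    proof -
      from that(1) obtain l where l: "l \<ge> 0" "x + s l u \<in> K" unfolding K0_def by blast
      moreover from that(2) obtain m where m: "m \<ge> 0" "y + s m u \<in> K" unfolding K0_def by blast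
      moreover from add[OF l(2) m(2)] have "(x + y) + s (l + m) u \<in> K" by (simp add: scale_left_distrib algebra_simps)
      ultimately show ?thesis unfolding K0_def by (auto intro!: exI[of _ "l + m"])
    qed
    show "s r x \<in> K0" if "r \<ge> 0" "x \<in> K0" for r x
    proof -
      from that(2) obtain l where "l \<ge> 0" "x + s l u \<in> K" unfolding K0_def by blast
      moreover from sc[OF that(1) this(2)] have "s r x + s (r * l) u \<in> K" by (simp add: scale_right_distrib)
      ultimately show ?thesis unfolding K0_def using that(1) by (auto intro!: exI[of _ "r * l"])
    qed
    show "\<exists>r. s r e + b i \<in> K0 \<and> s r e - b i \<in> K0" if "i \<in> I" for i
      using b that sub by blast
    show "0 \<in> K0" using sub K(1) .
    show "- e \<notin> K0"
    proof
      assume "- e \<in> K0"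
      then obtain l where l: "l \<ge> 0" "- e + s l u \<in> K" by (auto simp: K0_def)
      have "e + (- e + s l u) \<in> K" using add[OF K(2) l(2)] .
      then have lu: "s l u \<in> K" by simp
      show False
      proof (cases "l = 0")
        case True
        with l have me: "- e \<in> K" by simp
        \<comment> \<open>with both \<open>e\<close> and \<open>- e\<close> the cone contains all combinations of the \<open>b i\<close>, in particular \<open>u\<close>\<close>
        have "s r e \<in> K" for r
        proof (cases "r \<ge> 0")
          case False
          then have "s (- r) (- e) \<in> K" using sc[OF _ me, of "- r"] by simp
          then show ?thesis by simp
        qed (use sc K(2) in auto)
        note all_e = this
        have bi: "s c (b i) \<in> K" if "i \<in> I" for c i
        proof -
          from b[OF that] obtain r where r: "s r e + b i \<in> K" "s r e - b i \<in> K" by blast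
          have pm: "b i \<in> K" "- b i \<in> K" using add[OF all_e[of "- r"] r(1)] add[OF all_e[of "- r"] r(2)] by simp_all
          show ?thesis
          proof (cases "c \<ge> 0")
            case False
            then have "s (- c) (- b i) \<in> K" using sc[OF _ pm(2), of "- c"] by simp
            then show ?thesis by simp
          qed (use sc pm in auto)
        qed
        have "(\<Sum>i\<in>J. s (d i) (b i)) \<in> K" if "J \<subseteq> I" for J
          using finite_subset[OF that \<open>finite I\<close>] that
        proof (induction J)
          case (insert i J)
          then show ?case using add[OF bi] by simp
        qed (use K(1) in simp)
        from add[OF all_e this[OF order_refl]] x show False by blast
      next
        case False
        then have "s (1 / l) (s l u) \<in> K" using sc[OF _ lu, of "1 / l"] l(1) by simp
        with False x show False by (simp add: u_def)
      qed
    qed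
  qed
  then obtain t :: "'i \<Rightarrow> real" where t: "\<And>c r. s r e + (\<Sum>i\<in>I. s (c i) (b i)) \<in> K0 \<Longrightarrow> r + (\<Sum>i\<in>I. c i * t i) \<ge> 0" by blast
  have "(\<Sum>i\<in>I. c i * t i) \<ge> 0" if "(\<Sum>i\<in>I. s (c i) (b i)) \<in> K" for c
    using t[of 0 c] sub[OF that] by simp
  moreover have "s (- \<epsilon>) e + (\<Sum>i\<in>I. s (- d i) (b i)) \<in> K0"
    unfolding K0_def mem_Collect_eq
    by (rule exI[of _ 1]) (simp add: u_def K(1) sum_negf)
  from t[OF this] \<epsilon> have "(\<Sum>i\<in>I. d i * t i) < 0" by (simp add: sum_negf)
  ultimately show ?thesis using that by blast
qed

text \<open>
Separation for cones of complex coordinate tuples. The real basis \<open>\<delta>\<^sub>i, \<i> \<delta>\<^sub>i\<close> turns a pair of real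
coefficients \<open>t, t'\<close> of the functional into the complex coefficient \<open>t - \<i> t'\<close>. The cone may be a set of
functions on an infinite type, provided that membership is decided by the coordinates in \<open>I\<close>.
\<close>

lemma complex_separation:
  fixes K :: "('i \<Rightarrow> complex) set" and e d :: "'i \<Rightarrow> complex"
  assumes I: "finite I"
    and add: "\<And>u v. u \<in> K \<Longrightarrow> v \<in> K \<Longrightarrow> (\<lambda>i. u i + v i) \<in> K"
    and sc: "\<And>r u. r \<ge> 0 \<Longrightarrow> u \<in> K \<Longrightarrow> (\<lambda>i. of_real r * u i) \<in> K"
    and local: "\<And>u v. u \<in> K \<Longrightarrow> (\<And>i. i \<in> I \<Longrightarrow> u i = v i) \<Longrightarrow> v \<in> K"
    and unit: "\<And>u. \<exists>r. (\<lambda>i. of_real r * e i + u i) \<in> K"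
    and K: "(\<lambda>i. 0) \<in> K" "e \<in> K" and \<epsilon>: "\<epsilon> > 0" and d: "(\<lambda>i. of_real \<epsilon> * e i + d i) \<notin> K"
  obtains y where "\<And>c. c \<in> K \<Longrightarrow> Re (\<Sum>i\<in>I. y i * c i) \<ge> 0" "Re (\<Sum>i\<in>I. y i * d i) < 0"
proof -
  define s :: "real \<Rightarrow> ('i \<Rightarrow> complex) \<Rightarrow> 'i \<Rightarrow> complex" where "s = (\<lambda>r u i. of_real r * u i)"
  have sapp: "s r u i = of_real r * u i" for r u i by (simp add: s_def)
  have vs: "vector_space s"
    by unfold_locales (auto simp: s_def algebra_simps fun_eq_iff)
  define b :: "'i \<times> bool \<Rightarrow> 'i \<Rightarrow> complex" where
    "b = (\<lambda>(i, \<beta>) p. if p = i then (if \<beta> then \<i> else 1) else 0)"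
  define co :: "('i \<Rightarrow> complex) \<Rightarrow> 'i \<times> bool \<Rightarrow> real" where
    "co = (\<lambda>u (i, \<beta>). if \<beta> then Im (u i) else Re (u i))"
  have repr: "(\<Sum>q\<in>I \<times> UNIV. s (co u q) (b q)) p = (if p \<in> I then u p else 0)" for u p
  proof -
    have "(\<Sum>q\<in>I \<times> UNIV. s (co u q) (b q)) p = (\<Sum>i\<in>I. \<Sum>\<beta>\<in>UNIV. s (co u (i, \<beta>)) (b (i, \<beta>)) p)"
      by (simp add: sum_apply sum.cartesian_product)
    also have "\<dots> = (\<Sum>i\<in>I. if i = p then u p else 0)"
      by (intro sum.cong refl) (auto simp: UNIV_bool s_def co_def b_def complex_eq_iff)
    finally show ?thesis using I by simp
  qed
  have inK: "(\<Sum>q\<in>I \<times> UNIV. s (co u q) (b q)) \<in> K \<longleftrightarrow> u \<in> K" for u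
    using local[of u "\<Sum>q\<in>I \<times> UNIV. s (co u q) (b q)"] local[of "\<Sum>q\<in>I \<times> UNIV. s (co u q) (b q)" u]
    by (auto simp: repr)
  have bd: "\<exists>r. s r e + b q \<in> K \<and> s r e - b q \<in> K" for q
  proof -
    obtain r where r: "(\<lambda>i. of_real r * e i + b q i) \<in> K" using unit by blast
    obtain r' where r': "(\<lambda>i. of_real r' * e i + (- b q i)) \<in> K" using unit[of "\<lambda>i. - b q i"] by blast
    define R where "R = max r r'"
    have "R - r \<ge> 0" "R - r' \<ge> 0" by (simp_all add: R_def)
    from this[THEN sc, OF K(2)]
    have "(\<lambda>i. of_real (R - r) * e i) \<in> K" "(\<lambda>i. of_real (R - r') * e i) \<in> K" .
    from add[OF this(1) r] add[OF this(2) r'] have "s R e + b q \<in> K \<and> s R e - b q \<in> K"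
      by (simp add: s_def plus_fun_def fun_diff_def algebra_simps)
    then show ?thesis by blast
  qed
  obtain t :: "'i \<times> bool \<Rightarrow> real" where
      t: "\<And>c. (\<Sum>q\<in>I \<times> UNIV. s (c q) (b q)) \<in> K \<Longrightarrow> (\<Sum>q\<in>I \<times> UNIV. c q * t q) \<ge> 0"
        "(\<Sum>q\<in>I \<times> UNIV. co d q * t q) < 0"
  proof (rule cone_separation[OF vs])
    show "finite (I \<times> (UNIV :: bool set))" using I by simp
    show "s \<epsilon> e + (\<Sum>q\<in>I \<times> UNIV. s (co d q) (b q)) \<notin> K"
    proof
      assume "s \<epsilon> e + (\<Sum>q\<in>I \<times> UNIV. s (co d q) (b q)) \<in> K"
      then have "(\<lambda>i. of_real \<epsilon> * e i + d i) \<in> K"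
        by (rule local) (simp add: repr sapp)
      with d show False ..
    qed
    show "u + v \<in> K" if "u \<in> K" "v \<in> K" for u v using add[OF that] by (simp add: plus_fun_def)
    show "s r u \<in> K" if "r \<ge> 0" "u \<in> K" for r u using sc[OF that] by (simp add: s_def)
    show "0 \<in> K" using K(1) by (simp add: zero_fun_def)
    show "\<exists>r. s r e + b q \<in> K \<and> s r e - b q \<in> K" for q by (rule bd)
    show "e \<in> K" "\<epsilon> > 0" by (fact K(2) \<epsilon>)+
  qed blast
  define y where "y = (\<lambda>i. Complex (t (i, False)) (- t (i, True)))"
  have y: "Re (\<Sum>i\<in>I. y i * c i) = (\<Sum>q\<in>I \<times> UNIV. co c q * t q)" for c
  proof -
    have "(\<Sum>q\<in>I \<times> UNIV. co c q * t q) = (\<Sum>i\<in>I. \<Sum>\<beta>\<in>UNIV. co c (i, \<beta>) * t (i, \<beta>))"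
      by (simp add: sum.cartesian_product)
    also have "\<dots> = (\<Sum>i\<in>I. Re (y i * c i))"
      by (intro sum.cong refl) (simp add: UNIV_bool co_def y_def)
    finally show ?thesis by simp
  qed
  show ?thesis
  proof (rule that[of y])
    show "Re (\<Sum>i\<in>I. y i * c i) \<ge> 0" if "c \<in> K" for c
      unfolding y using that inK by (intro t(1)) simp
    show "Re (\<Sum>i\<in>I. y i * d i) < 0" unfolding y by (rule t(2))
  qed
qed

section \<open>Operator subsystems of a group C*-algebra\<close>

lemma fam_vector_space: "vector_space (fam_smult :: complex \<Rightarrow> 'g family \<Rightarrow> _)"
  by unfold_locales (auto simp: fam_smult_def algebra_simps fun_eq_iff)

text \<open>
The properties shared by the elements of the algebra that the operator system axioms depend on. The
bound is uniform over all representations; it is stated for the sesquilinear form because that is the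
shape in which it is applied.
\<close>

definition operator_fam :: "('g, 'c) monoid_scheme \<Rightarrow> 'g family \<Rightarrow> bool" where
  "operator_fam G a \<longleftrightarrow>
     (\<forall>\<pi> x. unitary_rep G \<pi> \<and> x \<in> l2 \<longrightarrow> a \<pi> x \<in> l2) \<and>
     (\<forall>\<pi> x. \<not> (unitary_rep G \<pi> \<and> x \<in> l2) \<longrightarrow> a \<pi> x = 0) \<and>
     (\<forall>\<pi> x y. unitary_rep G \<pi> \<and> x \<in> l2 \<and> y \<in> l2 \<longrightarrow> a \<pi> (x + y) = a \<pi> x + a \<pi> y) \<and>
     (\<forall>\<pi> x c. unitary_rep G \<pi> \<and> x \<in> l2 \<longrightarrow> a \<pi> (scal c x) = scal c (a \<pi> x)) \<and>
     (\<exists>M\<ge>0. \<forall>\<pi> x y. unitary_rep G \<pi> \<and> x \<in> l2 \<and> y \<in> l2 \<longrightarrow>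
        cmod (l2_inner y (a \<pi> x)) \<le> M * (sq_norm x + sq_norm y))"

text \<open>
The adjoint is defined by a description operator; this relation allows adjoints to be computed by
exhibiting a candidate.
\<close>

definition adj_pair :: "('g, 'c) monoid_scheme \<Rightarrow> 'g family \<Rightarrow> 'g family \<Rightarrow> bool" where
  "adj_pair G a b \<longleftrightarrow> (\<forall>\<pi> x z. unitary_rep G \<pi> \<and> x \<in> l2 \<and> z \<in> l2 \<longrightarrow>
     l2_inner (b \<pi> x) z = l2_inner x (a \<pi> z))"

lemma opf_l2: "operator_fam G a \<Longrightarrow> unitary_rep G \<pi> \<Longrightarrow> x \<in> l2 \<Longrightarrow> a \<pi> x \<in> l2"
  and opf_off: "operator_fam G a \<Longrightarrow> \<not> (unitary_rep G \<pi> \<and> x \<in> l2) \<Longrightarrow> a \<pi> x = 0"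
  and opf_add: "operator_fam G a \<Longrightarrow> unitary_rep G \<pi> \<Longrightarrow> x \<in> l2 \<Longrightarrow> y \<in> l2 \<Longrightarrow> a \<pi> (x + y) = a \<pi> x + a \<pi> y"
  and opf_scal: "operator_fam G a \<Longrightarrow> unitary_rep G \<pi> \<Longrightarrow> x \<in> l2 \<Longrightarrow> a \<pi> (scal c x) = scal c (a \<pi> x)"
  and opf_bound: "operator_fam G a \<Longrightarrow> \<exists>M\<ge>0. \<forall>\<pi> x y. unitary_rep G \<pi> \<and> x \<in> l2 \<and> y \<in> l2 \<longrightarrow>
        cmod (l2_inner y (a \<pi> x)) \<le> M * (sq_norm x + sq_norm y)"
  unfolding operator_fam_def by blast+

lemma opf_zero: "operator_fam G a \<Longrightarrow> a \<pi> 0 = 0"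
  using opf_add[of G a \<pi> 0 0] opf_off[of G a \<pi> 0] l2_zero by (cases "unitary_rep G \<pi>") auto

lemma opf_sum: "operator_fam G a \<Longrightarrow> unitary_rep G \<pi> \<Longrightarrow> (\<And>i. i \<in> I \<Longrightarrow> f i \<in> l2) \<Longrightarrow> a \<pi> (sum f I) = (\<Sum>i\<in>I. a \<pi> (f i))"
  by (induction I rule: infinite_finite_induct) (auto simp: opf_zero opf_add l2_sum simp del: plus_fun_apply)

lemma fam_smult_apply: "fam_smult c a \<pi> x = scal c (a \<pi> x)"
  by (simp add: fam_smult_def scal_def)

lemma subspace_operator_fam:
  fixes G :: "('g, 'c) monoid_scheme"
  shows "module.subspace fam_smult (Collect (operator_fam G))"
proof -
  interpret vector_space "fam_smult :: complex \<Rightarrow> 'g family \<Rightarrow> _" by (rule fam_vector_space)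
  show ?thesis
  proof (rule subspaceI)
    have "operator_fam G 0"
      unfolding operator_fam_def by (auto simp: l2_zero scal_def fun_eq_iff)
    then show "0 \<in> Collect (operator_fam G)" by simp
  next
    fix a b assume "a \<in> Collect (operator_fam G)" "b \<in> Collect (operator_fam G)"
    then have a: "operator_fam G a" and b: "operator_fam G b" by auto
    obtain M where M: "M \<ge> 0" "\<And>\<pi> x y. unitary_rep G \<pi> \<and> x \<in> l2 \<and> y \<in> l2 \<Longrightarrow>
        cmod (l2_inner y (a \<pi> x)) \<le> M * (sq_norm x + sq_norm y)" using opf_bound[OF a] by blast
    obtain N where N: "N \<ge> 0" "\<And>\<pi> x y. unitary_rep G \<pi> \<and> x \<in> l2 \<and> y \<in> l2 \<Longrightarrow>
        cmod (l2_inner y (b \<pi> x)) \<le> N * (sq_norm x + sq_norm y)" using opf_bound[OF b] by blast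
    have bd: "cmod (l2_inner y ((a + b) \<pi> x)) \<le> (M + N) * (sq_norm x + sq_norm y)"
      if *: "unitary_rep G \<pi> \<and> x \<in> l2 \<and> y \<in> l2" for \<pi> x y
    proof -
      have "l2_inner y ((a + b) \<pi> x) = l2_inner y (a \<pi> x) + l2_inner y (b \<pi> x)"
        using * by (simp add: inner_add_right opf_l2[OF a] opf_l2[OF b])
      then show ?thesis
        using norm_triangle_ineq[of "l2_inner y (a \<pi> x)" "l2_inner y (b \<pi> x)"] M(2)[OF *] N(2)[OF *]
        by (simp add: distrib_right)
    qed
    have "operator_fam G (a + b)"
      unfolding operator_fam_def
    proof (intro conjI allI impI)
      fix \<pi> x assume "unitary_rep G \<pi> \<and> x \<in> l2"
      then show "(a + b) \<pi> x \<in> l2" using l2_add[OF opf_l2[OF a] opf_l2[OF b]] by simp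
    next
      fix \<pi> x assume "\<not> (unitary_rep G \<pi> \<and> x \<in> l2)"
      from opf_off[OF a this] opf_off[OF b this] show "(a + b) \<pi> x = 0" by simp
    next
      fix \<pi> x y assume "unitary_rep G \<pi> \<and> x \<in> l2 \<and> y \<in> l2"
      then show "(a + b) \<pi> (x + y) = (a + b) \<pi> x + (a + b) \<pi> y"
        using opf_add[OF a, of \<pi> x y] opf_add[OF b, of \<pi> x y] by (simp add: fun_eq_iff)
    next
      fix \<pi> x c assume "unitary_rep G \<pi> \<and> x \<in> l2"
      then show "(a + b) \<pi> (scal c x) = scal c ((a + b) \<pi> x)"
        using opf_scal[OF a, of \<pi> x c] opf_scal[OF b, of \<pi> x c] by (simp add: scal_def fun_eq_iff distrib_left)
    next
      show "\<exists>M\<ge>0. \<forall>\<pi> x y. unitary_rep G \<pi> \<and> x \<in> l2 \<and> y \<in> l2 \<longrightarrow>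
        cmod (l2_inner y ((a + b) \<pi> x)) \<le> M * (sq_norm x + sq_norm y)"
        using bd M(1) N(1) by (intro exI[of _ "M + N"]) auto
    qed
    then show "a + b \<in> Collect (operator_fam G)" by simp
  next
    fix c a assume "a \<in> Collect (operator_fam G)"
    then have a: "operator_fam G a" by auto
    obtain M where M: "M \<ge> 0" "\<And>\<pi> x y. unitary_rep G \<pi> \<and> x \<in> l2 \<and> y \<in> l2 \<Longrightarrow>
        cmod (l2_inner y (a \<pi> x)) \<le> M * (sq_norm x + sq_norm y)" using opf_bound[OF a] by blast
    have bd: "cmod (l2_inner y (fam_smult c a \<pi> x)) \<le> (cmod c * M) * (sq_norm x + sq_norm y)"
      if *: "unitary_rep G \<pi> \<and> x \<in> l2 \<and> y \<in> l2" for \<pi> x y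
      using M(2)[OF *] * by (simp add: fam_smult_apply inner_scal_right opf_l2[OF a] norm_mult mult.assoc mult_left_mono)
    have "operator_fam G (fam_smult c a)"
      unfolding operator_fam_def
    proof (intro conjI allI impI)
      fix \<pi> x assume "unitary_rep G \<pi> \<and> x \<in> l2"
      then show "fam_smult c a \<pi> x \<in> l2" using l2_scal[OF opf_l2[OF a]] by (simp add: fam_smult_apply)
    next
      fix \<pi> x assume "\<not> (unitary_rep G \<pi> \<and> x \<in> l2)"
      from opf_off[OF a this] show "fam_smult c a \<pi> x = 0" by (simp add: fam_smult_apply scal_def fun_eq_iff)
    next
      fix \<pi> x y assume "unitary_rep G \<pi> \<and> x \<in> l2 \<and> y \<in> l2"
      then show "fam_smult c a \<pi> (x + y) = fam_smult c a \<pi> x + fam_smult c a \<pi> y"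
        using opf_add[OF a, of \<pi> x y] by (simp add: fam_smult_def fun_eq_iff distrib_left)
    next
      fix \<pi> x d assume "unitary_rep G \<pi> \<and> x \<in> l2"
      then show "fam_smult c a \<pi> (scal d x) = scal d (fam_smult c a \<pi> x)"
        using opf_scal[OF a, of \<pi> x d] by (simp add: scal_def fam_smult_def fun_eq_iff)
    next
      show "\<exists>M\<ge>0. \<forall>\<pi> x y. unitary_rep G \<pi> \<and> x \<in> l2 \<and> y \<in> l2 \<longrightarrow>
        cmod (l2_inner y (fam_smult c a \<pi> x)) \<le> M * (sq_norm x + sq_norm y)"
        using bd M(1) by (intro exI[of _ "cmod c * M"]) auto
    qed
    then show "fam_smult c a \<in> Collect (operator_fam G)" by simp
  qed
qed

lemma operator_fam_gunitary:
  assumes "g \<in> carrier G" shows "operator_fam G (gunitary G g)"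
proof -
  have u: "l2_unitary (\<pi> g)" if "unitary_rep G \<pi>" for \<pi> using that assms by (auto simp: unitary_rep_def)
  show ?thesis
    unfolding operator_fam_def
  proof (intro conjI allI impI)
    show "\<exists>M\<ge>0. \<forall>\<pi> x y. unitary_rep G \<pi> \<and> x \<in> l2 \<and> y \<in> l2 \<longrightarrow>
        cmod (l2_inner y (gunitary G g \<pi> x)) \<le> M * (sq_norm x + sq_norm y)"
    proof (intro exI[of _ 1] conjI allI impI)
      fix \<pi> x y assume *: "unitary_rep G \<pi> \<and> x \<in> l2 \<and> y \<in> l2"
      then show "cmod (l2_inner y (gunitary G g \<pi> x)) \<le> 1 * (sq_norm x + sq_norm y)"
        using inner_bound[OF _ unitary_l2[OF u], of y \<pi> x] unitary_sq_norm[OF u, of \<pi> x] by (simp add: gunitary_def)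
    qed simp
  qed (use u in \<open>auto simp: gunitary_def unitary_l2 unitary_add unitary_scal l2_add l2_scal simp del: plus_fun_apply\<close>)
qed

lemma fam_adjoint_eq:
  assumes b: "operator_fam G b" and ab: "adj_pair G a b" shows "fam_adjoint G a = b"
proof (intro ext)
  fix \<pi> x i
  show "fam_adjoint G a \<pi> x i = b \<pi> x i"
  proof (cases "unitary_rep G \<pi> \<and> x \<in> l2")
    case True
    have "(THE y. y \<in> l2 \<and> (\<forall>z\<in>l2. l2_inner y z = l2_inner x (a \<pi> z))) = b \<pi> x"
    proof (rule the_equality)
      show "b \<pi> x \<in> l2 \<and> (\<forall>z\<in>l2. l2_inner (b \<pi> x) z = l2_inner x (a \<pi> z))"
        using True opf_l2[OF b] ab by (auto simp: adj_pair_def)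
      show "y = b \<pi> x" if "y \<in> l2 \<and> (\<forall>z\<in>l2. l2_inner y z = l2_inner x (a \<pi> z))" for y
        using that True opf_l2[OF b] ab by (intro inner_eq_0_imp_eq) (auto simp: adj_pair_def)
    qed
    with True show ?thesis by (simp add: fam_adjoint_def)
  next
    case False
    then show ?thesis using opf_off[OF b False] by (auto simp: fam_adjoint_def)
  qed
qed

lemma adj_pair_sym:
  assumes "operator_fam G a" "operator_fam G b" "adj_pair G a b" shows "adj_pair G b a"
  unfolding adj_pair_def
proof (intro allI impI)
  fix \<pi> x z assume *: "unitary_rep G \<pi> \<and> x \<in> l2 \<and> z \<in> l2"
  have "l2_inner (a \<pi> x) z = cnj (l2_inner z (a \<pi> x))"
    using * opf_l2[OF assms(1)] by (intro inner_cnj) auto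
  also have "\<dots> = cnj (l2_inner (b \<pi> z) x)" using * assms(3) by (simp add: adj_pair_def)
  also have "\<dots> = l2_inner x (b \<pi> z)" using * opf_l2[OF assms(2)] by (intro inner_cnj[symmetric]) auto
  finally show "l2_inner (a \<pi> x) z = l2_inner x (b \<pi> z)" .
qed

definition form :: "nat \<Rightarrow> 'g family mat \<Rightarrow> ('g \<Rightarrow> cseq \<Rightarrow> cseq) \<Rightarrow> (nat \<Rightarrow> cseq) \<Rightarrow> (nat \<Rightarrow> cseq) \<Rightarrow> complex" where
  "form n X \<pi> \<xi> \<eta> = (\<Sum>i<n. \<Sum>j<n. l2_inner (\<xi> i) ((X $$ (i, j)) \<pi> (\<eta> j)))"

text \<open>
Any self-adjoint space of elements of the group C*-algebra that contains the unit.
\<close>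

locale group_operator_system =
  fixes G :: "('g, 'c) monoid_scheme" and V :: "'g family set"
  assumes sub: "module.subspace fam_smult V"
    and V_carrier: "V \<subseteq> full_cstar_carrier G"
    and V_op: "a \<in> V \<Longrightarrow> operator_fam G a"
    and V_adj: "a \<in> V \<Longrightarrow> \<exists>b\<in>V. adj_pair G a b"
    and V_unit: "gunitary G \<one>\<^bsub>G\<^esub> \<in> V"
    and rep_unit: "\<lbrakk>unitary_rep G \<pi>; x \<in> l2\<rbrakk> \<Longrightarrow> \<pi> \<one>\<^bsub>G\<^esub> x = x"
begin

sublocale F: vector_space "fam_smult :: complex \<Rightarrow> 'g family \<Rightarrow> _" by (rule fam_vector_space)

abbreviation "S \<equiv> os_sub V (full_cstar G)"

lemma S_simps: "os_space S = V" "os_smult S = fam_smult" "os_star S = fam_adjoint G" "os_unit S = gunitary G \<one>\<^bsub>G\<^esub>"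
  by (simp_all add: os_sub_def full_cstar_def)

definition entries :: "nat \<Rightarrow> 'g family mat \<Rightarrow> bool" where
  "entries n X \<longleftrightarrow> X \<in> carrier_mat n n \<and> (\<forall>i<n. \<forall>j<n. X $$ (i, j) \<in> V)"

lemma entries_op: "entries n X \<Longrightarrow> i < n \<Longrightarrow> j < n \<Longrightarrow> operator_fam G (X $$ (i, j))"
  using V_op by (auto simp: entries_def)

lemma cone_iff: "X \<in> os_cone S n \<longleftrightarrow> entries n X \<and>
    (\<forall>\<pi> \<xi>. unitary_rep G \<pi> \<longrightarrow> (\<forall>i<n. \<xi> i \<in> l2) \<longrightarrow> Re (form n X \<pi> \<xi> \<xi>) \<ge> 0 \<and> Im (form n X \<pi> \<xi> \<xi>) = 0)"
  using V_carrier
  by (auto simp: os_sub_def full_cstar_def entries_def form_def complex_nonneg_Reals_iff)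

lemma entries_add: "entries n X \<Longrightarrow> entries n Y \<Longrightarrow> entries n (X + Y)"
  using sub by (auto simp: entries_def F.subspace_add)

lemma form_add:
  assumes "entries n X" "entries n Y" "unitary_rep G \<pi>" "\<And>i. i < n \<Longrightarrow> \<xi> i \<in> l2" "\<And>i. i < n \<Longrightarrow> \<eta> i \<in> l2"
  shows "form n (X + Y) \<pi> \<xi> \<eta> = form n X \<pi> \<xi> \<eta> + form n Y \<pi> \<xi> \<eta>"
  unfolding form_def sum.distrib[symmetric]
proof (intro sum.cong refl)
  fix i j assume "i \<in> {..<n}" "j \<in> {..<n}"
  then have ij: "i < n" "j < n" by auto
  have "(X + Y) $$ (i, j) = X $$ (i, j) + Y $$ (i, j)" using ij assms(1,2) by (auto simp: entries_def)
  then show "l2_inner (\<xi> i) (((X + Y) $$ (i, j)) \<pi> (\<eta> j)) =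
      l2_inner (\<xi> i) ((X $$ (i, j)) \<pi> (\<eta> j)) + l2_inner (\<xi> i) ((Y $$ (i, j)) \<pi> (\<eta> j))"
    using ij assms by (simp add: inner_add_right opf_l2[OF entries_op])
qed

lemma form_add_vec:
  assumes "entries n X" "unitary_rep G \<pi>" "\<And>i. i < n \<Longrightarrow> \<xi> i \<in> l2" "\<And>i. i < n \<Longrightarrow> \<eta> i \<in> l2" "\<And>i. i < n \<Longrightarrow> \<zeta> i \<in> l2"
  shows "form n X \<pi> \<xi> (\<lambda>i. \<eta> i + \<zeta> i) = form n X \<pi> \<xi> \<eta> + form n X \<pi> \<xi> \<zeta>"
    and "form n X \<pi> (\<lambda>i. \<eta> i + \<zeta> i) \<xi> = form n X \<pi> \<eta> \<xi> + form n X \<pi> \<zeta> \<xi>"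
    and "form n X \<pi> \<xi> (\<lambda>i. scal c (\<eta> i)) = c * form n X \<pi> \<xi> \<eta>"
    and "form n X \<pi> (\<lambda>i. scal c (\<eta> i)) \<xi> = cnj c * form n X \<pi> \<eta> \<xi>"
  unfolding form_def sum.distrib[symmetric] sum_distrib_left
  by (intro sum.cong refl; use assms in \<open>simp add: inner_add_right inner_add_left inner_scal_left inner_scal_right
      opf_l2[OF entries_op] opf_add[OF entries_op] opf_scal[OF entries_op] l2_add l2_scal del: plus_fun_apply\<close>)+

text \<open>
Polarisation: the values of the form at \<open>\<xi> + \<eta>\<close> and \<open>\<xi> + \<i> \<eta>\<close> determine its value at the pair \<open>\<xi>, \<eta>\<close>.
\<close>

lemma form_polar:
  assumes "entries n X" "unitary_rep G \<pi>" "\<And>i. i < n \<Longrightarrow> \<xi> i \<in> l2" "\<And>i. i < n \<Longrightarrow> \<eta> i \<in> l2"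
    and re: "\<And>\<zeta>. (\<And>i. i < n \<Longrightarrow> \<zeta> i \<in> l2) \<Longrightarrow> Im (form n X \<pi> \<zeta> \<zeta>) = 0"
  shows "form n X \<pi> \<eta> \<xi> = cnj (form n X \<pi> \<xi> \<eta>)"
    and "(\<And>\<zeta>. (\<And>i. i < n \<Longrightarrow> \<zeta> i \<in> l2) \<Longrightarrow> form n X \<pi> \<zeta> \<zeta> = 0) \<Longrightarrow> form n X \<pi> \<xi> \<eta> = 0"
proof -
  define h where "h = (\<lambda>i. scal \<i> (\<eta> i))"
  have h: "h i \<in> l2" if "i < n" for i using assms(4)[OF that] by (simp add: h_def l2_scal)
  note fv = form_add_vec[OF assms(1,2)]
  have e1: "form n X \<pi> (\<lambda>i. \<xi> i + \<eta> i) (\<lambda>i. \<xi> i + \<eta> i) =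
     form n X \<pi> \<xi> \<xi> + form n X \<pi> \<eta> \<xi> + (form n X \<pi> \<xi> \<eta> + form n X \<pi> \<eta> \<eta>)"
    using fv(1,2) assms(3,4) by (simp add: l2_add del: plus_fun_apply)
  have e2: "form n X \<pi> (\<lambda>i. \<xi> i + h i) (\<lambda>i. \<xi> i + h i) =
     form n X \<pi> \<xi> \<xi> + form n X \<pi> h \<xi> + (form n X \<pi> \<xi> h + form n X \<pi> h h)"
    using fv(1,2) assms(3) h by (simp add: l2_add del: plus_fun_apply)
  have h1: "form n X \<pi> h \<xi> = - \<i> * form n X \<pi> \<eta> \<xi>" unfolding h_def using fv(4)[OF assms(3,4,4), where c = \<i>] by simp
  have h2: "form n X \<pi> \<xi> h = \<i> * form n X \<pi> \<xi> \<eta>" unfolding h_def using fv(3)[OF assms(3,4,4), where c = \<i>] by simp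
  have i1: "Im (form n X \<pi> \<eta> \<xi> + form n X \<pi> \<xi> \<eta>) = 0"
    using arg_cong[OF e1, of Im] re[of "\<lambda>i. \<xi> i + \<eta> i"] re[OF assms(3)] re[OF assms(4)] assms(3,4) l2_add by simp
  have i2: "Im (- \<i> * form n X \<pi> \<eta> \<xi> + \<i> * form n X \<pi> \<xi> \<eta>) = 0"
    using arg_cong[OF e2, of Im] re[of "\<lambda>i. \<xi> i + h i"] re[OF assms(3)] re[OF h] assms(3) h l2_add by (simp add: h1 h2)
  show *: "form n X \<pi> \<eta> \<xi> = cnj (form n X \<pi> \<xi> \<eta>)"
    using i1 i2 by (simp add: complex_eq_iff)
  assume z: "\<And>\<zeta>. (\<And>i. i < n \<Longrightarrow> \<zeta> i \<in> l2) \<Longrightarrow> form n X \<pi> \<zeta> \<zeta> = 0"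
  have "form n X \<pi> \<eta> \<xi> + form n X \<pi> \<xi> \<eta> = 0"
    using e1 z[of "\<lambda>i. \<xi> i + \<eta> i"] z[OF assms(3)] z[OF assms(4)] assms(3,4) l2_add by simp
  moreover have "- \<i> * form n X \<pi> \<eta> \<xi> + \<i> * form n X \<pi> \<xi> \<eta> = 0"
    using e2 z[of "\<lambda>i. \<xi> i + h i"] z[OF assms(3)] z[OF h] assms(3) h l2_add by (simp add: h1 h2)
  ultimately show "form n X \<pi> \<xi> \<eta> = 0" unfolding * by (simp add: complex_eq_iff)
qed

lemma form_single:
  assumes "entries n X" "unitary_rep G \<pi>" "i < n" "j < n" "x \<in> l2" "y \<in> l2"
  shows "form n X \<pi> (\<lambda>p. if p = i then x else 0) (\<lambda>q. if q = j then y else 0) = l2_inner x ((X $$ (i, j)) \<pi> y)"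
proof -
  have "form n X \<pi> (\<lambda>p. if p = i then x else 0) (\<lambda>q. if q = j then y else 0) =
      (\<Sum>p<n. \<Sum>q<n. if p = i then if q = j then l2_inner x ((X $$ (i, j)) \<pi> y) else 0 else 0)"
    unfolding form_def using assms by (intro sum.cong refl) (auto simp: opf_zero[OF entries_op[OF assms(1)]])
  also have "\<dots> = (\<Sum>p<n. if p = i then \<Sum>q<n. if q = j then l2_inner x ((X $$ (i, j)) \<pi> y) else 0 else 0)"
    by (intro sum.cong refl) auto
  also have "\<dots> = l2_inner x ((X $$ (i, j)) \<pi> y)" using assms(3,4) by simp
  finally show ?thesis .
qed

lemma herm_iff:
  assumes "entries n X"
  shows "os_adjoint S X = X \<longleftrightarrow> (\<forall>i<n. \<forall>j<n. adj_pair G (X $$ (j, i)) (X $$ (i, j)))"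
proof -
  have c: "X \<in> carrier_mat n n" using assms by (simp add: entries_def)
  have "os_adjoint S X = X \<longleftrightarrow> (\<forall>i<n. \<forall>j<n. fam_adjoint G (X $$ (j, i)) = X $$ (i, j))"
    using c by (auto simp: os_adjoint_def S_simps mat_eq_iff)
  also have "\<dots> \<longleftrightarrow> (\<forall>i<n. \<forall>j<n. adj_pair G (X $$ (j, i)) (X $$ (i, j)))"
  proof -
    have "fam_adjoint G a = b \<longleftrightarrow> adj_pair G a b" if "a \<in> V" "b \<in> V" for a b
      using V_adj[OF that(1)] fam_adjoint_eq V_op that by metis
    then show ?thesis using assms by (simp add: entries_def)
  qed
  finally show ?thesis .
qed

text \<open>
Vectors supported at one index isolate a single matrix entry, so polarisation of the matrix form
yields the adjoint relation between the entries at \<open>(i, j)\<close> and \<open>(j, i)\<close>.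
\<close>

lemma cone_adj:
  assumes "entries n X" and re: "\<And>\<pi> \<zeta>. unitary_rep G \<pi> \<Longrightarrow> (\<And>i. i < n \<Longrightarrow> \<zeta> i \<in> l2) \<Longrightarrow> Im (form n X \<pi> \<zeta> \<zeta>) = 0"
    and ij: "i < n" "j < n"
  shows "adj_pair G (X $$ (j, i)) (X $$ (i, j))"
  unfolding adj_pair_def
proof (intro allI impI)
  fix \<pi> x z assume *: "unitary_rep G \<pi> \<and> x \<in> l2 \<and> z \<in> l2"
  have "l2_inner ((X $$ (i, j)) \<pi> x) z = cnj (l2_inner z ((X $$ (i, j)) \<pi> x))"
    using * opf_l2[OF entries_op[OF assms(1) ij]] by (intro inner_cnj) auto
  also have "l2_inner z ((X $$ (i, j)) \<pi> x) = form n X \<pi> (\<lambda>p. if p = i then z else 0) (\<lambda>q. if q = j then x else 0)"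
    using form_single[OF assms(1) _ ij] * by simp
  also have "cnj \<dots> = form n X \<pi> (\<lambda>q. if q = j then x else 0) (\<lambda>p. if p = i then z else 0)"
    using * by (intro form_polar(1)[symmetric] assms) (auto simp: l2_zero)
  also have "\<dots> = l2_inner x ((X $$ (j, i)) \<pi> z)"
    using form_single[OF assms(1) _ ij(2,1)] * by simp
  finally show "l2_inner ((X $$ (i, j)) \<pi> x) z = l2_inner x ((X $$ (j, i)) \<pi> z)" .
qed

lemma herm_form_real:
  assumes "entries n X" and adj: "\<And>i j. i < n \<Longrightarrow> j < n \<Longrightarrow> adj_pair G (X $$ (j, i)) (X $$ (i, j))"
    and "unitary_rep G \<pi>" "\<And>i. i < n \<Longrightarrow> \<xi> i \<in> l2"
  shows "Im (form n X \<pi> \<xi> \<xi>) = 0"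
proof -
  have "cnj (form n X \<pi> \<xi> \<xi>) = (\<Sum>i<n. \<Sum>j<n. cnj (l2_inner (\<xi> i) ((X $$ (i, j)) \<pi> (\<xi> j))))"
    by (simp add: form_def)
  also have "\<dots> = (\<Sum>i<n. \<Sum>j<n. l2_inner (\<xi> j) ((X $$ (j, i)) \<pi> (\<xi> i)))"
  proof (intro sum.cong refl)
    fix i j assume "i \<in> {..<n}" "j \<in> {..<n}"
    then have ij: "i < n" "j < n" by auto
    have "cnj (l2_inner (\<xi> i) ((X $$ (i, j)) \<pi> (\<xi> j))) = l2_inner ((X $$ (i, j)) \<pi> (\<xi> j)) (\<xi> i)"
      using ij assms opf_l2[OF entries_op[OF assms(1) ij]] by (intro inner_cnj[symmetric]) auto
    also have "\<dots> = l2_inner (\<xi> j) ((X $$ (j, i)) \<pi> (\<xi> i))"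
      using adj[OF ij] assms(3,4) ij by (simp add: adj_pair_def)
    finally show "cnj (l2_inner (\<xi> i) ((X $$ (i, j)) \<pi> (\<xi> j))) = l2_inner (\<xi> j) ((X $$ (j, i)) \<pi> (\<xi> i))" .
  qed
  also have "\<dots> = form n X \<pi> \<xi> \<xi>" unfolding form_def by (rule sum.swap)
  finally show ?thesis by (simp add: complex_eq_iff)
qed

lemma form_unit:
  assumes "unitary_rep G \<pi>" "\<And>i. i < n \<Longrightarrow> \<xi> i \<in> l2"
  shows "form n (os_unit_mat S n r) \<pi> \<xi> \<xi> = of_real (r * (\<Sum>i<n. sq_norm (\<xi> i)))"
proof -
  have "form n (os_unit_mat S n r) \<pi> \<xi> \<xi> = (\<Sum>i<n. \<Sum>j<n. if j = i then of_real (r * sq_norm (\<xi> i)) else 0)"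
    unfolding form_def using assms
    by (intro sum.cong refl)
      (auto simp: os_unit_mat_def S_simps fam_smult_apply gunitary_def rep_unit inner_scal_right inner_self)
  then show ?thesis by (simp add: sum_distrib_left)
qed

lemma entries_unit: "entries n (os_unit_mat S n r)"
  using V_unit sub by (auto simp: entries_def os_unit_mat_def S_simps F.subspace_scale F.subspace_0)

lemma form_bound:
  assumes "entries n X"
  obtains M where "M \<ge> 0" "\<And>\<pi> \<xi>. unitary_rep G \<pi> \<Longrightarrow> (\<And>i. i < n \<Longrightarrow> \<xi> i \<in> l2) \<Longrightarrow>
    cmod (form n X \<pi> \<xi> \<xi>) \<le> M * (\<Sum>i<n. sq_norm (\<xi> i))"
proof -
  have "\<exists>M\<ge>0. \<forall>\<pi> x y. unitary_rep G \<pi> \<and> x \<in> l2 \<and> y \<in> l2 \<longrightarrow>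
        cmod (l2_inner y ((X $$ (i, j)) \<pi> x)) \<le> M * (sq_norm x + sq_norm y)" if "i < n" "j < n" for i j
    by (rule opf_bound[OF entries_op[OF assms that]])
  then obtain M where M: "\<And>i j. i < n \<Longrightarrow> j < n \<Longrightarrow> M i j \<ge> 0"
    "\<And>i j \<pi> x y. i < n \<Longrightarrow> j < n \<Longrightarrow> unitary_rep G \<pi> \<Longrightarrow> x \<in> l2 \<Longrightarrow> y \<in> l2 \<Longrightarrow>
        cmod (l2_inner y ((X $$ (i, j)) \<pi> x)) \<le> M i j * (sq_norm x + sq_norm y)"
    by metis
  show ?thesis
  proof
    show "0 \<le> (\<Sum>i<n. \<Sum>j<n. 2 * M i j)" using M(1) by (intro sum_nonneg) auto
    fix \<pi> \<xi> assume \<pi>: "unitary_rep G \<pi>" and \<xi>: "\<And>i. i < n \<Longrightarrow> \<xi> i \<in> l2"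
    define T where "T = (\<Sum>i<n. sq_norm (\<xi> i))"
    have T: "sq_norm (\<xi> i) \<le> T" if "i < n" for i
      unfolding T_def using that \<xi> sq_norm_nonneg by (intro member_le_sum) auto
    have "cmod (form n X \<pi> \<xi> \<xi>) \<le> (\<Sum>i<n. \<Sum>j<n. cmod (l2_inner (\<xi> i) ((X $$ (i, j)) \<pi> (\<xi> j))))"
      unfolding form_def by (rule order_trans[OF norm_sum sum_mono[OF norm_sum]])
    also have "\<dots> \<le> (\<Sum>i<n. \<Sum>j<n. 2 * M i j * T)"
    proof (intro sum_mono)
      fix i j assume "i \<in> {..<n}" "j \<in> {..<n}"
      then have ij: "i < n" "j < n" by auto
      have "cmod (l2_inner (\<xi> i) ((X $$ (i, j)) \<pi> (\<xi> j))) \<le> M i j * (sq_norm (\<xi> j) + sq_norm (\<xi> i))"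
        using M(2)[OF ij \<pi> \<xi> \<xi>] ij by simp
      also have "\<dots> \<le> M i j * (2 * T)"
        using M(1)[OF ij] T[OF ij(1)] T[OF ij(2)] by (intro mult_left_mono) auto
      finally show "cmod (l2_inner (\<xi> i) ((X $$ (i, j)) \<pi> (\<xi> j))) \<le> 2 * M i j * T" by simp
    qed
    finally show "cmod (form n X \<pi> \<xi> \<xi>) \<le> (\<Sum>i<n. \<Sum>j<n. 2 * M i j) * (\<Sum>i<n. sq_norm (\<xi> i))"
      by (simp add: sum_distrib_right T_def)
  qed
qed

lemma entries_conj:
  assumes "entries m X" "A \<in> carrier_mat m n"
  shows "entries n (os_conj S A X)"
  using assms sub unfolding entries_def os_conj_def S_simps
  by (auto intro!: F.subspace_sum F.subspace_scale)

text \<open>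
Compatibility of the cones: conjugating the matrix by \<open>A\<close> amounts to applying \<open>A\<close> to the vectors.
\<close>

lemma form_conj:
  assumes X: "entries m X" and A: "A \<in> carrier_mat m n" and \<pi>: "unitary_rep G \<pi>" and \<xi>: "\<And>i. i < n \<Longrightarrow> \<xi> i \<in> l2"
  defines "\<eta> \<equiv> (\<lambda>p. \<Sum>i<n. scal (A $$ (p, i)) (\<xi> i))"
  shows "form n (os_conj S A X) \<pi> \<xi> \<xi> = form m X \<pi> \<eta> \<eta>"
proof -
  let ?f = "\<lambda>i j p q. cnj (A $$ (p, i)) * A $$ (q, j) * l2_inner (\<xi> i) ((X $$ (p, q)) \<pi> (\<xi> j))"
  have "form n (os_conj S A X) \<pi> \<xi> \<xi> = (\<Sum>i<n. \<Sum>j<n. \<Sum>p<m. \<Sum>q<m. ?f i j p q)"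
    unfolding form_def
  proof (intro sum.cong refl)
    fix i j assume "i \<in> {..<n}" "j \<in> {..<n}"
    then have ij: "i < n" "j < n" by auto
    have o: "(X $$ (p, q)) \<pi> (\<xi> j) \<in> l2" if "p < m" "q < m" for p q
      using opf_l2[OF entries_op[OF X that] \<pi> \<xi>] ij by simp
    have "((os_conj S A X) $$ (i, j)) \<pi> (\<xi> j) =
        (\<Sum>p<m. \<Sum>q<m. scal (cnj (A $$ (p, i)) * A $$ (q, j)) ((X $$ (p, q)) \<pi> (\<xi> j)))"
      using A ij by (simp add: os_conj_def S_simps sum_apply fam_smult_apply)
    moreover have "l2_inner (\<xi> i) (\<Sum>p<m. \<Sum>q<m. scal (cnj (A $$ (p, i)) * A $$ (q, j)) ((X $$ (p, q)) \<pi> (\<xi> j)))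
        = (\<Sum>p<m. \<Sum>q<m. l2_inner (\<xi> i) (scal (cnj (A $$ (p, i)) * A $$ (q, j)) ((X $$ (p, q)) \<pi> (\<xi> j))))"
      using \<xi>[OF ij(1)] o by (subst inner_sum_right) (auto intro!: l2_sum l2_scal sum.cong inner_sum_right)
    ultimately show "l2_inner (\<xi> i) (((os_conj S A X) $$ (i, j)) \<pi> (\<xi> j)) = (\<Sum>p<m. \<Sum>q<m. ?f i j p q)"
      using \<xi>[OF ij(1)] o by (simp add: inner_scal_right)
  qed
  also have "\<dots> = (\<Sum>i<n. \<Sum>p<m. \<Sum>j<n. \<Sum>q<m. ?f i j p q)"
    by (rule sum.cong[OF refl sum.swap])
  also have "\<dots> = (\<Sum>p<m. \<Sum>i<n. \<Sum>j<n. \<Sum>q<m. ?f i j p q)"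
    by (rule sum.swap)
  also have "\<dots> = (\<Sum>p<m. \<Sum>i<n. \<Sum>q<m. \<Sum>j<n. ?f i j p q)"
    by (rule sum.cong[OF refl sum.cong[OF refl sum.swap]])
  also have "\<dots> = (\<Sum>p<m. \<Sum>q<m. \<Sum>i<n. \<Sum>j<n. ?f i j p q)"
    by (rule sum.cong[OF refl sum.swap])
  also have "\<dots> = form m X \<pi> \<eta> \<eta>"
    unfolding form_def
  proof (intro sum.cong refl)
    fix p q assume "p \<in> {..<m}" "q \<in> {..<m}"
    then have pq: "p < m" "q < m" by auto
    note op = entries_op[OF X pq]
    have o: "(X $$ (p, q)) \<pi> (\<xi> j) \<in> l2" if "j < n" for j using opf_l2[OF op \<pi> \<xi>] that by simp
    have "(X $$ (p, q)) \<pi> (\<eta> q) = (\<Sum>j<n. scal (A $$ (q, j)) ((X $$ (p, q)) \<pi> (\<xi> j)))"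
      unfolding \<eta>_def using \<xi> by (subst opf_sum[OF op \<pi>]) (auto intro!: l2_scal opf_scal[OF op \<pi>] sum.cong)
    moreover have "l2_inner (\<Sum>i<n. scal (A $$ (p, i)) (\<xi> i)) (\<Sum>j<n. scal (A $$ (q, j)) ((X $$ (p, q)) \<pi> (\<xi> j)))
        = (\<Sum>i<n. \<Sum>j<n. l2_inner (scal (A $$ (p, i)) (\<xi> i)) (scal (A $$ (q, j)) ((X $$ (p, q)) \<pi> (\<xi> j))))"
      using \<xi> o by (intro inner_sum_sum l2_scal) auto
    moreover have "\<dots> = (\<Sum>i<n. \<Sum>j<n. ?f i j p q)"
      using \<xi> o by (intro sum.cong refl) (simp add: inner_scal_left inner_scal_right l2_scal)
    ultimately show "(\<Sum>i<n. \<Sum>j<n. ?f i j p q) = l2_inner (\<eta> p) ((X $$ (p, q)) \<pi> (\<eta> q))"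
      unfolding \<eta>_def by (simp only:)
  qed
  finally show ?thesis .
qed

lemma form_scale:
  assumes X: "entries n X" "unitary_rep G \<pi>" "\<And>i. i < n \<Longrightarrow> \<xi> i \<in> l2"
  shows "form n (map_mat (os_smult S c) X) \<pi> \<xi> \<xi> = c * form n X \<pi> \<xi> \<xi>"
  unfolding form_def sum_distrib_left
proof (intro sum.cong refl)
  fix i j assume "i \<in> {..<n}" "j \<in> {..<n}"
  moreover from this have "(map_mat (os_smult S c) X) $$ (i, j) = fam_smult c (X $$ (i, j))"
    using X(1) by (auto simp: entries_def S_simps)
  ultimately show "l2_inner (\<xi> i) (((map_mat (os_smult S c) X) $$ (i, j)) \<pi> (\<xi> j)) = c * l2_inner (\<xi> i) ((X $$ (i, j)) \<pi> (\<xi> j))"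
    using assms opf_l2[OF entries_op[OF X(1)]] by (simp add: fam_smult_apply inner_scal_right)
qed

lemma entries_scale: "entries n X \<Longrightarrow> entries n (map_mat (os_smult S c) X)"
  using sub by (auto simp: entries_def S_simps F.subspace_scale)

lemma form_uminus:
  assumes X: "entries n X" "unitary_rep G \<pi>" "\<And>i. i < n \<Longrightarrow> \<xi> i \<in> l2"
  shows "form n (- X) \<pi> \<xi> \<xi> = - form n X \<pi> \<xi> \<xi>"
proof -
  have "- X = map_mat (os_smult S (- 1)) X"
    using X(1) by (auto simp: entries_def S_simps fam_smult_def fun_eq_iff)
  then show ?thesis using form_scale[OF X, where c = "- 1"] by simp
qed

text \<open>
Hermitian and proper cones come from polarisation, the order unit from the uniform bound of
\<open>form_bound\<close>, and the Archimedean property from letting \<open>r\<close> tend to \<open>0\<close> in each representation and at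
each vector separately.
\<close>

theorem operator_system_os_sub: "operator_system S"
proof (rule operator_system.intro)
  show "vector_space (os_smult S)" unfolding S_simps by (rule fam_vector_space)
  show "module.subspace (os_smult S) (os_space S)" unfolding S_simps by (rule sub)
  have star: "fam_adjoint G a \<in> V \<and> adj_pair G a (fam_adjoint G a)" if "a \<in> V" for a
    using V_adj[OF that] fam_adjoint_eq V_op by metis
  have star_eq: "fam_adjoint G a = b" if "b \<in> V" "adj_pair G a b" for a b
    using fam_adjoint_eq[OF V_op] that by blast
  note l2s = opf_l2[OF V_op]
  fix x y assume "x \<in> os_space S"
  then have x: "x \<in> V" by (simp add: S_simps)
  show "os_star S x \<in> os_space S" using star[OF x] by (simp add: S_simps)
  show "os_star S (os_star S x) = x"
    unfolding S_simps using star[OF x] x adj_pair_sym V_op by (intro star_eq) blast+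
  show "os_star S (os_smult S c x) = os_smult S (cnj c) (os_star S x)" for c
    unfolding S_simps
  proof (rule star_eq)
    show "fam_smult (cnj c) (fam_adjoint G x) \<in> V" using star[OF x] sub by (simp add: F.subspace_scale)
    show "adj_pair G (fam_smult c x) (fam_smult (cnj c) (fam_adjoint G x))"
      using star[OF x] l2s[OF x] l2s[OF conjunct1[OF star[OF x]]]
      by (simp add: adj_pair_def fam_smult_apply inner_scal_left inner_scal_right)
  qed
  assume "y \<in> os_space S"
  then have y: "y \<in> V" by (simp add: S_simps)
  show "os_star S (x + y) = os_star S x + os_star S y"
    unfolding S_simps
  proof (rule star_eq)
    show "fam_adjoint G x + fam_adjoint G y \<in> V" using star[OF x] star[OF y] sub by (simp add: F.subspace_add)
    show "adj_pair G (x + y) (fam_adjoint G x + fam_adjoint G y)"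
      using star[OF x] l2s[OF x] l2s[OF conjunct1[OF star[OF x]]] star[OF y] l2s[OF y] l2s[OF conjunct1[OF star[OF y]]]
      by (simp add: adj_pair_def inner_add_left inner_add_right)
  qed
next
  show "os_unit S \<in> os_space S" using V_unit by (simp add: S_simps)
  show "os_star S (os_unit S) = os_unit S"
    unfolding S_simps using V_unit
    by (intro fam_adjoint_eq V_op) (auto simp: adj_pair_def gunitary_def rep_unit)
next
  fix n :: nat assume n: "n > 0"
  have mats: "os_mats S n = Collect (entries n)" by (auto simp: os_mats_def S_simps entries_def)
  show "os_cone S n \<subseteq> os_herm S n"
  proof
    fix X assume "X \<in> os_cone S n"
    then have X: "entries n X" "\<And>\<pi> \<xi>. unitary_rep G \<pi> \<Longrightarrow> (\<And>i. i < n \<Longrightarrow> \<xi> i \<in> l2) \<Longrightarrow> Im (form n X \<pi> \<xi> \<xi>) = 0"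
      by (auto simp: cone_iff)
    have "os_adjoint S X = X" unfolding herm_iff[OF X(1)] using cone_adj[OF X] by blast
    with X(1) show "X \<in> os_herm S n" by (simp add: os_herm_def mats)
  qed
  fix X
  { fix Y assume "X \<in> os_cone S n" "Y \<in> os_cone S n"
    then show "X + Y \<in> os_cone S n"
      unfolding cone_iff by (auto simp: entries_add form_add) }
  { fix r :: real assume "X \<in> os_cone S n" "r \<ge> 0"
    then show "map_mat (os_smult S (of_real r)) X \<in> os_cone S n"
      unfolding cone_iff by (auto simp: entries_scale form_scale) }
  { assume *: "X \<in> os_cone S n" "- X \<in> os_cone S n"
    have X: "entries n X" using * by (simp add: cone_iff)
    \<comment> \<open>the form of \<open>X\<close> is both nonnegative and nonpositive\<close>
    have z: "form n X \<pi> \<xi> \<xi> = 0" if "unitary_rep G \<pi>" "\<And>i. i < n \<Longrightarrow> \<xi> i \<in> l2" for \<pi> \<xi>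
    proof -
      have "Re (form n X \<pi> \<xi> \<xi>) \<ge> 0" "Im (form n X \<pi> \<xi> \<xi>) = 0" "Re (form n (- X) \<pi> \<xi> \<xi>) \<ge> 0"
        using * that by (auto simp: cone_iff)
      then show ?thesis using form_uminus[OF X that] by (simp add: complex_eq_iff)
    qed
    have "X $$ (i, j) = 0" if ij: "i < n" "j < n" for i j
    proof (intro ext)
      fix \<pi> x t
      show "(X $$ (i, j)) \<pi> x t = 0 \<pi> x t"
      proof (cases "unitary_rep G \<pi> \<and> x \<in> l2")
        case True
        then have \<pi>: "unitary_rep G \<pi>" and x: "x \<in> l2" by auto
        define y where "y = (X $$ (i, j)) \<pi> x"
        have y: "y \<in> l2" using opf_l2[OF entries_op[OF X ij] \<pi> x] by (simp add: y_def)
        have "l2_inner y y = form n X \<pi> (\<lambda>p. if p = i then y else 0) (\<lambda>q. if q = j then x else 0)"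
          using form_single[OF X \<pi> ij y x] by (simp add: y_def)
        also have "\<dots> = 0"
          by (rule form_polar(2)[OF X \<pi>]) (simp_all add: x y z[OF \<pi>] l2_zero)
        finally have "y = 0" by (rule inner_self_eq_0[OF y])
        then show ?thesis by (simp add: y_def)
      next
        case False
        then show ?thesis using opf_off[OF entries_op[OF X ij] False] by simp
      qed
    qed
    then show "X = 0\<^sub>m n n" using X by (auto simp: entries_def) }
  have herm: "entries n X \<and> (\<forall>i<n. \<forall>j<n. adj_pair G (X $$ (j, i)) (X $$ (i, j)))" if "X \<in> os_herm S n"
    using that herm_iff by (auto simp: os_herm_def mats)
  { assume "X \<in> os_herm S n"
    from herm[OF this] have X: "entries n X" "\<And>i j. i < n \<Longrightarrow> j < n \<Longrightarrow> adj_pair G (X $$ (j, i)) (X $$ (i, j))" by auto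
    obtain M where M: "M \<ge> 0" "\<And>\<pi> \<xi>. unitary_rep G \<pi> \<Longrightarrow> (\<And>i. i < n \<Longrightarrow> \<xi> i \<in> l2) \<Longrightarrow>
      cmod (form n X \<pi> \<xi> \<xi>) \<le> M * (\<Sum>i<n. sq_norm (\<xi> i))" using form_bound[OF X(1)] by blast
    have "os_unit_mat S n (M + 1) + X \<in> os_cone S n"
      unfolding cone_iff
    proof (intro conjI allI impI)
      show "entries n (os_unit_mat S n (M + 1) + X)" by (rule entries_add[OF entries_unit X(1)])
      fix \<pi> \<xi> assume \<pi>: "unitary_rep G \<pi>" and "\<forall>i<n. \<xi> i \<in> l2"
      then have \<xi>: "\<And>i. i < n \<Longrightarrow> \<xi> i \<in> l2" by blast
      have f: "form n (os_unit_mat S n (M + 1) + X) \<pi> \<xi> \<xi> = of_real ((M + 1) * (\<Sum>i<n. sq_norm (\<xi> i))) + form n X \<pi> \<xi> \<xi>"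
        using form_add[OF entries_unit X(1) \<pi>] form_unit[OF \<pi>] \<xi> by simp
      have "\<bar>Re (form n X \<pi> \<xi> \<xi>)\<bar> \<le> M * (\<Sum>i<n. sq_norm (\<xi> i))"
        using M(2)[of \<pi> \<xi>, OF \<pi> \<xi>] abs_Re_le_cmod[of "form n X \<pi> \<xi> \<xi>"] by linarith
      moreover have "(\<Sum>i<n. sq_norm (\<xi> i)) \<ge> 0" using \<xi> by (intro sum_nonneg sq_norm_nonneg) auto
      ultimately show "0 \<le> Re (form n (os_unit_mat S n (M + 1) + X) \<pi> \<xi> \<xi>)"
        unfolding f by (simp add: distrib_right)
      show "Im (form n (os_unit_mat S n (M + 1) + X) \<pi> \<xi> \<xi>) = 0"
        unfolding f using herm_form_real[OF X \<pi> \<xi>] by simp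
    qed
    then show "\<exists>r>0. os_unit_mat S n r + X \<in> os_cone S n" using M(1) by (intro exI[of _ "M + 1"]) auto }
  { assume "X \<in> os_herm S n" and ar: "\<And>r. r > 0 \<Longrightarrow> os_unit_mat S n r + X \<in> os_cone S n"
    from herm[OF this(1)] have X: "entries n X" "\<And>i j. i < n \<Longrightarrow> j < n \<Longrightarrow> adj_pair G (X $$ (j, i)) (X $$ (i, j))" by auto
    show "X \<in> os_cone S n"
      unfolding cone_iff
    proof (intro conjI allI impI)
      show "entries n X" by (rule X)
      fix \<pi> \<xi> assume \<pi>: "unitary_rep G \<pi>" and "\<forall>i<n. \<xi> i \<in> l2"
      then have \<xi>: "\<And>i. i < n \<Longrightarrow> \<xi> i \<in> l2" by blast
      show "Im (form n X \<pi> \<xi> \<xi>) = 0" using herm_form_real[OF X \<pi> \<xi>] by simp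
      define T where "T = (\<Sum>i<n. sq_norm (\<xi> i))"
      have T: "T \<ge> 0" unfolding T_def using \<xi> by (intro sum_nonneg sq_norm_nonneg) auto
      have pos: "0 \<le> r * T + Re (form n X \<pi> \<xi> \<xi>)" if "r > 0" for r
      proof -
        have "Re (form n (os_unit_mat S n r + X) \<pi> \<xi> \<xi>) \<ge> 0"
          using ar[OF that] \<pi> \<xi> by (auto simp: cone_iff)
        then show ?thesis using form_add[OF entries_unit X(1) \<pi>] form_unit[OF \<pi>] \<xi> by (simp add: T_def)
      qed
      show "0 \<le> Re (form n X \<pi> \<xi> \<xi>)"
      proof (rule field_le_epsilon)
        fix e :: real assume e: "e > 0"
        have "e / (T + 1) * T \<le> e" using T e by (simp add: field_simps)
        then show "0 \<le> Re (form n X \<pi> \<xi> \<xi>) + e" using pos[of "e / (T + 1)"] T e by simp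
      qed
    qed }
next
  fix m n :: nat and X and A :: "complex mat" assume "m > 0" "n > 0" "X \<in> os_cone S m" and A: "A \<in> carrier_mat m n"
  then have X: "entries m X" "\<And>\<pi> \<xi>. unitary_rep G \<pi> \<Longrightarrow> (\<And>i. i < m \<Longrightarrow> \<xi> i \<in> l2) \<Longrightarrow> Re (form m X \<pi> \<xi> \<xi>) \<ge> 0 \<and> Im (form m X \<pi> \<xi> \<xi>) = 0"
    by (auto simp: cone_iff)
  show "os_conj S A X \<in> os_cone S n"
    unfolding cone_iff
  proof (intro conjI allI impI)
    show "entries n (os_conj S A X)" by (rule entries_conj[OF X(1) A])
    fix \<pi> \<xi> assume \<pi>: "unitary_rep G \<pi>" and "\<forall>i<n. \<xi> i \<in> l2"
    then have \<xi>: "\<And>i. i < n \<Longrightarrow> \<xi> i \<in> l2" by blast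
    have \<eta>: "(\<Sum>i<n. scal (A $$ (p, i)) (\<xi> i)) \<in> l2" for p using \<xi> by (intro l2_sum l2_scal) auto
    show "Re (form n (os_conj S A X) \<pi> \<xi> \<xi>) \<ge> 0" "Im (form n (os_conj S A X) \<pi> \<xi> \<xi>) = 0"
      using X(2)[OF \<pi> \<eta>] by (auto simp: form_conj[OF X(1) A \<pi> \<xi>])
  qed
qed

end

section \<open>The operator system \<open>NCP(k)\<close>\<close>

locale ncp =
  fixes k :: nat
  assumes k: "k \<ge> 2"
begin

sublocale F: vector_space "fam_smult :: complex \<Rightarrow> (int + int) list family \<Rightarrow> _" by (rule fam_vector_space)

abbreviation "G \<equiv> Zk_Z2 k"

definition w_fam :: "nat \<Rightarrow> (int + int) list family" where
  "w_fam i = gunitary G (NCP_w [^]\<^bsub>G\<^esub> i)"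

definition v_fam :: "(int + int) list family" where
  "v_fam = gunitary G NCP_v"

definition NCP_space :: "(int + int) list family set" where
  "NCP_space = module.span fam_smult (insert v_fam (w_fam ` {0..<k}))"

lemma NCP_eq: "NCP k = os_sub NCP_space (full_cstar G)"
  by (simp add: NCP_def NCP_space_def v_fam_def w_fam_def)

lemma w_fam_apply: "i \<le> k \<Longrightarrow> unitary_rep G \<pi> \<Longrightarrow> x \<in> l2 \<Longrightarrow> w_fam i \<pi> x = (\<pi> NCP_w ^^ i) x"
  using rep_w_pow[OF k] by (simp add: w_fam_def gunitary_def)

lemma v_fam_apply: "unitary_rep G \<pi> \<Longrightarrow> x \<in> l2 \<Longrightarrow> v_fam \<pi> x = \<pi> NCP_v x"
  by (simp add: v_fam_def gunitary_def)

lemma w_fam_k: "w_fam k = w_fam 0"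
  using w_pow[OF k, of k] w_pow[OF k, of 0] by (simp add: w_fam_def)

lemma w_fam_in: "i \<le> k \<Longrightarrow> w_fam i \<in> NCP_space"
  unfolding NCP_space_def using w_fam_k k by (cases "i = k") (auto intro!: F.span_base)

lemma v_fam_in: "v_fam \<in> NCP_space"
  unfolding NCP_space_def by (auto intro!: F.span_base)

lemma unit_eq: "gunitary G \<one>\<^bsub>G\<^esub> = w_fam 0"
  using w_pow[OF k, of 0] by (simp add: w_fam_def one_Zk_Z2)

lemma NCP_space_op: "a \<in> NCP_space \<Longrightarrow> operator_fam G a"
proof -
  have "insert v_fam (w_fam ` {0..<k}) \<subseteq> Collect (operator_fam G)"
    using operator_fam_gunitary[OF v_carrier[OF k]] operator_fam_gunitary[OF w_pow_carrier[OF k]]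
    by (auto simp: v_fam_def w_fam_def)
  from F.span_minimal[OF this subspace_operator_fam] show "a \<in> NCP_space \<Longrightarrow> operator_fam G a"
    by (auto simp: NCP_space_def)
qed

text \<open>
The inverse of \<open>w\<^sup>i\<close> is \<open>w\<^sup>k\<^sup>-\<^sup>i\<close>. For \<open>i = 0\<close> this is \<open>w\<^sup>k = 1\<close>, which is \<open>w\<^sup>0\<close> and hence again one of
the spanning elements.
\<close>

lemma adj_w_fam: "i \<le> k \<Longrightarrow> adj_pair G (w_fam i) (w_fam (k - i))"
  unfolding adj_pair_def
proof (intro allI impI)
  fix \<pi> x z assume i: "i \<le> k" and "unitary_rep G \<pi> \<and> x \<in> l2 \<and> z \<in> l2"
  then have \<pi>: "unitary_rep G \<pi>" and x: "x \<in> l2" and z: "z \<in> l2" by auto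
  let ?W = "\<pi> NCP_w"
  have u: "l2_unitary (?W ^^ j)" for j using rep_unitary_w[OF k \<pi>] by (rule unitary_funpow)
  have "l2_inner ((?W ^^ (k - i)) x) z = l2_inner ((?W ^^ i) ((?W ^^ (k - i)) x)) ((?W ^^ i) z)"
    using unitary_inner[OF u unitary_l2[OF u x] z] by simp
  also have "(?W ^^ i) ((?W ^^ (k - i)) x) = x"
    using rep_w_k[OF k \<pi> x] i by (simp flip: funpow_add[unfolded comp_def fun_eq_iff, rule_format])
  finally show "l2_inner (w_fam (k - i) \<pi> x) z = l2_inner x (w_fam i \<pi> z)"
    using i by (simp add: w_fam_apply \<pi> x z)
qed

lemma adj_v_fam: "adj_pair G v_fam v_fam"
  unfolding adj_pair_def
proof (intro allI impI)
  fix \<pi> x z assume "unitary_rep G \<pi> \<and> x \<in> l2 \<and> z \<in> l2"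
  then have \<pi>: "unitary_rep G \<pi>" and x: "x \<in> l2" and z: "z \<in> l2" by auto
  note u = rep_unitary_v[OF k \<pi>]
  show "l2_inner (v_fam \<pi> x) z = l2_inner x (v_fam \<pi> z)"
    using unitary_inner[OF u unitary_l2[OF u x] z] rep_v_v[OF k \<pi> x] by (simp add: v_fam_apply \<pi> x z)
qed

lemma adj_zero: "adj_pair G 0 0"
  by (simp add: adj_pair_def)

lemma adj_comb:
  assumes "a \<in> NCP_space" "b \<in> NCP_space" "a' \<in> NCP_space" "b' \<in> NCP_space" "adj_pair G a a'" "adj_pair G b b'"
  shows "adj_pair G (fam_smult c a + b) (fam_smult (cnj c) a' + b')"
  using assms(5,6) opf_l2[OF NCP_space_op[OF assms(1)]] opf_l2[OF NCP_space_op[OF assms(2)]]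
    opf_l2[OF NCP_space_op[OF assms(3)]] opf_l2[OF NCP_space_op[OF assms(4)]]
  unfolding adj_pair_def
  by (simp add: fam_smult_apply inner_add_left inner_add_right inner_scal_left inner_scal_right l2_scal)

lemma NCP_space_comb: "a \<in> NCP_space \<Longrightarrow> b \<in> NCP_space \<Longrightarrow> fam_smult c a + b \<in> NCP_space"
  by (simp add: NCP_space_def F.span_add F.span_scale)

lemma NCP_space_zero: "0 \<in> NCP_space"
  by (simp add: NCP_space_def F.span_zero)

lemma NCP_space_adj:
  assumes "a \<in> NCP_space" shows "\<exists>b\<in>NCP_space. adj_pair G a b"
proof -
  have "a \<in> NCP_space \<and> (\<exists>b\<in>NCP_space. adj_pair G a b)"
    using assms[unfolded NCP_space_def]
  proof (induction rule: F.span_induct_alt)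
    case base
    show ?case using NCP_space_zero adj_zero by blast
  next
    case (step c x y)
    have x: "x \<in> NCP_space" using step(1) unfolding NCP_space_def by (rule F.span_base)
    have "\<exists>b\<in>NCP_space. adj_pair G x b"
    proof (cases "x = v_fam")
      case True then show ?thesis using adj_v_fam v_fam_in by blast
    next
      case False
      with step(1) obtain i where "x = w_fam i" "i < k" by auto
      then show ?thesis using adj_w_fam[of i] w_fam_in[of "k - i"] by auto
    qed
    then show ?case using adj_comb NCP_space_comb x step(2) by meson
  qed
  then show ?thesis by blast
qed

lemma NCP_space_carrier: "NCP_space \<subseteq> full_cstar_carrier G"
proof
  fix a assume a: "a \<in> NCP_space"
  have "insert v_fam (w_fam ` {0..<k}) \<subseteq> gunitary G ` carrier G"
    using v_carrier[OF k] w_pow_carrier[OF k] by (auto simp: v_fam_def w_fam_def)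
  from F.span_mono[OF this] a have sp: "a \<in> module.span fam_smult (gunitary G ` carrier G)" by (auto simp: NCP_space_def)
  have "l2_norm (a \<pi> x - a \<pi> x) \<le> \<epsilon> * l2_norm x" if "\<epsilon> > 0" "x \<in> l2" for \<epsilon> :: real and \<pi> x
    using that sq_norm_nonneg[OF that(2)] by (simp add: l2_norm_def sq_norm_def)
  then show "a \<in> full_cstar_carrier G"
    using opf_l2[OF NCP_space_op[OF a]] opf_off[OF NCP_space_op[OF a]] sp unfolding full_cstar_carrier_def by blast
qed

sublocale O: group_operator_system G NCP_space
proof
  show "module.subspace fam_smult NCP_space" unfolding NCP_space_def by (rule F.subspace_span)
  show "NCP_space \<subseteq> full_cstar_carrier G" by (rule NCP_space_carrier)
  show "gunitary G \<one>\<^bsub>G\<^esub> \<in> NCP_space" unfolding unit_eq by (rule w_fam_in) simp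
  show "\<pi> \<one>\<^bsub>G\<^esub> x = x" if "unitary_rep G \<pi>" "x \<in> l2" for \<pi> x
    using rep_one[OF k that] by (simp add: one_Zk_Z2)
qed (fact NCP_space_op NCP_space_adj)+

lemma operator_system_NCP: "operator_system (NCP k)"
  unfolding NCP_eq by (rule O.operator_system_os_sub)

text \<open>
The spectral projection of \<open>w\<close> for the eigenvalue \<open>\<omega>\<^sup>m\<close>, as a discrete Fourier transform of the
powers of \<open>w\<close>.
\<close>

definition w_proj :: "nat \<Rightarrow> (int + int) list family" where
  "w_proj m = (\<Sum>i<k. fam_smult (cnj (unity_root k ^ (i * m)) / of_nat k) (w_fam i))"

lemma w_proj_in: "w_proj m \<in> NCP_space"
  unfolding w_proj_def using w_fam_in unfolding NCP_space_def by (intro F.span_sum F.span_scale) auto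

lemma w_proj_apply:
  assumes "unitary_rep G \<pi>" "x \<in> l2"
  shows "w_proj m \<pi> x = scal (1 / of_nat k) (\<Sum>i<k. scal (cnj (unity_root k ^ (i * m))) ((\<pi> NCP_w ^^ i) x))"
  using assms by (simp add: w_proj_def sum_apply fam_smult_apply w_fam_apply) (simp add: fun_eq_iff scal_def sum_apply sum_divide_distrib)

text \<open>
Let \<open>q = k p\<^sub>m x\<close>, the vector \<open>\<Sum>\<^sub>i \<omega>\<^sup>-\<^sup>i\<^sup>m w\<^sup>i x\<close>. A cyclic shift of the sum shows that \<open>w q = \<omega>\<^sup>m q\<close>.
Hence all summands have the same inner product with \<open>q\<close> as \<open>x\<close> has, which gives
\<open>\<langle>q, q\<rangle> = k \<langle>x, q\<rangle>\<close>, so \<open>\<langle>x, p\<^sub>m x\<rangle> = \<parallel>q\<parallel>\<^sup>2/k\<^sup>2\<close>.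
\<close>

lemma w_proj_positive:
  assumes \<pi>: "unitary_rep G \<pi>" and x: "x \<in> l2"
  shows "\<exists>r\<ge>0. l2_inner x (w_proj m \<pi> x) = of_real r"
proof -
  let ?W = "\<pi> NCP_w"
  have u: "l2_unitary (?W ^^ j)" for j using rep_unitary_w[OF k \<pi>] by (rule unitary_funpow)
  have ul: "(?W ^^ j) x \<in> l2" for j by (rule unitary_l2[OF u x])
  define f where "f = (\<lambda>i. scal (cnj (unity_root k ^ (i * m))) ((?W ^^ i) x))"
  define q where "q = (\<Sum>i<k. f i)"
  have fl: "f i \<in> l2" for i unfolding f_def by (rule l2_scal[OF ul])
  have q: "q \<in> l2" unfolding q_def by (rule l2_sum[OF fl])
  have cc: "unity_root k ^ j * cnj (unity_root k ^ j) = 1" for j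
    using cnj_unity_root(1)[of k] by (metis complex_cnj_power mult.commute power_mult_distrib power_one)
  have Wf: "?W (f i) = scal (unity_root k ^ m) (f (Suc i))" for i
  proof -
    have "?W (f i) = scal (cnj (unity_root k ^ (i * m))) ((?W ^^ Suc i) x)"
      unfolding f_def using unitary_scal[OF rep_unitary_w[OF k \<pi>] ul] by simp
    also have "cnj (unity_root k ^ (i * m)) = unity_root k ^ m * cnj (unity_root k ^ (Suc i * m))"
      using cc[of m] by (simp add: power_add flip: mult.assoc)
    finally show ?thesis by (simp add: f_def scal_def fun_eq_iff)
  qed
  have shift: "(\<Sum>i<k. f (Suc i)) = q"
  proof -
    have "f k = f 0"
    proof -
      have "unity_root k ^ (k * m) = 1" using unity_root_pow[of k] k by (simp add: power_mult)
      then have "f k = scal 1 x" by (simp only: f_def rep_w_k[OF k \<pi> x] complex_cnj_one)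
      then show ?thesis by (simp add: f_def)
    qed
    moreover have "f 0 + (\<Sum>i<k. f (Suc i)) = (\<Sum>i<k. f i) + f k"
      using sum.lessThan_Suc_shift[of f k] by (simp del: sum.lessThan_Suc add: sum.lessThan_Suc[symmetric])
    ultimately show ?thesis by (simp add: q_def)
  qed
  have Wq: "?W q = scal (unity_root k ^ m) q"
  proof -
    have "?W q = (\<Sum>i<k. ?W (f i))" unfolding q_def by (rule unitary_sum[OF rep_unitary_w[OF k \<pi>] fl])
    also have "\<dots> = scal (unity_root k ^ m) (\<Sum>i<k. f (Suc i))"
      by (simp add: Wf fun_eq_iff scal_def sum_apply sum_distrib_left)
    finally show ?thesis by (simp only: shift)
  qed
  have Wiq: "(?W ^^ i) q = scal (unity_root k ^ (i * m)) q" for i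
  proof (induction i)
    case (Suc i)
    have "(?W ^^ Suc i) q = scal (unity_root k ^ (i * m)) (?W q)"
      using unitary_scal[OF rep_unitary_w[OF k \<pi>] q] Suc by simp
    then show ?case unfolding Wq by (simp add: scal_def fun_eq_iff power_add)
  qed (simp add: scal_def)
  have "l2_inner (f i) q = l2_inner x q" for i
  proof -
    have "l2_inner x q = l2_inner ((?W ^^ i) x) ((?W ^^ i) q)" by (rule unitary_inner[OF u x q, symmetric])
    also have "\<dots> = unity_root k ^ (i * m) * l2_inner ((?W ^^ i) x) q"
      unfolding Wiq by (rule inner_scal_right[OF ul q])
    also have "\<dots> = l2_inner (f i) q" unfolding f_def using inner_scal_left[OF ul q] by simp
    finally show ?thesis by simp
  qed
  moreover have "l2_inner q q = (\<Sum>i<k. l2_inner (f i) q)"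
    by (subst (1) q_def) (rule inner_sum_left[OF q fl])
  ultimately have "l2_inner q q = of_nat k * l2_inner x q" by simp
  then have "l2_inner x q = of_real (sq_norm q / real k)"
    using k by (simp add: inner_self[OF q] field_simps)
  moreover have "w_proj m \<pi> x = scal (1 / of_nat k) q" unfolding w_proj_apply[OF \<pi> x] q_def f_def ..
  ultimately have "l2_inner x (w_proj m \<pi> x) = of_real (sq_norm q / real k / real k)"
    by (simp add: inner_scal_right[OF x q])
  moreover have "sq_norm q / real k / real k \<ge> 0" using sq_norm_nonneg[OF q] by simp
  ultimately show ?thesis by blast
qed

lemma cone_1I:
  assumes a: "a \<in> NCP_space" and pos: "\<And>\<pi> x. unitary_rep G \<pi> \<Longrightarrow> x \<in> l2 \<Longrightarrow> \<exists>r\<ge>0. l2_inner x (a \<pi> x) = of_real r"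
  shows "mat 1 1 (\<lambda>_. a) \<in> os_cone (NCP k) 1"
  unfolding NCP_eq O.cone_iff
proof (intro conjI allI impI)
  show "O.entries 1 (mat 1 1 (\<lambda>_. a))" using a by (simp add: O.entries_def)
  fix \<pi> and \<xi> :: "nat \<Rightarrow> cseq" assume \<pi>: "unitary_rep G \<pi>" and \<xi>: "\<forall>i<1. \<xi> i \<in> l2"
  obtain r where "r \<ge> 0" "l2_inner (\<xi> 0) (a \<pi> (\<xi> 0)) = of_real r" using pos[OF \<pi>, of "\<xi> 0"] \<xi> by auto
  then show "Re (form 1 (mat 1 1 (\<lambda>_. a)) \<pi> \<xi> \<xi>) \<ge> 0" "Im (form 1 (mat 1 1 (\<lambda>_. a)) \<pi> \<xi> \<xi>) = 0"
    by (simp_all add: form_def)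
qed

lemma w_proj_cone: "mat 1 1 (\<lambda>_. w_proj m) \<in> os_cone (NCP k) 1"
  by (rule cone_1I[OF w_proj_in w_proj_positive])

text \<open>
For \<open>s = \<plusminus>1\<close> the element \<open>1 + sv\<close> is twice a projection, so \<open>\<langle>x, (1 + sv) x\<rangle> = \<parallel>(1 + sv) x\<parallel>\<^sup>2/2\<close>.
\<close>

lemma one_pm_v_cone:
  assumes s: "s = 1 \<or> s = - 1"
  shows "mat 1 1 (\<lambda>_. w_fam 0 + fam_smult s v_fam) \<in> os_cone (NCP k) 1"
proof (rule cone_1I)
  show "w_fam 0 + fam_smult s v_fam \<in> NCP_space" using NCP_space_comb[OF v_fam_in w_fam_in[of 0], of s] by (simp add: add.commute)
  fix \<pi> x assume \<pi>: "unitary_rep G \<pi>" and x: "x \<in> l2"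
  define z where "z = \<pi> NCP_v x"
  note u = rep_unitary_v[OF k \<pi>]
  have z: "z \<in> l2" unfolding z_def by (rule unitary_l2[OF u x])
  have zz: "l2_inner z z = l2_inner x x" unfolding z_def by (rule unitary_inner[OF u x x])
  have zx: "l2_inner z x = l2_inner x z"
    using adj_v_fam \<pi> x by (auto simp: adj_pair_def v_fam_apply z_def)
  define y where "y = x + scal s z"
  have y: "y \<in> l2" unfolding y_def using x z by (intro l2_add l2_scal)
  have xy: "l2_inner x y = l2_inner x x + s * l2_inner x z"
    unfolding y_def using x z by (simp add: inner_add_right inner_scal_right l2_scal)
  have zy: "l2_inner z y = l2_inner x z + s * l2_inner x x"
    unfolding y_def using x z by (simp add: inner_add_right inner_scal_right l2_scal zx zz)
  have "l2_inner y y = l2_inner x y + cnj s * l2_inner z y"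
    using inner_add_left[OF x l2_scal[OF z] y, of s] inner_scal_left[OF z y, of s] by (simp add: y_def)
  also have "\<dots> = 2 * l2_inner x y"
    using s by (auto simp: xy zy)
  finally have "l2_inner y y = 2 * l2_inner x y" .
  then have "l2_inner x y = of_real (sq_norm y / 2)" by (simp add: inner_self[OF y])
  moreover have "(w_fam 0 + fam_smult s v_fam) \<pi> x = y"
    using \<pi> x by (simp add: y_def z_def fam_smult_apply w_fam_apply v_fam_apply)
  ultimately show "\<exists>r\<ge>0. l2_inner x ((w_fam 0 + fam_smult s v_fam) \<pi> x) = of_real r"
    using sq_norm_nonneg[OF y] by (intro exI[of _ "sq_norm y / 2"]) simp
qed

text \<open>
Fourier inversion, from the orthogonality of the characters of \<open>\<int>\<^sub>k\<close>.
\<close>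

lemma w_fam_w_proj: assumes "i < k" shows "w_fam i = (\<Sum>m<k. fam_smult (unity_root k ^ (i * m)) (w_proj m))"
proof -
  have "(\<Sum>m<k. fam_smult (unity_root k ^ (i * m)) (w_proj m)) =
      (\<Sum>m<k. \<Sum>l<k. fam_smult (unity_root k ^ (i * m) * (cnj (unity_root k ^ (l * m)) / of_nat k)) (w_fam l))"
    by (simp add: w_proj_def F.scale_sum_right)
  also have "\<dots> = (\<Sum>l<k. \<Sum>m<k. fam_smult (unity_root k ^ (i * m) * (cnj (unity_root k ^ (l * m)) / of_nat k)) (w_fam l))"
    by (rule sum.swap)
  also have "\<dots> = (\<Sum>l<k. fam_smult (if l = i then 1 else 0) (w_fam l))"
  proof (intro sum.cong refl)
    fix l assume "l \<in> {..<k}"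
    then have "(\<Sum>m<k. unity_root k ^ (i * m) * (cnj (unity_root k ^ (l * m)) / of_nat k)) = (if l = i then 1 else 0)"
      using unity_root_orthogonal[of l k i] assms by (simp add: mult.commute flip: sum_divide_distrib)
    then show "(\<Sum>m<k. fam_smult (unity_root k ^ (i * m) * (cnj (unity_root k ^ (l * m)) / of_nat k)) (w_fam l)) =
        fam_smult (if l = i then 1 else 0) (w_fam l)"
      by (simp only: F.scale_sum_left[symmetric])
  qed
  also have "\<dots> = (\<Sum>l<k. if l = i then w_fam l else 0)"
    by (intro sum.cong refl) auto
  also have "\<dots> = w_fam i" using assms by simp
  finally show ?thesis by simp
qed

text \<open>
The spanning family \<open>p\<^sub>0, \<dots>, p\<^sub>k\<^sub>-\<^sub>1, v\<close>, indexed by \<open>{..k}\<close> with \<open>v\<close> at the index \<open>k\<close>.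
\<close>

definition gen :: "nat \<Rightarrow> (int + int) list family" where
  "gen j = (if j < k then w_proj j else v_fam)"

lemma gen_in: "gen j \<in> NCP_space"
  by (simp add: gen_def w_proj_in v_fam_in)

lemma unit_gen: "gunitary G \<one>\<^bsub>G\<^esub> = (\<Sum>j<k. gen j)"
  using w_fam_w_proj[of 0] k by (simp add: unit_eq gen_def)

lemma gen_adj: "adj_pair G (gen j) (gen j)"
proof (cases "j < k")
  case True
  have e: "O.entries 1 (mat 1 1 (\<lambda>_. w_proj j))" using w_proj_in by (simp add: O.entries_def)
  have "adj_pair G (mat 1 1 (\<lambda>_. w_proj j) $$ (0, 0)) (mat 1 1 (\<lambda>_. w_proj j) $$ (0, 0))"
    using w_proj_cone[of j] by (intro O.cone_adj[OF e]) (auto simp: NCP_eq O.cone_iff)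
  with True show ?thesis by (simp add: gen_def)
qed (simp add: gen_def adj_v_fam)

lemma NCP_space_gen:
  assumes "a \<in> NCP_space" shows "\<exists>c. a = (\<Sum>j\<le>k. fam_smult (c j) (gen j))"
  using assms unfolding NCP_space_def
proof (induction rule: F.span_induct_alt)
  case base
  show ?case by (intro exI[of _ "\<lambda>_. 0"]) simp
next
  case (step c x y)
  have "\<exists>d. x = (\<Sum>j\<le>k. fam_smult (d j) (gen j))"
  proof (cases "x = v_fam")
    case True
    have "v_fam = (\<Sum>j\<le>k. if j = k then v_fam else 0)" by simp
    also have "\<dots> = (\<Sum>j\<le>k. fam_smult (if j = k then 1 else 0) (gen j))"
      by (intro sum.cong refl) (auto simp: gen_def)
    finally have "v_fam = (\<Sum>j\<le>k. fam_smult (if j = k then 1 else 0) (gen j))" .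
    then show ?thesis unfolding True by (intro exI[of _ "\<lambda>j. if j = k then 1 else 0"])
  next
    case False
    with step(1) obtain i where i: "x = w_fam i" "i < k" by auto
    have "x = (\<Sum>m<k. fam_smult (unity_root k ^ (i * m)) (gen m))" using w_fam_w_proj[OF i(2)] i(1) by (simp add: gen_def)
    also have "\<dots> = (\<Sum>m\<le>k. fam_smult (if m < k then unity_root k ^ (i * m) else 0) (gen m))"
      by (simp add: lessThan_Suc_atMost[symmetric])
    finally have "x = (\<Sum>m\<le>k. fam_smult (if m < k then unity_root k ^ (i * m) else 0) (gen m))" .
    then show ?thesis by (intro exI[of _ "\<lambda>m. if m < k then unity_root k ^ (i * m) else 0"])
  qed
  then obtain d where d: "x = (\<Sum>j\<le>k. fam_smult (d j) (gen j))" ..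
  obtain d' where d': "y = (\<Sum>j\<le>k. fam_smult (d' j) (gen j))" using step(2) ..
  have "fam_smult c x + y = (\<Sum>j\<le>k. fam_smult (c * d j + d' j) (gen j))"
    unfolding d d' by (simp add: F.scale_sum_right F.scale_left_distrib sum.distrib)
  then show ?case by (intro exI[of _ "\<lambda>j. c * d j + d' j"])
qed

text \<open>
The coefficients can be taken hermitian: the entry at \<open>(i, l)\<close> is the adjoint of the entry at
\<open>(l, i)\<close> and the generators are self-adjoint, so any choice of coefficients may be averaged with its
conjugate transpose.
\<close>

lemma cone_coeffs:
  assumes "X \<in> os_cone (NCP k) n"
  obtains c where "\<And>i l. i < n \<Longrightarrow> l < n \<Longrightarrow> X $$ (i, l) = (\<Sum>j\<le>k. fam_smult (c j i l) (gen j))"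
    "\<And>j i l. c j i l = cnj (c j l i)"
proof -
  have X: "O.entries n X" and re: "\<And>\<pi> \<xi>. unitary_rep G \<pi> \<Longrightarrow> (\<And>i. i < n \<Longrightarrow> \<xi> i \<in> l2) \<Longrightarrow> Im (form n X \<pi> \<xi> \<xi>) = 0"
    using assms by (auto simp: NCP_eq O.cone_iff)
  have ex: "\<exists>c. X $$ (i, l) = (\<Sum>j\<le>k. fam_smult (c j) (gen j))" if "i < n" "l < n" for i l
    using X that by (intro NCP_space_gen) (simp add: O.entries_def)
  define d where "d = (\<lambda>i l. SOME c. X $$ (i, l) = (\<Sum>j\<le>k. fam_smult (c j) (gen j)))"
  have d: "X $$ (i, l) = (\<Sum>j\<le>k. fam_smult (d i l j) (gen j))" if "i < n" "l < n" for i l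
    unfolding d_def by (rule someI_ex[OF ex[OF that]])
  have adj_sum: "adj_pair G (\<Sum>j\<in>J. fam_smult (e j) (gen j)) (\<Sum>j\<in>J. fam_smult (cnj (e j)) (gen j)) \<and>
      (\<Sum>j\<in>J. fam_smult (e j) (gen j)) \<in> NCP_space" if "finite J" for e and J :: "nat set"
    using that
  proof (induction J arbitrary: e)
    case empty
    show ?case using NCP_space_zero adj_zero by (simp only: sum.empty)
  next
    case (insert j J)
    have "adj_pair G (fam_smult (e j) (gen j) + (\<Sum>j\<in>J. fam_smult (e j) (gen j)))
        (fam_smult (cnj (e j)) (gen j) + (\<Sum>j\<in>J. fam_smult (cnj (e j)) (gen j)))"
      using insert.IH[of e] insert.IH[of "\<lambda>j. cnj (e j)"] gen_in gen_adj by (intro adj_comb) auto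
    then show ?case using insert NCP_space_comb[OF gen_in] by (simp del: plus_fun_apply)
  qed
  have X': "X $$ (i, l) = (\<Sum>j\<le>k. fam_smult (cnj (d l i j)) (gen j))" if "i < n" "l < n" for i l
  proof -
    have "adj_pair G (X $$ (l, i)) (X $$ (i, l))" by (rule O.cone_adj[OF X re that])
    then have "X $$ (i, l) = fam_adjoint G (X $$ (l, i))"
      using fam_adjoint_eq[OF O.entries_op[OF X that]] by simp
    also have "\<dots> = (\<Sum>j\<le>k. fam_smult (cnj (d l i j)) (gen j))"
      unfolding d[OF that(2,1)]
      by (rule fam_adjoint_eq) (use adj_sum[of "{..k}"] NCP_space_op in auto)
    finally show ?thesis .
  qed
  define c where "c = (\<lambda>j i l. (d i l j + cnj (d l i j)) / 2)"
  have "X $$ (i, l) = (\<Sum>j\<le>k. fam_smult (c j i l) (gen j))" if "i < n" "l < n" for i l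
  proof -
    have "(\<Sum>j\<le>k. fam_smult (c j i l) (gen j)) =
        fam_smult (1/2) ((\<Sum>j\<le>k. fam_smult (d i l j) (gen j)) + (\<Sum>j\<le>k. fam_smult (cnj (d l i j)) (gen j)))"
      by (simp add: c_def F.scale_sum_right F.scale_right_distrib F.scale_left_distrib add_divide_distrib sum.distrib)
    also have "\<dots> = fam_smult (1/2) (X $$ (i, l) + X $$ (i, l))" using d[OF that] X'[OF that] by simp
    also have "\<dots> = X $$ (i, l)" by (simp add: fam_smult_def fun_eq_iff)
    finally show ?thesis by simp
  qed
  moreover have "c j i l = cnj (c j l i)" for j i l by (simp add: c_def add.commute)
  ultimately show ?thesis by (rule that)
qed

text \<open>
The core of the proof. The kernels \<open>r\<^sub>0, \<dots>, r\<^sub>k\<^sub>-\<^sub>1\<close> are dilated to the \<open>k\<close> blocks of \<open>\<ell>\<^sup>2\<close>, where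
\<open>W\<close> acts on the block \<open>m\<close> as the scalar \<open>\<omega>\<^sup>m\<close>, and the two kernels \<open>(R \<plusminus> r\<^sub>k)/2\<close> to the even and the
odd coordinates, where \<open>D\<close> acts as \<open>1\<close> and \<open>- 1\<close>. The kernels of either kind add up to \<open>R\<close>, so the two
families of vectors are unitarily equivalent and \<open>D\<close> can be carried over to the first one.
\<close>

lemma realise_functional:
  assumes r: "\<And>j. j < k \<Longrightarrow> psd n (r j)"
    and plus: "psd n (\<lambda>i l. ((\<Sum>j<k. r j i l) + r k i l) / 2)"
    and minus: "psd n (\<lambda>i l. ((\<Sum>j<k. r j i l) - r k i l) / 2)"
  obtains \<pi> \<xi> where "unitary_rep G \<pi>" "\<And>i. \<xi> i \<in> l2"
    "\<And>i l j. i < n \<Longrightarrow> l < n \<Longrightarrow> j \<le> k \<Longrightarrow> l2_inner (\<xi> i) (gen j \<pi> (\<xi> l)) = r j i l"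
proof -
  have k0: "k > 0" using k by simp
  obtain \<xi> where \<xi>: "\<And>i. \<xi> i \<in> l2"
    "\<And>i l m. i < n \<Longrightarrow> l < n \<Longrightarrow> m < k \<Longrightarrow> l2_inner (\<xi> i) (residue_block k m (\<xi> l)) = r m i l"
    using naimark[of k n r, OF k0 r] by blast
  define h where "h = (\<lambda>m::nat. \<lambda>i l. ((\<Sum>j<k. r j i l) + (if m = 0 then r k i l else - r k i l)) / 2)"
  have "psd n (h m)" if "m < 2" for m
    using plus minus that by (cases "m = 0") (simp_all add: h_def)
  then obtain \<eta> where \<eta>: "\<And>i. \<eta> i \<in> l2"
    "\<And>i l m. i < n \<Longrightarrow> l < n \<Longrightarrow> m < 2 \<Longrightarrow> l2_inner (\<eta> i) (residue_block 2 m (\<eta> l)) = h m i l"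
    using naimark[of 2 n h] by auto
  have gram: "l2_inner (\<xi> i) (\<xi> l) = l2_inner (\<eta> i) (\<eta> l)" if "i < n" "l < n" for i l
  proof -
    have "l2_inner (\<xi> i) (\<xi> l) = l2_inner (\<xi> i) (\<Sum>m<k. residue_block k m (\<xi> l))" by (simp only: sum_residue_block[OF k0])
    also have "\<dots> = (\<Sum>m<k. r m i l)" using \<xi> that by (subst inner_sum_right) (auto intro: residue_block_l2)
    also have "\<dots> = (\<Sum>m<2. h m i l)" by (simp add: numeral_2_eq_2 h_def add_divide_distrib diff_divide_distrib)
    also have "\<dots> = l2_inner (\<eta> i) (\<Sum>m<2. residue_block 2 m (\<eta> l))" using \<eta> that by (subst inner_sum_right) (auto intro: residue_block_l2)
    also have "\<dots> = l2_inner (\<eta> i) (\<eta> l)" using sum_residue_block[of 2 "\<eta> l"] by simp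
    finally show ?thesis .
  qed
  obtain U where U: "l2_unitary U" "\<And>i. i < n \<Longrightarrow> U (\<xi> i) = \<eta> i"
    using gram_unitary[of n \<xi> \<eta>] \<xi>(1) \<eta>(1) gram by blast
  obtain U' where U': "l2_unitary U'" "\<And>x. x \<in> l2 \<Longrightarrow> U (U' x) = x" "\<And>x. x \<in> l2 \<Longrightarrow> U' (U x) = x"
    using unitary_inverse[OF U(1)] by blast
  define D :: "cseq \<Rightarrow> cseq" where "D = (\<lambda>x t. (if t mod 2 = 0 then 1 else - 1) * x t)"
  define W :: "cseq \<Rightarrow> cseq" where "W = (\<lambda>x t. unity_root k ^ (t mod k) * x t)"
  define V where "V = (\<lambda>x. U' (D (U x)))"
  have D: "l2_unitary D" unfolding D_def by (rule diag_unitary) auto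
  have W: "l2_unitary W" unfolding W_def by (rule diag_unitary) (simp add: norm_power cnj_unity_root(2))
  have V: "l2_unitary V" unfolding V_def by (rule unitary_comp[OF U'(1) unitary_comp[OF D U(1)]])
  have DD: "D (D x) = x" for x by (auto simp: D_def)
  have V2: "(V ^^ 2) x = x" if "x \<in> l2" for x
  proof -
    have "V (V x) = U' (D (D (U x)))"
      unfolding V_def using U'(2)[OF unitary_l2[OF D unitary_l2[OF U(1) that]]] by simp
    then show ?thesis using U'(3)[OF that] by (simp add: DD numeral_2_eq_2)
  qed
  have Wi: "(W ^^ i) x = (\<lambda>t. unity_root k ^ (i * (t mod k)) * x t)" for i x
    by (induction i) (auto simp: W_def power_add mult.assoc)
  have Wk: "(W ^^ k) x = x" for x
    using unity_root_pow[OF k0] by (simp add: Wi power_mult)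
  define \<pi> where "\<pi> = word_act W V"
  have \<pi>: "unitary_rep G \<pi>" unfolding \<pi>_def by (rule word_act_rep[OF k0 W V Wk V2])
  have \<pi>w: "\<pi> NCP_w = W" and \<pi>v: "\<pi> NCP_v = V"
    by (auto simp: \<pi>_def NCP_w_def NCP_v_def word_act_def fun_eq_iff)
  have w_proj: "w_proj m \<pi> x = residue_block k m x" if "m < k" "x \<in> l2" for m x
  proof
    fix t
    have "w_proj m \<pi> x t = (\<Sum>i<k. cnj (unity_root k ^ (i * m)) * unity_root k ^ (i * (t mod k))) * x t / of_nat k"
      unfolding w_proj_apply[OF \<pi> that(2)] \<pi>w Wi by (simp add: scal_def sum_apply sum_distrib_right mult.assoc)
    also have "\<dots> = residue_block k m x t"
      using unity_root_orthogonal[OF that(1), of "t mod k"] k0 by (simp add: residue_block_def)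
    finally show "w_proj m \<pi> x t = residue_block k m x t" .
  qed
  have D_block: "D x = residue_block 2 0 x - residue_block 2 1 x" for x
    by (auto simp: D_def residue_block_def fun_eq_iff)
  have "\<And>i l j. \<lbrakk>i < n; l < n; j \<le> k\<rbrakk> \<Longrightarrow> l2_inner (\<xi> i) (gen j \<pi> (\<xi> l)) = r j i l"
  proof -
    fix i l j assume il: "i < n" "l < n" and j: "j \<le> k"
    show "l2_inner (\<xi> i) (gen j \<pi> (\<xi> l)) = r j i l"
  proof (cases "j < k")
    case True
    then show ?thesis using \<xi> il w_proj by (simp add: gen_def)
  next
    case False
    with j have jk: "j = k" by simp
    have "l2_inner (\<xi> i) (gen j \<pi> (\<xi> l)) = l2_inner (\<xi> i) (V (\<xi> l))"
      using False by (simp add: gen_def v_fam_apply[OF \<pi> \<xi>(1)] \<pi>v)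
    also have "\<dots> = l2_inner (U (\<xi> i)) (U (V (\<xi> l)))"
      by (rule unitary_inner[OF U(1) \<xi>(1) unitary_l2[OF V \<xi>(1)], symmetric])
    also have "\<dots> = l2_inner (\<eta> i) (D (\<eta> l))"
      unfolding V_def using U'(2)[OF unitary_l2[OF D \<eta>(1)]] U(2) il by simp
    also have "\<dots> = h 0 i l - h 1 i l"
      using \<eta> il by (simp add: D_block inner_diff_right residue_block_l2)
    also have "\<dots> = r k i l" by (simp add: h_def add_divide_distrib diff_divide_distrib)
    finally show ?thesis by (simp add: jk)
  qed
  qed
  from that[OF \<pi> \<xi>(1) this] show ?thesis .
qed

end

section \<open>Positive maps out of \<open>NCP(k)\<close>\<close>

text \<open>
A unital positive map \<open>f\<close> from \<open>NCP(k)\<close> to an operator system \<open>T\<close>.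
\<close>

locale ncp_map = ncp k + T: operator_system T
  for k :: nat and T :: "'b::ab_group_add os" +
  fixes f :: "(int + int) list family \<Rightarrow> 'b"
  assumes lin: "os_linear (NCP k) T f" and unital: "os_unital (NCP k) T f" and pos: "os_positive (NCP k) T f"
begin

sublocale TV: vector_space "os_smult T" by (rule T.vector_space)

lemma f_in: "a \<in> NCP_space \<Longrightarrow> f a \<in> os_space T"
  and f_add: "a \<in> NCP_space \<Longrightarrow> b \<in> NCP_space \<Longrightarrow> f (a + b) = f a + f b"
  and f_smult: "a \<in> NCP_space \<Longrightarrow> f (fam_smult c a) = os_smult T c (f a)"
  using lin by (auto simp: os_linear_def NCP_eq O.S_simps)

definition g :: "nat \<Rightarrow> 'b" where "g j = f (gen j)"

lemma g_in: "g j \<in> os_space T"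
  by (simp add: g_def f_in gen_in)

lemma f_comb: "finite J \<Longrightarrow> f (\<Sum>j\<in>J. fam_smult (c j) (gen j)) = (\<Sum>j\<in>J. os_smult T (c j) (g j))"
proof (induction J rule: finite_induct)
  case empty
  have "f (fam_smult 0 0) = os_smult T 0 (f 0)" by (rule f_smult[OF NCP_space_zero])
  then have "f 0 = 0" by simp
  then show ?case by (simp only: sum.empty)
next
  case (insert j J)
  have "(\<Sum>j\<in>J. fam_smult (c j) (gen j)) \<in> NCP_space"
    unfolding NCP_space_def using gen_in unfolding NCP_space_def by (intro F.span_sum F.span_scale)
  moreover have "fam_smult (c j) (gen j) \<in> NCP_space"
    using gen_in unfolding NCP_space_def by (intro F.span_scale)
  ultimately show ?case using insert by (simp add: f_add f_smult gen_in g_def del: plus_fun_apply)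
qed

lemma pos_1:
  assumes "mat 1 1 (\<lambda>_. a) \<in> os_cone (NCP k) 1" shows "mat 1 1 (\<lambda>_. f a) \<in> os_cone T 1"
proof -
  have "map_mat f (mat 1 1 (\<lambda>_. a)) = mat 1 1 (\<lambda>_. f a)" by (rule eq_matI) auto
  then show ?thesis using pos assms unfolding os_positive_def by metis
qed

lemma cone_1_star: "mat 1 1 (\<lambda>_. t) \<in> os_cone T 1 \<Longrightarrow> os_star T t = t"
proof -
  assume "mat 1 1 (\<lambda>_. t) \<in> os_cone T 1"
  then have "os_adjoint T (mat 1 1 (\<lambda>_. t)) = mat 1 1 (\<lambda>_. t)"
    using T.cone_herm[of 1] by (auto simp: os_herm_def)
  from arg_cong[OF this, of "\<lambda>M. M $$ (0, 0)"] show "os_star T t = t"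
    by (simp add: os_adjoint_def)
qed

lemma f_unit: "f (w_fam 0) = os_unit T"
  using unital by (simp add: os_unital_def NCP_eq O.S_simps unit_eq)

lemma sum_g: "(\<Sum>j<k. g j) = os_unit T"
  using f_comb[of "{..<k}" "\<lambda>_. 1"] f_unit unit_gen by (simp add: unit_eq)

lemma f_pm: "f (w_fam 0 + fam_smult s v_fam) = (\<Sum>j\<le>k. os_smult T (if j < k then 1 else s) (g j))"
proof -
  have "f (w_fam 0 + fam_smult s v_fam) = os_unit T + os_smult T s (g k)"
    using f_add[OF w_fam_in[of 0], of "fam_smult s v_fam"] f_smult[OF v_fam_in, of s] v_fam_in f_unit
    by (simp add: g_def gen_def NCP_space_def F.span_scale)
  then show ?thesis by (simp add: sum_g lessThan_Suc_atMost[symmetric])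
qed

lemma g_star: assumes "j \<le> k" shows "os_star T (g j) = g j"
proof (cases "j < k")
  case True
  then show ?thesis using cone_1_star[OF pos_1[OF w_proj_cone[of j]]] by (simp add: g_def gen_def)
next
  case False
  with assms have j: "j = k" by simp
  have e: "f (w_fam 0 + fam_smult 1 v_fam) = os_unit T + g k"
    unfolding f_pm by (simp add: sum_g lessThan_Suc_atMost[symmetric])
  have "os_star T (os_unit T + g k) = os_unit T + g k"
    using cone_1_star[OF pos_1[OF one_pm_v_cone[of 1]]] unfolding e by simp
  then show ?thesis using T.star_add[OF T.unit_closed g_in] T.star_unit j by simp
qed

lemma comb_in: "(\<Sum>j\<in>J. os_smult T (c j) (g j)) \<in> os_space T"
  using T.subspace g_in by (intro TV.subspace_sum TV.subspace_scale)

lemma star_comb: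
  assumes "finite J" "J \<subseteq> {..k}"
  shows "os_star T (\<Sum>j\<in>J. os_smult T (c j) (g j)) = (\<Sum>j\<in>J. os_smult T (cnj (c j)) (g j))"
  using assms
proof (induction J rule: finite_induct)
  case empty
  have "os_star T (os_smult T 0 (g 0)) = os_smult T 0 (os_star T (g 0))" using T.star_smult[OF g_in, of 0] by simp
  then show ?case by simp
next
  case (insert j J)
  have "os_smult T (c j) (g j) \<in> os_space T" using T.subspace g_in by (intro TV.subspace_scale)
  then show ?case using insert T.star_add[OF _ comb_in] T.star_smult[OF g_in] g_star by simp
qed

text \<open>
The element \<open>\<Sum>\<^sub>j c\<^sub>j \<otimes> f(p\<^sub>j)\<close> of \<open>M\<^sub>n(T)\<close>, the \<open>k\<close>-th term being \<open>c\<^sub>k \<otimes> f(v)\<close>. The argument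
\<open>(j, i, l)\<close> of \<open>c\<close> stands for the entry at \<open>(i, l)\<close> of the scalar matrix \<open>c\<^sub>j\<close>.
\<close>

definition coeff_mat :: "nat \<Rightarrow> (nat \<times> nat \<times> nat \<Rightarrow> complex) \<Rightarrow> 'b mat" where
  "coeff_mat n c = mat n n (\<lambda>(i, l). \<Sum>j\<le>k. os_smult T (c (j, i, l)) (g j))"

lemma coeff_mat_add: "coeff_mat n c + coeff_mat n d = coeff_mat n (\<lambda>q. c q + d q)"
  by (rule eq_matI) (simp_all add: coeff_mat_def TV.scale_left_distrib sum.distrib)

lemma coeff_mat_scale: "map_mat (os_smult T s) (coeff_mat n c) = coeff_mat n (\<lambda>q. s * c q)"
  by (rule eq_matI) (simp_all add: coeff_mat_def TV.scale_sum_right)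

lemma coeff_mat_cong: "(\<And>q. q \<in> {..k} \<times> {..<n} \<times> {..<n} \<Longrightarrow> c q = d q) \<Longrightarrow> coeff_mat n c = coeff_mat n d"
  by (rule eq_matI) (auto simp: coeff_mat_def intro!: sum.cong)

lemma coeff_mat_herm:
  assumes "\<And>j i l. c (j, i, l) = cnj (c (j, l, i))" shows "coeff_mat n c \<in> os_herm T n"
proof -
  have "os_adjoint T (coeff_mat n c) = coeff_mat n c"
  proof (rule eq_matI)
    fix i l assume "i < dim_row (coeff_mat n c)" "l < dim_col (coeff_mat n c)"
    then have il: "i < n" "l < n" by (auto simp: coeff_mat_def)
    then have "os_adjoint T (coeff_mat n c) $$ (i, l) = (\<Sum>j\<le>k. os_smult T (cnj (c (j, l, i))) (g j))"
      by (simp add: os_adjoint_def coeff_mat_def star_comb)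
    also have "\<dots> = coeff_mat n c $$ (i, l)" using il by (simp add: coeff_mat_def assms[symmetric])
    finally show "os_adjoint T (coeff_mat n c) $$ (i, l) = coeff_mat n c $$ (i, l)" .
  qed (simp_all add: os_adjoint_def coeff_mat_def)
  then show ?thesis by (simp add: os_herm_def os_mats_def coeff_mat_def comb_in)
qed

text \<open>
The coefficients of the unit, which is the sum of the \<open>p\<^sub>j\<close>.
\<close>

definition unit_coeffs :: "nat \<times> nat \<times> nat \<Rightarrow> complex" where
  "unit_coeffs = (\<lambda>(j, i, l). if j < k \<and> i = l then 1 else 0)"

lemma coeff_mat_unit_coeffs: "coeff_mat n (\<lambda>q. of_real r * unit_coeffs q) = os_unit_mat T n r"
proof (rule eq_matI)
  fix i l assume "i < dim_row (os_unit_mat T n r)" "l < dim_col (os_unit_mat T n r)"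
  then have il: "i < n" "l < n" by (auto simp: os_unit_mat_def)
  have "(\<Sum>j\<le>k. os_smult T (of_real r * unit_coeffs (j, i, l)) (g j)) = (if i = l then os_smult T (of_real r) (\<Sum>j<k. g j) else 0)"
    by (simp add: unit_coeffs_def lessThan_Suc_atMost[symmetric] TV.scale_sum_right)
  then show "coeff_mat n (\<lambda>q. of_real r * unit_coeffs q) $$ (i, l) = os_unit_mat T n r $$ (i, l)"
    using il by (simp add: coeff_mat_def os_unit_mat_def sum_g)
qed (simp_all add: coeff_mat_def os_unit_mat_def)

definition add_adjoint :: "(nat \<times> nat \<times> nat \<Rightarrow> complex) \<Rightarrow> nat \<times> nat \<times> nat \<Rightarrow> complex" where
  "add_adjoint c = (\<lambda>(j, i, l). c (j, i, l) + cnj (c (j, l, i)))"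

lemma add_adjoint_herm: "add_adjoint c (j, i, l) = cnj (add_adjoint c (j, l, i))"
  by (simp add: add_adjoint_def add.commute)

lemma add_adjoint_of_herm: "(\<And>j i l. c (j, i, l) = cnj (c (j, l, i))) \<Longrightarrow> add_adjoint c = (\<lambda>q. of_real 2 * c q)"
proof -
  assume h: "\<And>j i l. c (j, i, l) = cnj (c (j, l, i))"
  show ?thesis
  proof
    fix q :: "nat \<times> nat \<times> nat"
    obtain j i l where q: "q = (j, i, l)" by (cases q)
    show "add_adjoint c q = of_real 2 * c q" unfolding q add_adjoint_def using h[of j i l, symmetric] by simp
  qed
qed

lemma unit_coeffs_herm: "unit_coeffs (j, i, l) = cnj (unit_coeffs (j, l, i))"
  by (simp add: unit_coeffs_def)

text \<open>
Adding the adjoint makes every coefficient tuple hermitian. Hence the cone contains all skew-hermitian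
tuples, and \<open>unit_coeffs\<close> is an order unit for the whole coordinate space, as separation in that space
requires.
\<close>

definition coeff_cone :: "nat \<Rightarrow> (nat \<times> nat \<times> nat \<Rightarrow> complex) set" where
  "coeff_cone n = {c. coeff_mat n (add_adjoint c) \<in> os_cone T n}"

lemma coeff_cone_herm_iff:
  assumes "n > 0" "\<And>j i l. c (j, i, l) = cnj (c (j, l, i))"
  shows "c \<in> coeff_cone n \<longleftrightarrow> coeff_mat n c \<in> os_cone T n"
proof
  assume "c \<in> coeff_cone n"
  then have "coeff_mat n (\<lambda>q. of_real 2 * c q) \<in> os_cone T n"
    by (simp only: coeff_cone_def mem_Collect_eq add_adjoint_of_herm[of c, OF assms(2)])
  from T.cone_scale[OF assms(1) this, of "1/2"] show "coeff_mat n c \<in> os_cone T n"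
    unfolding coeff_mat_scale by simp
next
  assume "coeff_mat n c \<in> os_cone T n"
  from T.cone_scale[OF assms(1) this, of 2] show "c \<in> coeff_cone n"
    by (simp add: coeff_mat_scale coeff_cone_def add_adjoint_of_herm[of c, OF assms(2)])
qed

lemma coeff_cone_add: "n > 0 \<Longrightarrow> u \<in> coeff_cone n \<Longrightarrow> v \<in> coeff_cone n \<Longrightarrow> (\<lambda>q. u q + v q) \<in> coeff_cone n"
proof -
  assume n: "n > 0" and "u \<in> coeff_cone n" "v \<in> coeff_cone n"
  then have "coeff_mat n (add_adjoint u) + coeff_mat n (add_adjoint v) \<in> os_cone T n" unfolding coeff_cone_def by (auto intro: T.cone_add)
  moreover have "add_adjoint (\<lambda>q. u q + v q) = (\<lambda>q. add_adjoint u q + add_adjoint v q)" by (auto simp: add_adjoint_def fun_eq_iff)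
  ultimately show ?thesis by (simp add: coeff_cone_def coeff_mat_add)
qed

lemma coeff_cone_scale: "n > 0 \<Longrightarrow> r \<ge> 0 \<Longrightarrow> u \<in> coeff_cone n \<Longrightarrow> (\<lambda>q. of_real r * u q) \<in> coeff_cone n"
proof -
  assume n: "n > 0" and "r \<ge> 0" "u \<in> coeff_cone n"
  then have "map_mat (os_smult T (of_real r)) (coeff_mat n (add_adjoint u)) \<in> os_cone T n" unfolding coeff_cone_def by (auto intro: T.cone_scale)
  moreover have "add_adjoint (\<lambda>q. of_real r * u q) = (\<lambda>q. of_real r * add_adjoint u q)" by (auto simp: add_adjoint_def fun_eq_iff distrib_left)
  ultimately show ?thesis by (simp add: coeff_cone_def coeff_mat_scale)
qed

lemma coeff_cone_local:
  assumes "u \<in> coeff_cone n" "\<And>q. q \<in> {..k} \<times> {..<n} \<times> {..<n} \<Longrightarrow> u q = v q" shows "v \<in> coeff_cone n"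
proof -
  have "coeff_mat n (add_adjoint u) = coeff_mat n (add_adjoint v)" by (rule coeff_mat_cong) (auto simp: add_adjoint_def assms(2))
  with assms(1) show ?thesis by (simp add: coeff_cone_def)
qed

lemma coeff_cone_unit:
  assumes n: "n > 0" shows "\<exists>r>0. (\<lambda>q. of_real r * unit_coeffs q + u q) \<in> coeff_cone n"
proof -
  obtain r where r: "r > 0" "os_unit_mat T n r + coeff_mat n (add_adjoint u) \<in> os_cone T n"
    using T.order_unit[OF n coeff_mat_herm[of "add_adjoint u", OF add_adjoint_herm]] by blast
  have "add_adjoint (\<lambda>q. of_real (r / 2) * unit_coeffs q + u q) = (\<lambda>q. of_real r * unit_coeffs q + add_adjoint u q)"
    by (auto simp: add_adjoint_def unit_coeffs_def fun_eq_iff)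
  then have "(\<lambda>q. of_real (r / 2) * unit_coeffs q + u q) \<in> coeff_cone n"
    using r(2) by (simp add: coeff_cone_def coeff_mat_add[symmetric] coeff_mat_unit_coeffs)
  with r(1) show ?thesis by (intro exI[of _ "r / 2"]) simp
qed

lemma coeff_cone_unit_coeffs: assumes n: "n > 0" shows "unit_coeffs \<in> coeff_cone n"
proof -
  obtain r where r: "r > 0" "(\<lambda>q. of_real r * unit_coeffs q + 0) \<in> coeff_cone n" using coeff_cone_unit[OF n, of "\<lambda>_. 0"] by blast
  from coeff_cone_scale[OF n _ r(2), of "1 / r"] r(1) show ?thesis by simp
qed

text \<open>
Compatibility of the cones of \<open>T\<close>: the scalar row \<open>a\<close> turns a positive element \<open>t\<close> of \<open>T\<close> into the
positive matrix \<open>a\<^sup>*ta\<close>.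
\<close>

lemma coeff_cone_rank_one:
  assumes n: "n > 0" and e: "\<And>j. cnj (e j) = e j"
    and cone: "mat 1 1 (\<lambda>_. \<Sum>j\<le>k. os_smult T (e j) (g j)) \<in> os_cone T 1"
  shows "(\<lambda>(j, i, l). e j * (cnj (a i) * a l)) \<in> coeff_cone n"
proof -
  let ?A = "mat 1 n (\<lambda>(_, i). a i)"
  have "os_conj T ?A (mat 1 1 (\<lambda>_. \<Sum>j\<le>k. os_smult T (e j) (g j))) \<in> os_cone T n"
    by (rule T.cone_compat[OF _ n cone]) simp_all
  moreover have "os_conj T ?A (mat 1 1 (\<lambda>_. \<Sum>j\<le>k. os_smult T (e j) (g j))) = coeff_mat n (\<lambda>(j, i, l). e j * (cnj (a i) * a l))"
    by (rule eq_matI) (simp_all add: os_conj_def coeff_mat_def TV.scale_sum_right mult_ac)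
  ultimately show ?thesis
    by (subst coeff_cone_herm_iff[OF n]) (auto simp: e mult_ac)
qed

theorem positive_imp_completely_positive: "completely_positive (NCP k) T f"
  unfolding completely_positive_def
proof (intro allI impI ballI)
  fix n :: nat and X assume n: "n > 0" and X: "X \<in> os_cone (NCP k) n"
  define I where "I = {..k} \<times> {..<n} \<times> {..<n}"
  obtain c0 where c0: "\<And>i l. i < n \<Longrightarrow> l < n \<Longrightarrow> X $$ (i, l) = (\<Sum>j\<le>k. fam_smult (c0 j i l) (gen j))"
    "\<And>j i l. c0 j i l = cnj (c0 j l i)" using cone_coeffs[OF X] by blast
  define c where "c = (\<lambda>(j, i, l). c0 j i l)"
  have ch: "c (j, i, l) = cnj (c (j, l, i))" for j i l unfolding c_def using c0(2)[of j i l] by simp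
  have Xe: "O.entries n X" using X by (simp add: NCP_eq O.cone_iff)
  have fX: "map_mat f X = coeff_mat n c"
    by (rule eq_matI) (use Xe in \<open>auto simp: O.entries_def coeff_mat_def c_def c0(1) f_comb\<close>)
  show "map_mat f X \<in> os_cone T n"
  proof (rule ccontr)
    assume neg: "map_mat f X \<notin> os_cone T n"
    obtain \<epsilon> where \<epsilon>: "\<epsilon> > 0" "os_unit_mat T n \<epsilon> + coeff_mat n c \<notin> os_cone T n"
      using T.archimedean[OF n coeff_mat_herm[of c, OF ch]] neg fX by auto
    have nin: "(\<lambda>q. of_real \<epsilon> * unit_coeffs q + c q) \<notin> coeff_cone n"
    proof
      assume "(\<lambda>q. of_real \<epsilon> * unit_coeffs q + c q) \<in> coeff_cone n"
      then have "coeff_mat n (\<lambda>q. of_real \<epsilon> * unit_coeffs q + c q) \<in> os_cone T n"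
        by (subst (asm) coeff_cone_herm_iff[OF n]) (simp_all add: unit_coeffs_herm[symmetric] ch[symmetric])
      then show False using \<epsilon>(2) by (simp add: coeff_mat_add[symmetric] coeff_mat_unit_coeffs)
    qed
    obtain y where y: "\<And>u. u \<in> coeff_cone n \<Longrightarrow> Re (\<Sum>q\<in>I. y q * u q) \<ge> 0" "Re (\<Sum>q\<in>I. y q * c q) < 0"
    proof (rule complex_separation[of I "coeff_cone n" unit_coeffs \<epsilon> c])
      show "finite I" by (simp add: I_def)
      show "(\<lambda>i. 0) \<in> coeff_cone n" using coeff_cone_scale[OF n _ coeff_cone_unit_coeffs[OF n], of 0] by simp
      show "\<exists>r. (\<lambda>i. of_real r * unit_coeffs i + u i) \<in> coeff_cone n" for u using coeff_cone_unit[OF n] by blast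
      show "v \<in> coeff_cone n" if "u \<in> coeff_cone n" "\<And>i. i \<in> I \<Longrightarrow> u i = v i" for u v
        using coeff_cone_local[OF that(1)] that(2) by (simp add: I_def)
      show "(\<lambda>i. u i + v i) \<in> coeff_cone n" if "u \<in> coeff_cone n" "v \<in> coeff_cone n" for u v by (rule coeff_cone_add[OF n that])
      show "(\<lambda>i. of_real r * u i) \<in> coeff_cone n" if "r \<ge> 0" "u \<in> coeff_cone n" for r u by (rule coeff_cone_scale[OF n that])
      show "unit_coeffs \<in> coeff_cone n" by (rule coeff_cone_unit_coeffs[OF n])
    qed (use \<epsilon>(1) nin in blast)+
    have sum_I: "(\<Sum>q\<in>I. h q) = (\<Sum>j\<le>k. \<Sum>i<n. \<Sum>l<n. h (j, i, l))" for h :: "_ \<Rightarrow> complex"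
      by (simp add: I_def sum.cartesian_product split_beta)
    \<comment> \<open>the hermitian part of the functional, which agrees with the functional on hermitian tuples\<close>
    define r where "r = (\<lambda>j i l. (y (j, i, l) + cnj (y (j, l, i))) / 2)"
    have rh: "r j i l = cnj (r j l i)" for j i l by (simp add: r_def add.commute)
    have rq: "Re (qform n (r j) a a) = Re (qform n (\<lambda>i l. y (j, i, l)) a a)" for j a
      using qform_adjoint[of n "\<lambda>i l. y (j, i, l)" a]
      by (simp add: r_def qform_divide qform_add_kernel)
    \<comment> \<open>the functional is nonnegative at \<open>a\<^sup>*a \<otimes> t\<close> for every positive combination \<open>t\<close> of the generators\<close>
    have test: "(\<Sum>j\<le>k. e j * Re (qform n (r j) a a)) \<ge> 0"
      if "mat 1 1 (\<lambda>_. \<Sum>j\<le>k. os_smult T (of_real (e j)) (g j)) \<in> os_cone T 1" for e :: "nat \<Rightarrow> real" and a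
    proof -
      have "0 \<le> Re (\<Sum>q\<in>I. y q * (case q of (j, i, l) \<Rightarrow> of_real (e j) * (cnj (a i) * a l)))"
        by (rule y(1)[OF coeff_cone_rank_one[OF n _ that]]) simp
      also have "(\<Sum>q\<in>I. y q * (case q of (j, i, l) \<Rightarrow> of_real (e j) * (cnj (a i) * a l))) =
          (\<Sum>j\<le>k. of_real (e j) * qform n (\<lambda>i l. y (j, i, l)) a a)"
        unfolding sum_I qform_def by (simp add: sum_distrib_left mult_ac)
      also have "Re \<dots> = (\<Sum>j\<le>k. e j * Re (qform n (r j) a a))" by (simp add: rq)
      finally show ?thesis .
    qed
    have rj: "psd n (r j)" if "j < k" for j
    proof -
      have "(\<Sum>j'\<le>k. os_smult T (of_real (if j' = j then 1 else 0)) (g j')) = (\<Sum>j'\<le>k. if j' = j then g j' else 0)"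
        by (intro sum.cong) auto
      also have "\<dots> = f (w_proj j)" using that by (simp add: g_def gen_def)
      finally have *: "mat 1 1 (\<lambda>_. \<Sum>j'\<le>k. os_smult T (of_real (if j' = j then 1 else 0)) (g j')) \<in> os_cone T 1"
        using pos_1[OF w_proj_cone] by simp
      have "(\<Sum>j'\<le>k. (if j' = j then 1 else 0) * Re (qform n (r j') a a)) = Re (qform n (r j) a a)" for a
      proof -
        have "(\<Sum>j'\<le>k. (if j' = j then 1 else 0) * Re (qform n (r j') a a)) = (\<Sum>j'\<le>k. if j' = j then Re (qform n (r j') a a) else 0)"
          by (intro sum.cong) auto
        then show ?thesis using that by simp
      qed
      then show ?thesis using test[OF *] rh unfolding psd_def by metis
    qed
    have pm: "psd n (\<lambda>i l. ((\<Sum>j<k. r j i l) + of_real s * r k i l) / 2)" if s: "s = 1 \<or> s = - 1" for s :: real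
    proof -
      have "complex_of_real s = 1 \<or> complex_of_real s = - 1" using s by auto
      from pos_1[OF one_pm_v_cone[OF this]]
      have *: "mat 1 1 (\<lambda>_. \<Sum>j\<le>k. os_smult T (of_real (if j < k then 1 else s)) (g j)) \<in> os_cone T 1"
        unfolding f_pm by (simp add: if_distrib[of of_real] cong: if_cong)
      have "(\<Sum>j<k. r j i l) + of_real s * r k i l = (\<Sum>j\<le>k. of_real (if j < k then 1 else s) * r j i l)" for i l
        by (simp add: lessThan_Suc_atMost[symmetric])
      then have eq: "Re (qform n (\<lambda>i l. ((\<Sum>j<k. r j i l) + of_real s * r k i l) / 2) a a) =
          (\<Sum>j\<le>k. (if j < k then 1 else s) * Re (qform n (r j) a a)) / 2" for a
        by (simp add: qform_divide qform_sum)
      have "Re (qform n (\<lambda>i l. ((\<Sum>j<k. r j i l) + of_real s * r k i l) / 2) a a) \<ge> 0" for a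
        unfolding eq using test[OF *, of a] by simp
      moreover have "((\<Sum>j<k. r j i l) + of_real s * r k i l) / 2 = cnj (((\<Sum>j<k. r j l i) + of_real s * r k l i) / 2)" for i l
        by (simp add: rh[symmetric])
      ultimately show ?thesis unfolding psd_def by blast
    qed
    have plus: "psd n (\<lambda>i l. ((\<Sum>j<k. r j i l) + r k i l) / 2)" using pm[of 1] by simp
    have minus: "psd n (\<lambda>i l. ((\<Sum>j<k. r j i l) - r k i l) / 2)" using pm[of "-1"] by simp
    obtain \<pi> \<xi> where \<pi>: "unitary_rep G \<pi>" and \<xi>: "\<And>i. \<xi> i \<in> l2"
      and real: "\<And>i l j. i < n \<Longrightarrow> l < n \<Longrightarrow> j \<le> k \<Longrightarrow> l2_inner (\<xi> i) (gen j \<pi> (\<xi> l)) = r j i l"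
      using realise_functional[of n r, OF rj plus minus] by blast
    \<comment> \<open>evaluating the form of \<open>X\<close> at \<open>\<xi>\<close> gives the value of the functional at the coefficients of \<open>X\<close>\<close>
    have "form n X \<pi> \<xi> \<xi> = (\<Sum>i<n. \<Sum>l<n. \<Sum>j\<le>k. r j i l * c (j, i, l))"
      unfolding form_def
    proof (intro sum.cong refl)
      fix i l assume "i \<in> {..<n}" "l \<in> {..<n}"
      then have il: "i < n" "l < n" by auto
      have gl: "gen j \<pi> (\<xi> l) \<in> l2" for j by (rule opf_l2[OF NCP_space_op[OF gen_in] \<pi> \<xi>])
      have "l2_inner (\<xi> i) ((X $$ (i, l)) \<pi> (\<xi> l)) = l2_inner (\<xi> i) (\<Sum>j\<le>k. scal (c (j, i, l)) (gen j \<pi> (\<xi> l)))"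
        unfolding c0(1)[OF il] by (simp add: sum_apply fam_smult_apply c_def)
      also have "\<dots> = (\<Sum>j\<le>k. l2_inner (\<xi> i) (scal (c (j, i, l)) (gen j \<pi> (\<xi> l))))"
        by (rule inner_sum_right[OF \<xi> l2_scal[OF gl]])
      also have "\<dots> = (\<Sum>j\<le>k. r j i l * c (j, i, l))"
        by (intro sum.cong refl) (simp add: inner_scal_right[OF \<xi> gl] real[OF il] mult.commute)
      finally show "l2_inner (\<xi> i) ((X $$ (i, l)) \<pi> (\<xi> l)) = (\<Sum>j\<le>k. r j i l * c (j, i, l))" .
    qed
    also have "\<dots> = (\<Sum>i<n. \<Sum>j\<le>k. \<Sum>l<n. r j i l * c (j, i, l))"
      by (rule sum.cong[OF refl sum.swap])
    also have "\<dots> = (\<Sum>j\<le>k. \<Sum>i<n. \<Sum>l<n. r j i l * c (j, i, l))"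
      by (rule sum.swap)
    also have "Re \<dots> = Re (\<Sum>q\<in>I. y q * c q)"
      unfolding sum_I Re_sum[of _ "{..k}"]
    proof (intro sum.cong refl)
      fix j
      let ?S = "\<Sum>i<n. \<Sum>l<n. y (j, i, l) * c (j, i, l)"
      have "(\<Sum>i<n. \<Sum>l<n. cnj (y (j, l, i)) * c (j, i, l)) = (\<Sum>l<n. \<Sum>i<n. cnj (y (j, l, i)) * c (j, i, l))"
        by (rule sum.swap)
      also have "\<dots> = (\<Sum>l<n. \<Sum>i<n. cnj (y (j, l, i) * c (j, l, i)))"
        by (simp add: ch[symmetric])
      also have "\<dots> = cnj ?S" by simp
      finally have S: "(\<Sum>i<n. \<Sum>l<n. cnj (y (j, l, i)) * c (j, i, l)) = cnj ?S" .
      have "(\<Sum>i<n. \<Sum>l<n. r j i l * c (j, i, l)) =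
          (?S + (\<Sum>i<n. \<Sum>l<n. cnj (y (j, l, i)) * c (j, i, l))) / 2"
        by (simp add: r_def add_divide_distrib distrib_right sum.distrib sum_divide_distrib)
      then have H: "(\<Sum>i<n. \<Sum>l<n. r j i l * c (j, i, l)) = (?S + cnj ?S) / 2"
        unfolding S .
      have "Re ((z + cnj z) / 2) = Re z" for z by simp
      then show "Re (\<Sum>i<n. \<Sum>l<n. r j i l * c (j, i, l)) = Re ?S" unfolding H .
    qed
    finally have "Re (form n X \<pi> \<xi> \<xi>) < 0" using y(2) by simp
    moreover have "Re (form n X \<pi> \<xi> \<xi>) \<ge> 0" using X \<pi> \<xi> by (auto simp: NCP_eq O.cone_iff)
    ultimately show False by simp
  qed
qed

end

theorem theorem5p4:
  fixes k :: nat
  assumes "k \<ge> 3"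
  shows "is_omax TYPE('b::ab_group_add) (NCP k) (NCP k)"
proof -
  interpret ncp k by unfold_locales (use assms in simp)
  have "completely_positive (NCP k) T f"
    if "operator_system T" "os_linear (NCP k) T f" "os_unital (NCP k) T f" "os_positive (NCP k) T f"
    for T :: "'b os" and f
  proof -
    interpret ncp_map k T f
      by (intro ncp_map.intro ncp_map_axioms.intro that) unfold_locales
    show ?thesis by (rule positive_imp_completely_positive)
  qed
  then show ?thesis unfolding is_omax_def using operator_system_NCP by blast
qed

end
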